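(* Let $p>2$. Let $X_1,X_2,\dots$ be a short-memory linear process $X_i=\sum_{j=0}^\infty\psi_j\eta_{i-j}$, let $Y_{nj}=\mu_{nj}+X_j$, $j=1,\dots,n$, and let $T_n=T_n(Y_{n1},\dots,Y_{nn})$ be the statistic $$T_n=\sup_{d\ge1}\ \sup_{(\tau_k)\in\mathcal T_d}\|\boldsymbol Q_n\widehat{\boldsymbol\beta}(\tau)\|_p =\sup_{d\ge1}\ \sup_{(\tau_k)\in\mathcal T_d}\Big(\sum_{k=1}^d\Big|\sum_{j=1}^nY_{nj}\mathbf 1_{(\tau_{k-1},\tau_k]}(j/n)\Big|^p\Big)^{1/p}.$$ Under the null hypothesis $H_0:\ \mu_{n1}=\dots=\mu_{nn}=0$ it holds that $$n^{-1/2}|A_\psi|^{-1}\sigma_\eta^{-1}T_n\xrightarrow{\mathscr D}\|W\|_{(p)}\qquad\text{as }n\to\infty,$$ where $W$ is a Wiener process on $[0,1]$ and $\xrightarrow{\mathscr D}$ denotes convergence in distribution.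
   Context: Short-memory linear process: $(\eta_j)_{j\in\mathbb Z}$ are i.i.d. real random variables on a probability space $(\Omega,\mathcal A,\mathsf P)$ with mean zero and finite variance $\sigma_\eta^2=\mathsf E\eta_1^2\neq0$ ($\sigma_\eta>0$); $(\psi_j)_{j\ge0}$ are real numbers with $\sum_{j\ge0}|\psi_j|<\infty$ and $A_\psi:=\sum_{j\ge0}\psi_j\ne0$; and $X_i=\sum_{j=0}^\infty\psi_j\eta_{i-j}$ for $i\in\mathbb Z$. $\mathcal T_d$ is the set of all partitions $\tau=(\tau_k)$ of $[0,1]$ with $0=\tau_0<\tau_1<\dots<\tau_d=1$. For $\tau\in\mathcal T_d$ and $I_k=(\tau_{k-1},\tau_k]$, $\widehat{\boldsymbol\beta}(\tau)$ is the least squares estimator of $\boldsymbol\beta=[\beta_1,\dots,\beta_d]'$ in the model $Y_{nj}=\sum_{k=1}^d\beta_k\mathbf 1_{I_k}(j/n)+X_j$, i.e. $\widehat{\boldsymbol\beta}=\boldsymbol Q_n^{-1}\big[\sum_{j=1}^nY_{nj}\mathbf 1_{I_1}(j/n),\dots,\sum_{j=1}^nY_{nj}\mathbf 1_{I_d}(j/n)\big]'$ with $\boldsymbol Q_n=\mathrm{diag}\{\lfloor\tau_kn\rfloor-\lfloor\tau_{k-1}n\rfloor,\ k=1,\dots,d\}$; $\|\cdot\|_p$ is the $\ell_p$-norm on $\mathbb R^d$. (When $\boldsymbol Q_n$ is singular, $\boldsymbol Q_n\widehat{\boldsymbol\beta}$ is understood as the vector of the sums $\sum_{j=1}^nY_{nj}\mathbf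 1_{I_k}(j/n)$.) $\|g\|_{(p)}=\sup\{(\sum_{i=1}^m|g(t_i)-g(t_{i-1})|^p)^{1/p}:0=t_0<\dots<t_m=1,\ m\ge1\}$. *)

theory Defs
  imports "HOL-Probability.Probability"
begin

definition linear_process :: "(nat \<Rightarrow> real) \<Rightarrow> (int \<Rightarrow> 'a \<Rightarrow> real) \<Rightarrow> int \<Rightarrow> 'a \<Rightarrow> real" where
  "linear_process \<psi> \<eta> i \<omega> = (\<Sum>j. \<psi> j * \<eta> (i - int j) \<omega>)"

(* Sample paths are continuous and start at 0 surely, not just almost surely, so that
   functionals of the whole path are measurable without completing the measure. *)
definition wiener_process :: "'b measure \<Rightarrow> (real \<Rightarrow> 'b \<Rightarrow> real) \<Rightarrow> bool" where
  "wiener_process N W \<longleftrightarrow>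
     prob_space N \<and>
     (\<forall>t\<in>{0..1}. W t \<in> borel_measurable N) \<and>
     (\<forall>\<omega>\<in>space N. W 0 \<omega> = 0) \<and>
     (\<forall>\<omega>\<in>space N. continuous_on {0..1} (\<lambda>t. W t \<omega>)) \<and>
     (\<forall>s t. 0 \<le> s \<and> s < t \<and> t \<le> 1 \<longrightarrow>
        distributed N lborel (\<lambda>\<omega>. W t \<omega> - W s \<omega>) (normal_density 0 (sqrt (t - s)))) \<and>
     (\<forall>(m::nat) t. 0 \<le> t 0 \<and> t m \<le> 1 \<and> strict_mono_on {..m} t \<longrightarrow>
        prob_space.indep_vars N (\<lambda>_. borel) (\<lambda>i \<omega>. W (t (Suc i)) \<omega> - W (t i) \<omega>) {..<m})"

definition unit_partition :: "nat \<Rightarrow> (nat \<Rightarrow> real) \<Rightarrow> bool" where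
  "unit_partition d \<tau> \<longleftrightarrow> 1 \<le> d \<and> \<tau> 0 = 0 \<and> \<tau> d = 1 \<and> strict_mono_on {..d} \<tau>"

(* Vectors in R^d are functions on the index set {1..d}. *)
definition lp_norm :: "real \<Rightarrow> nat \<Rightarrow> (nat \<Rightarrow> real) \<Rightarrow> real" where
  "lp_norm p d v = (\<Sum>k=1..d. \<bar>v k\<bar> powr p) powr (1 / p)"

definition p_variation :: "real \<Rightarrow> (real \<Rightarrow> real) \<Rightarrow> ennreal" where
  "p_variation p g =
     (SUP (m, t) \<in> {(m, t). unit_partition m t}.
        ennreal (lp_norm p m (\<lambda>i. g (t i) - g (t (i - 1)))))"

definition block_sum :: "nat \<Rightarrow> (nat \<Rightarrow> real) \<Rightarrow> (nat \<Rightarrow> real) \<Rightarrow> nat \<Rightarrow> real" where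
  "block_sum n y \<tau> k = (\<Sum>j=1..n. y j * indicator {\<tau> (k - 1)<..\<tau> k} (real j / real n))"

(* The indicators of the blocks have disjoint supports, so the Gram matrix Q_n of the regression
   on them is diagonal; this is its k-th diagonal entry, the number of j in {1..n} with j/n in
   the k-th block. *)
definition Q_diag :: "nat \<Rightarrow> (nat \<Rightarrow> real) \<Rightarrow> nat \<Rightarrow> real" where
  "Q_diag n \<tau> k = of_int (\<lfloor>\<tau> k * real n\<rfloor> - \<lfloor>\<tau> (k - 1) * real n\<rfloor>)"

(* Least squares coefficients Q_n^{-1} [block sums].  Where the diagonal entry is 0, the block
   contains no j/n and division by zero yields 0, so Q_n times the estimator is the vector of
   block sums also for singular Q_n: see Q_diag_mult_lse below. *)
definition lse :: "nat \<Rightarrow> (nat \<Rightarrow> real) \<Rightarrow> (nat \<Rightarrow> real) \<Rightarrow> nat \<Rightarrow> real" where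
  "lse n y \<tau> k = block_sum n y \<tau> k / Q_diag n \<tau> k"

(* A supremum of reals; the set is bounded above by bdd_above_test_statistic below. *)
definition test_statistic :: "real \<Rightarrow> nat \<Rightarrow> (nat \<Rightarrow> real) \<Rightarrow> real" where
  "test_statistic p n y =
     (SUP (d, \<tau>) \<in> {(d, \<tau>). unit_partition d \<tau>}.
        lp_norm p d (\<lambda>k. Q_diag n \<tau> k * lse n y \<tau> k))"

definition converges_in_distribution ::
    "'a measure \<Rightarrow> (nat \<Rightarrow> 'a \<Rightarrow> real) \<Rightarrow> 'b measure \<Rightarrow> ('b \<Rightarrow> real) \<Rightarrow> bool" where
  "converges_in_distribution M Z N L \<longleftrightarrow>
     (\<forall>n. Z n \<in> borel_measurable M) \<and> L \<in> borel_measurable N \<and>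
     weak_conv_m (\<lambda>n. distr M borel (Z n)) (distr N borel L)"

lemma Q_diag_mult_lse: "Q_diag n \<tau> k * lse n y \<tau> k = block_sum n y \<tau> k"
proof (cases "Q_diag n \<tau> k = 0")
  case True
  have "real j / real n \<notin> {\<tau> (k - 1)<..\<tau> k}" if "j \<in> {1..n}" for j
  proof
    assume *: "real j / real n \<in> {\<tau> (k - 1)<..\<tau> k}"
    have n: "real n > 0" using that by auto
    from * n have "\<tau> (k - 1) * real n < real j" "real j \<le> \<tau> k * real n"
      by (auto simp: field_simps)
    then have "\<lfloor>\<tau> (k - 1) * real n\<rfloor> < int j" "int j \<le> \<lfloor>\<tau> k * real n\<rfloor>"
      by (auto simp: floor_less_iff le_floor_iff)
    then show False using True unfolding Q_diag_def by linarith
  qed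
  then have "block_sum n y \<tau> k = 0"
    unfolding block_sum_def by (intro sum.neutral) auto
  then show ?thesis using True by simp
next
  case False
  then show ?thesis by (simp add: lse_def)
qed

lemma test_statistic_eq:
  "test_statistic p n y =
     (SUP (d, \<tau>) \<in> {(d, \<tau>). unit_partition d \<tau>}.
        (\<Sum>k=1..d. \<bar>\<Sum>j=1..n. y j * indicator {\<tau> (k - 1)<..\<tau> k} (real j / real n)\<bar> powr p)
          powr (1 / p))"
  unfolding test_statistic_def Q_diag_mult_lse lp_norm_def block_sum_def ..

lemma sum_indicator_blocks:
  assumes "strict_mono_on {..d} (\<tau> :: nat \<Rightarrow> real)"
  shows "(\<Sum>k=1..d. indicator {\<tau> (k - 1)<..\<tau> k} x :: real) = indicator {\<tau> 0<..\<tau> d} x"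
  using assms
proof (induction d)
  case 0
  then show ?case by simp
next
  case (Suc d)
  have "strict_mono_on {..d} \<tau>"
    using Suc.prems by (auto simp: strict_mono_on_def)
  moreover have "\<tau> d < \<tau> (Suc d)"
    using Suc.prems by (auto simp: strict_mono_on_def)
  moreover have "\<tau> 0 \<le> \<tau> d"
    using Suc.prems by (cases "d = 0") (auto simp: strict_mono_on_def intro!: less_imp_le)
  ultimately show ?case
    using Suc.IH by (auto simp: indicator_def)
qed

lemma bdd_above_test_statistic:
  assumes "p \<ge> 1"
  shows "bdd_above ((\<lambda>(d, \<tau>). lp_norm p d (\<lambda>k. Q_diag n \<tau> k * lse n y \<tau> k)) `
           {(d, \<tau>). unit_partition d \<tau>})"
proof -
  define B where "B = (\<Sum>j=1..n. \<bar>y j\<bar>)"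
  have B0: "0 \<le> B" unfolding B_def by (simp add: sum_nonneg)
  have "lp_norm p d (\<lambda>k. Q_diag n \<tau> k * lse n y \<tau> k) \<le> (B * B powr (p - 1)) powr (1 / p)"
    if "unit_partition d \<tau>" for d \<tau>
  proof -
    define a where "a k = (\<Sum>j=1..n. \<bar>y j\<bar> * indicator {\<tau> (k - 1)<..\<tau> k} (real j / real n))" for k
    have le_a: "\<bar>block_sum n y \<tau> k\<bar> \<le> a k" for k
      unfolding block_sum_def a_def
      by (rule order_trans[OF sum_abs]) (auto simp: abs_mult intro!: sum_mono)
    have a0: "0 \<le> a k" for k unfolding a_def by (auto intro!: sum_nonneg)
    have aB: "a k \<le> B" for k
      unfolding a_def B_def by (intro sum_mono) (simp add: indicator_def)
    have "(\<Sum>k=1..d. a k) = (\<Sum>j=1..n. \<bar>y j\<bar> * (\<Sum>k=1..d. indicator {\<tau> (k - 1)<..\<tau> k} (real j / real n)))"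
      unfolding a_def sum_distrib_left by (rule sum.swap)
    also have "\<dots> = (\<Sum>j=1..n. \<bar>y j\<bar> * indicator {\<tau> 0<..\<tau> d} (real j / real n))"
      using that by (subst sum_indicator_blocks) (auto simp: unit_partition_def)
    also have "\<dots> \<le> B"
      unfolding B_def by (intro sum_mono) (simp add: indicator_def)
    finally have sum_a: "(\<Sum>k=1..d. a k) \<le> B" .
    have "\<bar>block_sum n y \<tau> k\<bar> powr p \<le> a k * B powr (p - 1)" for k
    proof -
      have "\<bar>block_sum n y \<tau> k\<bar> powr p \<le> a k powr p"
        using le_a assms by (intro powr_mono2) auto
      also have "\<dots> = a k * a k powr (p - 1)"
        using a0 powr_mult_base[of "a k" "p - 1"] by simp
      also have "\<dots> \<le> a k * B powr (p - 1)"
        using a0 aB assms by (intro mult_left_mono powr_mono2) auto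
      finally show ?thesis .
    qed
    then have "(\<Sum>k=1..d. \<bar>block_sum n y \<tau> k\<bar> powr p) \<le> (\<Sum>k=1..d. a k * B powr (p - 1))"
      by (intro sum_mono)
    also have "\<dots> = (\<Sum>k=1..d. a k) * B powr (p - 1)" by (simp add: sum_distrib_right)
    also have "\<dots> \<le> B * B powr (p - 1)"
      using sum_a by (intro mult_right_mono) auto
    finally show ?thesis
      unfolding lp_norm_def Q_diag_mult_lse using assms
      by (intro powr_mono2) (auto intro!: sum_nonneg)
  qed
  then show ?thesis by (intro bdd_aboveI) auto
qed

end

theory Submission
  imports Defs
begin

text \<open>
  As a function of the observations, the statistic is a seminorm: the discrete \<open>p\<close>-variation of their
  partial sums. The key estimate bounds the \<open>q\<close>-variation of sums \<open>S\<close> of \<open>n\<close> independent centred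
  variables of variance at most \<open>v\<close>, for every \<open>q > 2\<close>. Let \<open>N\<^sub>\<lambda>\<close> be the number of restarts when the walk
  is reset to \<open>0\<close> each time it leaves \<open>(-\<lambda>, \<lambda>)\<close>. Pathwise \<open>V\<^sub>q(S)\<^sup>q\<close> is at most a dyadic sum of
  \<open>(4\<lambda>)\<^sup>q N\<^sub>\<lambda>\<close>, and orthogonality of the increments gives \<open>\<lambda>\<^sup>2 E N\<^sub>\<lambda> \<le> n v\<close>, so that
  \<open>E V\<^sub>q(S) \<le> C sqrt(n v)\<close>.

  By this estimate and subadditivity, the linear process can be replaced by \<open>A\<^sub>\<psi> \<eta>\<close> at a cost
  \<open>o(sqrt n)\<close> in \<open>L\<^sup>1\<close>, without a Beveridge-Nelson decomposition. Interpolating between a \<open>q < p\<close> and the supremum norm,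
  the \<open>p\<close>-variation of the random walk is then approximated by that of its values at \<open>m\<close> equidistant times,
  uniformly in \<open>n\<close>. For fixed \<open>m\<close> the central limit theorem applies, and as \<open>m\<close> grows the
  grid \<open>p\<close>-variation of \<open>W\<close> converges to its \<open>p\<close>-variation.
\<close>

section \<open>The statistic as a discrete \<open>p\<close>-variation\<close>

text \<open>The p-variation is not continuous in the supremum norm, so uniform convergence of the
  partial sum paths would not by itself give the limit. Control of the q-variation for some q
  strictly between 2 and p is the missing compactness: given such control, a uniformly small path
  also has small p-variation, and the central limit theorem for finitely many blocks is all that
  remains to be used. The variance alone does not control the oscillation inside m blocks: it bounds
  each of the m probabilities by order 1/m, and their sum does not shrink with m. The noise is
  therefore split into a bounded centred part, whose fourth moments give order 1/m^2 per block, and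
  a centred part of small variance. The same splitting makes a lag by j negligible: for noise
  bounded by b the lag moves every partial sum by at most 2 j b, and interpolation with the
  1-variation yields order n^(1/p), which is o(sqrt n) because p > 2. The lags are then summed by
  dominated convergence with weights |psi_j|.\<close>

lemma powr_convex_nonneg:
  fixes u v t p :: real
  assumes "p \<ge> 1" "0 \<le> u" "0 \<le> v" "0 \<le> t" "t \<le> 1"
  shows "(t * u + (1 - t) * v) powr p \<le> t * u powr p + (1 - t) * v powr p"
proof -
  \<comment> \<open>On [0,1] the power s^p is at most s, which is the convexity inequality with one
    endpoint at 0.\<close>
  have z: "(s * w) powr p \<le> s * w powr p" if "0 \<le> s" "s \<le> 1" "0 \<le> w" for s w :: real
  proof -
    have "s powr p \<le> s powr 1"
      using that assms(1) by (intro powr_mono') auto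
    then show ?thesis
      using that by (auto simp: powr_mult intro!: mult_right_mono)
  qed
  consider "u = 0" | "v = 0" | "u > 0" "v > 0" using assms by linarith
  then show ?thesis
  proof cases
    case 1 then show ?thesis using z[of "1 - t" v] assms by simp
  next
    case 2 then show ?thesis using z[of t u] assms by simp
  next
    case 3
    then show ?thesis
      using convex_onD[OF powr_convex[OF assms(1)], of "1 - t" u v] assms by (simp add: algebra_simps)
  qed
qed

lemma lp_norm_nonneg: "0 \<le> lp_norm p d v"
  by (simp add: lp_norm_def)

lemma lp_norm_powr: "p \<ge> 1 \<Longrightarrow> lp_norm p d v powr p = (\<Sum>k=1..d. \<bar>v k\<bar> powr p)"
  unfolding lp_norm_def powr_powr by (simp add: sum_nonneg)

lemma lp_norm_le_iff:
  assumes "p \<ge> 1" "0 \<le> B"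
  shows "lp_norm p d v \<le> B \<longleftrightarrow> (\<Sum>k=1..d. \<bar>v k\<bar> powr p) \<le> B powr p"
proof -
  have "lp_norm p d v \<le> B \<longleftrightarrow> lp_norm p d v powr p \<le> B powr p"
    using assms powr_mono2[of p "lp_norm p d v" B] powr_less_mono2[of p B "lp_norm p d v"]
    by (meson lp_norm_nonneg linorder_not_less order_trans zero_le_one less_le_trans zero_less_one less_imp_le)
  then show ?thesis using lp_norm_powr[OF assms(1)] by simp
qed

lemma lp_norm_cong: "(\<And>k. 1 \<le> k \<Longrightarrow> k \<le> d \<Longrightarrow> \<bar>v k\<bar> = \<bar>w k\<bar>) \<Longrightarrow> lp_norm p d v = lp_norm p d w"
  unfolding lp_norm_def by (intro arg_cong2[where f="(powr)"] sum.cong) auto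

lemma lp_norm_scale: "p \<ge> 1 \<Longrightarrow> lp_norm p d (\<lambda>k. c * v k) = \<bar>c\<bar> * lp_norm p d v"
  unfolding lp_norm_def
  by (simp add: abs_mult powr_mult sum_distrib_left[symmetric] powr_powr sum_nonneg)

text \<open>The strict upper bounds \<open>a\<close>, \<open>b\<close> in the proof avoid dividing by a vanishing norm.\<close>
lemma lp_norm_triangle:
  assumes p: "p \<ge> 1"
  shows "lp_norm p d (\<lambda>k. v k + w k) \<le> lp_norm p d v + lp_norm p d w"
proof (rule field_le_epsilon)
  fix e :: real assume e: "0 < e"
  define a b where "a = lp_norm p d v + e / 2" and "b = lp_norm p d w + e / 2"
  have ab: "a > 0" "b > 0" using e lp_norm_nonneg[of p d] by (auto simp: a_def b_def add_nonneg_pos)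
  have va: "(\<Sum>k=1..d. (\<bar>v k\<bar> / a) powr p) \<le> 1"
  proof -
    have "(\<Sum>k=1..d. \<bar>v k\<bar> powr p) \<le> a powr p"
      using lp_norm_le_iff[of p a d v] p ab e by (simp add: a_def)
    then show ?thesis using ab by (simp add: powr_divide sum_divide_distrib[symmetric])
  qed
  have wb: "(\<Sum>k=1..d. (\<bar>w k\<bar> / b) powr p) \<le> 1"
  proof -
    have "(\<Sum>k=1..d. \<bar>w k\<bar> powr p) \<le> b powr p"
      using lp_norm_le_iff[of p b d w] p ab e by (simp add: b_def)
    then show ?thesis using ab by (simp add: powr_divide sum_divide_distrib[symmetric])
  qed
  \<comment> \<open>With this weight, |v k| + |w k| is (a + b) times a convex combination of |v k| /
    a and |w k| / b, whose p-th powers sum to at most 1 each.\<close>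
  define t where "t = a / (a + b)"
  have t: "0 \<le> t" "t \<le> 1" "1 - t = b / (a + b)" using ab by (auto simp: t_def field_simps)
  have "\<bar>v k + w k\<bar> powr p \<le> (a + b) powr p * (t * (\<bar>v k\<bar> / a) powr p + (1 - t) * (\<bar>w k\<bar> / b) powr p)" for k
  proof -
    have "\<bar>v k + w k\<bar> powr p \<le> (\<bar>v k\<bar> + \<bar>w k\<bar>) powr p" using p by (intro powr_mono2) auto
    also have "\<bar>v k\<bar> + \<bar>w k\<bar> = (a + b) * (t * (\<bar>v k\<bar> / a) + (1 - t) * (\<bar>w k\<bar> / b))"
    proof -
      have "(a + b) * (t * (\<bar>v k\<bar> / a)) = \<bar>v k\<bar>" "(a + b) * ((1 - t) * (\<bar>w k\<bar> / b)) = \<bar>w k\<bar>"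
        unfolding t(3) unfolding t_def using ab by auto
      then show ?thesis by (simp only: distrib_left)
    qed
    also have "\<dots> powr p = (a + b) powr p * (t * (\<bar>v k\<bar> / a) + (1 - t) * (\<bar>w k\<bar> / b)) powr p"
      using ab t by (intro powr_mult) 
    also have "\<dots> \<le> (a + b) powr p * (t * (\<bar>v k\<bar> / a) powr p + (1 - t) * (\<bar>w k\<bar> / b) powr p)"
      using p ab t by (intro mult_left_mono powr_convex_nonneg) auto
    finally show ?thesis .
  qed
  then have "(\<Sum>k=1..d. \<bar>v k + w k\<bar> powr p)
      \<le> (\<Sum>k=1..d. (a + b) powr p * (t * (\<bar>v k\<bar> / a) powr p + (1 - t) * (\<bar>w k\<bar> / b) powr p))"
    by (intro sum_mono)
  also have "\<dots> = (a + b) powr p * (t * (\<Sum>k=1..d. (\<bar>v k\<bar> / a) powr p) + (1 - t) * (\<Sum>k=1..d. (\<bar>w k\<bar> / b) powr p))"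
    by (simp only: sum.distrib sum_distrib_left[symmetric])
  also have "\<dots> \<le> (a + b) powr p * (t * 1 + (1 - t) * 1)"
    using t va wb by (intro mult_left_mono add_mono) auto
  finally have "(\<Sum>k=1..d. \<bar>v k + w k\<bar> powr p) \<le> (a + b) powr p" by simp
  then have "lp_norm p d (\<lambda>k. v k + w k) \<le> a + b"
    using ab p by (subst lp_norm_le_iff) auto
  then show "lp_norm p d (\<lambda>k. v k + w k) \<le> lp_norm p d v + lp_norm p d w + e"
    by (simp add: a_def b_def)
qed

text \<open>Minkowski's inequality applied to the decomposition into coordinate vectors, one
  coordinate per induction step.\<close>

lemma lp_norm_le_l1:
  assumes "p \<ge> 1" shows "lp_norm p d v \<le> (\<Sum>k=1..d. \<bar>v k\<bar>)"
proof (induction d)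
  case 0 then show ?case by (simp add: lp_norm_def)
next
  case (Suc d)
  have "lp_norm p (Suc d) v = lp_norm p (Suc d) (\<lambda>k. v k * of_bool (k \<le> d) + v k * of_bool (k = Suc d))"
    by (rule lp_norm_cong) auto
  also have "\<dots> \<le> lp_norm p (Suc d) (\<lambda>k. v k * of_bool (k \<le> d)) + lp_norm p (Suc d) (\<lambda>k. v k * of_bool (k = Suc d))"
    by (rule lp_norm_triangle[OF assms])
  also have "lp_norm p (Suc d) (\<lambda>k. v k * of_bool (k \<le> d)) = lp_norm p d v"
    by (simp add: lp_norm_def)
  also have "lp_norm p (Suc d) (\<lambda>k. v k * of_bool (k = Suc d)) = \<bar>v (Suc d)\<bar>"
    using assms by (simp add: lp_norm_def powr_powr)
  finally show ?case using Suc by simp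
qed

section \<open>Partial sums, and index sequences in place of partitions\<close>

definition psum :: "(nat \<Rightarrow> real) \<Rightarrow> nat \<Rightarrow> real" where
  "psum y k = (\<Sum>j=1..k. y j)"

lemma psum_0 [simp]: "psum y 0 = 0" and psum_Suc [simp]: "psum y (Suc k) = psum y k + y (Suc k)"
  by (simp_all add: psum_def)

lemma psum_diff: "i \<le> j \<Longrightarrow> psum y j - psum y i = (\<Sum>l\<in>{i<..j}. y l)"
proof -
  assume "i \<le> j"
  then have "{1..j} = {1..i} \<union> {i<..j}" by auto
  then show ?thesis by (simp add: psum_def sum.union_disjoint ivl_disj_int)
qed

lemma nat_floor_mono: "x \<le> y \<Longrightarrow> nat \<lfloor>x\<rfloor> \<le> nat \<lfloor>y\<rfloor>"
  by (simp add: floor_mono nat_mono)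

lemma unit_partition_mono:
  assumes "unit_partition d \<tau>" "i \<le> j" "j \<le> d" shows "\<tau> i \<le> \<tau> j"
  using assms by (cases "i = j") (auto simp: unit_partition_def strict_mono_on_def intro: less_imp_le)

text \<open>The condition that j/n lies in a half-open block cuts out the integers j between the two
  floors, the left one excluded. A partition thus acts on the data only through the floors of its
  points times n.\<close>

lemma block_sum_eq:
  assumes "unit_partition d \<tau>" "1 \<le> i" "i \<le> d"
  shows "block_sum n y \<tau> i = psum y (nat \<lfloor>\<tau> i * n\<rfloor>) - psum y (nat \<lfloor>\<tau> (i - 1) * n\<rfloor>)"
proof -
  have le: "\<tau> (i - 1) \<le> \<tau> i" "0 \<le> \<tau> (i - 1)" "\<tau> i \<le> 1"
    using unit_partition_mono[OF assms(1), of "i - 1" i] unit_partition_mono[OF assms(1), of 0 "i - 1"]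
      unit_partition_mono[OF assms(1), of i d] assms by (auto simp: unit_partition_def)
  have "\<tau> i * real n \<le> 1 * real n" using le by (intro mult_right_mono) auto
  then have "nat \<lfloor>\<tau> i * n\<rfloor> \<le> n" by linarith
  then have *: "{nat \<lfloor>\<tau> (i - 1) * n\<rfloor><..nat \<lfloor>\<tau> i * n\<rfloor>}
      = {j\<in>{1..n}. real j / real n \<in> {\<tau> (i - 1)<..\<tau> i}}" (is "?A = ?B")
  proof (intro equalityI subsetI)
    fix j assume j: "j \<in> ?A"
    then have "j \<in> {1..n}" using \<open>nat \<lfloor>\<tau> i * n\<rfloor> \<le> n\<close> by auto
    moreover have "\<tau> (i - 1) * n < j" "j \<le> \<tau> i * n"
      using j le by (auto simp: nat_less_iff le_nat_iff floor_less_iff le_floor_iff)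
    ultimately show "j \<in> ?B" by (auto simp: field_simps)
  next
    fix j assume j: "j \<in> ?B"
    then have "\<tau> (i - 1) * n < j" "j \<le> \<tau> i * n" by (auto simp: field_simps)
    moreover have "0 \<le> \<tau> (i - 1) * n" "0 \<le> \<tau> i * n" using le by auto
    ultimately show "j \<in> ?A" by (auto simp: nat_less_iff le_nat_iff floor_less_iff le_floor_iff)
  qed
  have "block_sum n y \<tau> i = (\<Sum>j\<in>?B. y j)"
    unfolding block_sum_def sum.inter_filter[OF finite_atLeastAtMost] by (intro sum.cong) (auto simp: indicator_def)
  also have "\<dots> = psum y (nat \<lfloor>\<tau> i * n\<rfloor>) - psum y (nat \<lfloor>\<tau> (i - 1) * n\<rfloor>)"
    unfolding *[symmetric] using le by (intro psum_diff[symmetric] nat_floor_mono mult_right_mono) auto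
  finally show ?thesis .
qed

text \<open>The embedding \<open>real\<close> serves as the trivial partition 0 < 1; it shows that
  the suprema range over a nonempty set.\<close>

lemma unit_partition_1: "unit_partition (Suc 0) real"
  by (simp add: unit_partition_def strict_mono_on_def)

text \<open>The partitions of \<open>[0,1]\<close> enter the statistic only through the weakly increasing index
  sequences \<open>k\<close> from \<open>0\<close> to \<open>n\<close>; repeated indices contribute vanishing blocks.\<close>
lemma test_statistic_le:
  assumes "\<And>d k. mono k \<Longrightarrow> k 0 = 0 \<Longrightarrow> k d = n \<Longrightarrow>
    lp_norm p d (\<lambda>i. psum y (k i) - psum y (k (i - 1))) \<le> B"
  shows "test_statistic p n y \<le> B"
  unfolding test_statistic_def
proof (rule cSUP_least, goal_cases)
  case 1 then show ?case using unit_partition_1 by blast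
next
  case (2 x)
  obtain d \<tau> where x: "x = (d, \<tau>)" by (cases x)
  then have \<tau>: "unit_partition d \<tau>" using 2 by simp
  \<comment> \<open>Values of \<open>\<tau>\<close> beyond \<open>d\<close> are arbitrary; the
    \<open>min\<close> freezes the sequence there, so that \<open>k\<close> is monotone on all
    natural numbers.\<close>
  define k where "k i = nat \<lfloor>\<tau> (min i d) * n\<rfloor>" for i
  have "mono k"
    unfolding k_def by (intro monoI nat_floor_mono mult_right_mono unit_partition_mono[OF \<tau>]) auto
  moreover have "k 0 = 0" "k d = n" using \<tau> by (auto simp: k_def unit_partition_def)
  ultimately have "lp_norm p d (\<lambda>i. psum y (k i) - psum y (k (i - 1))) \<le> B" by (rule assms)
  also have "lp_norm p d (\<lambda>i. psum y (k i) - psum y (k (i - 1))) = lp_norm p d (block_sum n y \<tau>)"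
    by (intro lp_norm_cong) (auto simp: block_sum_eq[OF \<tau>] k_def min_def)
  finally show ?case using x by (simp add: Q_diag_mult_lse)
qed

lemma test_statistic_nonneg:
  assumes "p \<ge> 1" shows "0 \<le> test_statistic p n y"
  unfolding test_statistic_def
  by (rule cSUP_upper2[OF bdd_above_test_statistic[OF assms], of "(Suc 0, real)"])
     (auto simp: unit_partition_1 lp_norm_nonneg)

text \<open>A weakly increasing index sequence has to be realised by a strictly increasing
  partition. Adding i / (d + 1) < 1 to the i-th index before dividing by n separates repeated
  indices and leaves the floors unchanged.\<close>

lemma test_statistic_ge:
  assumes p: "p \<ge> 1" and k: "mono k" "k 0 = 0" "k d = n"
  shows "lp_norm p d (\<lambda>i. psum y (k i) - psum y (k (i - 1))) \<le> test_statistic p n y"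
proof (cases "n = 0")
  case True
  then have "k i = 0" if "i \<le> d" for i using monoD[OF k(1) that] k by simp
  then have "lp_norm p d (\<lambda>i. psum y (k i) - psum y (k (i - 1))) = lp_norm p d (\<lambda>i. 0)"
    by (intro lp_norm_cong) auto
  then show ?thesis using test_statistic_nonneg[OF p] by (simp add: lp_norm_def)
next
  case False
  \<comment> \<open>The sequence is cut when it first reaches \<open>n\<close>: later increments
    vanish, and perturbing these indices would move points beyond 1.\<close>
  define e where "e = (LEAST i. k i = n)"
  have ke: "k e = n" unfolding e_def by (rule LeastI[of "\<lambda>i. k i = n", OF k(3)])
  have e_le: "e \<le> d" unfolding e_def by (rule Least_le) (rule k)
  have k_le: "k i \<le> n" if "i \<le> d" for i using monoD[OF k(1) that] k(3) by simp
  have k_lt: "k i < n" if "i < e" for i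
    using not_less_Least[of i "\<lambda>i. k i = n"] that k_le[of i] e_le unfolding e_def by fastforce
  have k_eq: "k i = n" if "e \<le> i" "i \<le> d" for i
    using monoD[OF k(1) that(1)] ke k_le[OF that(2)] by simp
  have e: "1 \<le> e" using ke k(2) False by (cases e) auto
  define \<tau> where "\<tau> i = (if i < e then (real (k i) + real i / real (d + 1)) / n else 1)" for i
  have fr: "real (k i) + real i / real (d + 1) < n" if "i < e" for i
  proof -
    have "real i / real (d + 1) < 1" using that e_le by simp
    then show ?thesis using k_lt[OF that] by linarith
  qed
  have \<tau>: "unit_partition e \<tau>"
    unfolding unit_partition_def
  proof (intro conjI)
    show "strict_mono_on {..e} \<tau>"
    proof (rule strict_mono_onI)
      fix r s assume "r \<in> {..e}" "s \<in> {..e}" "r < s"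
      moreover have "real (k r) + real r / real (d + 1) < real (k s) + real s / real (d + 1)"
        using monoD[OF k(1), of r s] \<open>r < s\<close> by (intro add_le_less_mono divide_strict_right_mono) auto
      ultimately show "\<tau> r < \<tau> s"
        using fr[of r] False by (auto simp: \<tau>_def divide_strict_right_mono)
    qed
  qed (use e k in \<open>auto simp: \<tau>_def\<close>)
  have fl: "nat \<lfloor>\<tau> i * n\<rfloor> = k i" if "i \<le> e" for i
  proof (cases "i = e")
    case True then show ?thesis using ke by (simp add: \<tau>_def)
  next
    case F: False
    have "real i / real (d + 1) < 1" using that e_le by simp
    then have "\<lfloor>real (k i) + real i / real (d + 1)\<rfloor> = int (k i)"
      by (intro floor_unique) auto
    then show ?thesis using F that False by (simp add: \<tau>_def)
  qed
  have "lp_norm p d (\<lambda>i. psum y (k i) - psum y (k (i - 1))) = lp_norm p e (\<lambda>i. psum y (k i) - psum y (k (i - 1)))"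
  proof -
    have "(\<Sum>i=1..d. \<bar>psum y (k i) - psum y (k (i - 1))\<bar> powr p) = (\<Sum>i=1..e. \<bar>psum y (k i) - psum y (k (i - 1))\<bar> powr p)"
    proof (intro sum.mono_neutral_right ballI)
      fix i assume "i \<in> {1..d} - {1..e}"
      then have "k i = n" "k (i - 1) = n" by (auto intro!: k_eq)
      then show "\<bar>psum y (k i) - psum y (k (i - 1))\<bar> powr p = 0" by simp
    qed (use e_le in auto)
    then show ?thesis by (simp add: lp_norm_def)
  qed
  also have "\<dots> = lp_norm p e (block_sum n y \<tau>)"
    by (intro lp_norm_cong) (auto simp: block_sum_eq[OF \<tau>] fl)
  also have "\<dots> \<le> test_statistic p n y"
    unfolding test_statistic_def
    by (rule cSUP_upper2[OF bdd_above_test_statistic[OF p], of "(e, \<tau>)"])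
       (auto simp: \<tau> Q_diag_mult_lse)
  finally show ?thesis .
qed

section \<open>The statistic as a seminorm: bounds, continuity, interpolation\<close>

lemma test_statistic_triangle:
  assumes p: "p \<ge> 1"
  shows "test_statistic p n (\<lambda>j. y j + z j) \<le> test_statistic p n y + test_statistic p n z"
proof (rule test_statistic_le)
  fix d k assume k: "mono (k :: nat \<Rightarrow> nat)" "k 0 = 0" "k d = n"
  have "lp_norm p d (\<lambda>i. psum (\<lambda>j. y j + z j) (k i) - psum (\<lambda>j. y j + z j) (k (i - 1)))
    = lp_norm p d (\<lambda>i. (psum y (k i) - psum y (k (i - 1))) + (psum z (k i) - psum z (k (i - 1))))"
    by (simp add: psum_def sum.distrib algebra_simps)
  also have "\<dots> \<le> lp_norm p d (\<lambda>i. psum y (k i) - psum y (k (i - 1))) + lp_norm p d (\<lambda>i. psum z (k i) - psum z (k (i - 1)))"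
    by (rule lp_norm_triangle[OF p])
  also have "\<dots> \<le> test_statistic p n y + test_statistic p n z"
    using k p by (intro add_mono test_statistic_ge) auto
  finally show "lp_norm p d (\<lambda>i. psum (\<lambda>j. y j + z j) (k i) - psum (\<lambda>j. y j + z j) (k (i - 1)))
    \<le> test_statistic p n y + test_statistic p n z" .
qed

lemma test_statistic_cong:
  "(\<And>j. 1 \<le> j \<Longrightarrow> j \<le> n \<Longrightarrow> y j = z j) \<Longrightarrow> test_statistic p n y = test_statistic p n z"
  unfolding test_statistic_eq by (auto intro!: SUP_cong sum.cong arg_cong2[where f="(powr)"])

lemma test_statistic_scale:
  assumes p: "p \<ge> 1"
  shows "test_statistic p n (\<lambda>j. c * y j) = \<bar>c\<bar> * test_statistic p n y"
proof -
  have le: "test_statistic p n (\<lambda>j. c * y j) \<le> \<bar>c\<bar> * test_statistic p n y" for c y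
  proof (rule test_statistic_le)
    fix d k assume k: "mono (k :: nat \<Rightarrow> nat)" "k 0 = 0" "k d = n"
    have "lp_norm p d (\<lambda>i. psum (\<lambda>j. c * y j) (k i) - psum (\<lambda>j. c * y j) (k (i - 1)))
      = lp_norm p d (\<lambda>i. c * (psum y (k i) - psum y (k (i - 1))))"
      by (simp add: psum_def sum_distrib_left algebra_simps)
    also have "\<dots> = \<bar>c\<bar> * lp_norm p d (\<lambda>i. (psum y (k i) - psum y (k (i - 1))))"
      by (rule lp_norm_scale[OF p])
    also have "\<dots> \<le> \<bar>c\<bar> * test_statistic p n y"
      using k p by (intro mult_left_mono test_statistic_ge) auto
    finally show "lp_norm p d (\<lambda>i. psum (\<lambda>j. c * y j) (k i) - psum (\<lambda>j. c * y j) (k (i - 1)))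
      \<le> \<bar>c\<bar> * test_statistic p n y" .
  qed
  show ?thesis
  proof (cases "c = 0")
    case True
    then show ?thesis using le[of 0 y] test_statistic_nonneg[OF p, of n] by (auto intro!: antisym)
  next
    case False
    have "\<bar>c\<bar> * test_statistic p n y \<le> \<bar>c\<bar> * (\<bar>1 / c\<bar> * test_statistic p n (\<lambda>j. c * y j))"
      using le[of "1 / c" "\<lambda>j. c * y j"] False by (intro mult_left_mono) auto
    also have "\<dots> = test_statistic p n (\<lambda>j. c * y j)" using False by simp
    finally show ?thesis using le[of c y] by simp
  qed
qed

lemma sum_consecutive:
  fixes k :: "nat \<Rightarrow> nat" and f :: "nat \<Rightarrow> 'a :: comm_monoid_add"
  assumes "mono k"
  shows "(\<Sum>i=1..d. \<Sum>l\<in>{k (i - 1)<..k i}. f l) = (\<Sum>l\<in>{k 0<..k d}. f l)"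
proof (induction d)
  case (Suc d)
  have "{k 0<..k (Suc d)} = {k 0<..k d} \<union> {k d<..k (Suc d)}"
    using monoD[OF assms, of 0 d] monoD[OF assms, of d "Suc d"] by auto
  then show ?case using Suc by (simp add: sum.union_disjoint ivl_disj_int)
qed simp

text \<open>Minkowski's inequality in each block followed by the triangle inequality inside it. The
  bound is crude in n, but it gives continuity and integrability, and it controls the 1-variation in
  interpolations.\<close>

lemma test_statistic_le_l1:
  assumes p: "p \<ge> 1"
  shows "test_statistic p n y \<le> (\<Sum>j=1..n. \<bar>y j\<bar>)"
proof (rule test_statistic_le)
  fix d k assume k: "mono (k :: nat \<Rightarrow> nat)" "k 0 = 0" "k d = n"
  have "lp_norm p d (\<lambda>i. psum y (k i) - psum y (k (i - 1))) \<le> (\<Sum>i=1..d. \<bar>psum y (k i) - psum y (k (i - 1))\<bar>)"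
    by (rule lp_norm_le_l1[OF p])
  also have "\<dots> \<le> (\<Sum>i=1..d. \<Sum>l\<in>{k (i - 1)<..k i}. \<bar>y l\<bar>)"
    using k(1) by (intro sum_mono) (subst psum_diff, auto simp: mono_def)
  also have "\<dots> = (\<Sum>j=1..n. \<bar>y j\<bar>)"
    using sum_consecutive[OF k(1), where d=d and f="\<lambda>l. \<bar>y l\<bar>"] k by (simp add: atLeastSucAtMost_greaterThanAtMost)
  finally show "lp_norm p d (\<lambda>i. psum y (k i) - psum y (k (i - 1))) \<le> (\<Sum>j=1..n. \<bar>y j\<bar>)" .
qed

lemma test_statistic_diff_le:
  assumes p: "p \<ge> 1"
  shows "\<bar>test_statistic p n y - test_statistic p n z\<bar> \<le> test_statistic p n (\<lambda>j. y j - z j)"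
  using test_statistic_triangle[OF p, of n "\<lambda>j. y j - z j" z]
    test_statistic_triangle[OF p, of n "\<lambda>j. z j - y j" y]
    test_statistic_scale[OF p, of n "-1" "\<lambda>j. y j - z j"] by simp

text \<open>A seminorm dominated by the l_1 norm of the first n coordinates is Lipschitz in these
  coordinates.\<close>

lemma tendsto_test_statistic:
  assumes p: "p \<ge> 1" and y: "\<And>j. 1 \<le> j \<Longrightarrow> j \<le> n \<Longrightarrow> ((\<lambda>x. y x j) \<longlongrightarrow> z j) F"
  shows "((\<lambda>x. test_statistic p n (y x)) \<longlongrightarrow> test_statistic p n z) F"
proof (rule Lim_transform_bound[where g="\<lambda>x. \<Sum>j=1..n. \<bar>y x j - z j\<bar>", THEN LIM_zero_cancel])
  show "\<forall>\<^sub>F x in F. norm (test_statistic p n (y x) - test_statistic p n z) \<le> norm (\<Sum>j=1..n. \<bar>y x j - z j\<bar>)"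
    using test_statistic_diff_le[OF p, of n] test_statistic_le_l1[OF p, of n]
    by (intro always_eventually) (auto intro: order_trans simp: sum_nonneg)
  show "((\<lambda>x. \<Sum>j=1..n. \<bar>y x j - z j\<bar>) \<longlongrightarrow> 0) F"
    using y by (intro tendsto_null_sum tendsto_rabs_zero LIM_zero) auto
qed

lemma continuous_test_statistic: "p \<ge> 1 \<Longrightarrow> continuous_on UNIV (test_statistic p n)"
  using continuous_on_product_coordinates[unfolded continuous_on_def]
  unfolding continuous_on_def by (fastforce intro!: tendsto_test_statistic)

text \<open>The supremum runs over uncountably many partitions; measurability comes from continuity
  in the product topology instead of a countable reduction.\<close>

lemma borel_measurable_test_statistic [measurable]:
  assumes p: "p \<ge> 1" and [measurable]: "\<And>j. Z j \<in> borel_measurable M"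
  shows "(\<lambda>\<omega>. test_statistic p n (\<lambda>j. Z j \<omega>)) \<in> borel_measurable M"
  by (rule measurable_compose[OF measurable_coordinatewise_then_product
        borel_measurable_continuous_onI[OF continuous_test_statistic[OF p]]]) auto

text \<open>Every increment of the partial sums is at most 2 c, so |x|^p = |x|^(p - q) |x|^q can be
  bounded increment by increment. Control in a lower exponent q thus turns uniform smallness into
  smallness in the exponent p.\<close>

lemma test_statistic_interpolate:
  assumes q: "1 \<le> q" "q \<le> p" and c: "\<And>k. k \<le> n \<Longrightarrow> \<bar>psum y k\<bar> \<le> c"
  shows "test_statistic p n y powr p \<le> (2 * c) powr (p - q) * test_statistic q n y powr q"
proof -
  have p: "1 \<le> p" using q by simp
  define B where "B = ((2 * c) powr (p - q) * test_statistic q n y powr q) powr (1 / p)"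
  have B: "B powr p = (2 * c) powr (p - q) * test_statistic q n y powr q" "0 \<le> B"
    using p by (auto simp: B_def powr_powr)
  have "test_statistic p n y \<le> B"
  proof (rule test_statistic_le)
    fix d k assume k: "mono (k :: nat \<Rightarrow> nat)" "k 0 = 0" "k d = n"
    let ?v = "\<lambda>i. psum y (k i) - psum y (k (i - 1))"
    have "(\<Sum>i=1..d. \<bar>?v i\<bar> powr p) \<le> (\<Sum>i=1..d. (2 * c) powr (p - q) * \<bar>?v i\<bar> powr q)"
    proof (rule sum_mono)
      fix i assume i: "i \<in> {1..d}"
      have "k i \<le> n" "k (i - 1) \<le> n" using monoD[OF k(1), of _ d] i k(3) by auto
      then have "\<bar>?v i\<bar> \<le> 2 * c" using c[of "k i"] c[of "k (i - 1)"] by linarith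
      then have "\<bar>?v i\<bar> powr (p - q) * \<bar>?v i\<bar> powr q \<le> (2 * c) powr (p - q) * \<bar>?v i\<bar> powr q"
        using q by (intro mult_right_mono powr_mono2) auto
      then show "\<bar>?v i\<bar> powr p \<le> (2 * c) powr (p - q) * \<bar>?v i\<bar> powr q"
        by (simp flip: powr_add)
    qed
    also have "\<dots> = (2 * c) powr (p - q) * lp_norm q d ?v powr q"
      by (simp add: lp_norm_powr[OF q(1)] sum_distrib_left)
    also have "\<dots> \<le> B powr p"
      unfolding B using q k by (intro mult_left_mono powr_mono2 test_statistic_ge) (auto simp: lp_norm_nonneg)
    finally show "lp_norm p d ?v \<le> B" using B p by (subst lp_norm_le_iff) auto
  qed
  then have "test_statistic p n y powr p \<le> B powr p"
    using p by (intro powr_mono2 test_statistic_nonneg) auto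
  then show ?thesis by (simp add: B)
qed

text \<open>Countable subadditivity: the triangle inequality for finite sums passes to the limit by
  continuity. It serves to expand the linear process in its lags.\<close>

lemma test_statistic_suminf_le:
  assumes p: "p \<ge> 1"
    and y: "\<And>i. 1 \<le> i \<Longrightarrow> i \<le> n \<Longrightarrow> (\<lambda>j. y j i) sums z i"
    and summable: "summable (\<lambda>j. test_statistic p n (y j))"
  shows "test_statistic p n z \<le> (\<Sum>j. test_statistic p n (y j))"
proof (rule LIMSEQ_le)
  show "(\<lambda>J. test_statistic p n (\<lambda>i. \<Sum>j<J. y j i)) \<longlonglongrightarrow> test_statistic p n z"
    using y by (intro tendsto_test_statistic p) (auto simp: sums_def)
  show "(\<lambda>J. \<Sum>j<J. test_statistic p n (y j)) \<longlonglongrightarrow> (\<Sum>j. test_statistic p n (y j))"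
    using summable by (rule summable_LIMSEQ)
  have "test_statistic p n (\<lambda>i. \<Sum>j<J. y j i) \<le> (\<Sum>j<J. test_statistic p n (y j))" for J
  proof (induction J)
    case 0 then show ?case using test_statistic_scale[OF p, of n 0] by simp
  next
    case (Suc J) then show ?case
      using test_statistic_triangle[OF p, of n "\<lambda>i. \<Sum>j<J. y j i" "y J"] by simp
  qed
  then show "\<exists>N. \<forall>J\<ge>N. test_statistic p n (\<lambda>i. \<Sum>j<J. y j i) \<le> (\<Sum>j<J. test_statistic p n (y j))" by blast
qed

section \<open>Restarted random walks\<close>

text \<open>\<open>gap l y\<close> is the walk with steps \<open>y 1, y 2, \<dots>\<close>, reset to \<open>0\<close> whenever it would leave \<open>(-l, l)\<close>.\<close>
primrec gap :: "real \<Rightarrow> (nat \<Rightarrow> real) \<Rightarrow> nat \<Rightarrow> real" where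
  "gap l y 0 = 0"
| "gap l y (Suc k) = (if \<bar>gap l y k + y (Suc k)\<bar> < l then gap l y k + y (Suc k) else 0)"

definition jump :: "real \<Rightarrow> (nat \<Rightarrow> real) \<Rightarrow> nat \<Rightarrow> bool" where
  "jump l y j \<longleftrightarrow> l \<le> \<bar>gap l y (j - 1) + y j\<bar>"

text \<open>The restart count N of the overview at level \<open>l\<close>, taken real-valued since
  it enters through its expectation.\<close>

definition jumps :: "real \<Rightarrow> (nat \<Rightarrow> real) \<Rightarrow> nat \<Rightarrow> real" where
  "jumps l y n = (\<Sum>j=1..n. of_bool (jump l y j))"

lemma jumps_nonneg: "0 \<le> jumps l y n"
  by (simp add: jumps_def sum_nonneg)

lemma jumps_0 [simp]: "jumps l y 0 = 0"
  and jumps_Suc: "jumps l y (Suc k) = jumps l y k + of_bool (l \<le> \<bar>gap l y k + y (Suc k)\<bar>)"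
  by (simp_all add: jumps_def jump_def)

lemma jumps_le: "jumps l y n \<le> n"
  unfolding jumps_def by (rule order_trans[OF sum_bounded_above[of _ _ 1]]) auto

lemma abs_gap_less: "l > 0 \<Longrightarrow> \<bar>gap l y k\<bar> < l"
  by (cases k) auto

lemma gap_cong: "(\<And>j. 1 \<le> j \<Longrightarrow> j \<le> k \<Longrightarrow> y j = z j) \<Longrightarrow> gap l y k = gap l z k"
  by (induction k) auto

lemma gap_diff:
  assumes "s \<le> t" "\<And>j. s < j \<Longrightarrow> j \<le> t \<Longrightarrow> \<not> jump l y j"
  shows "gap l y t - gap l y s = psum y t - psum y s"
  using assms
proof (induction t rule: dec_induct)
  case (step t)
  have "\<not> jump l y (Suc t)" using step by auto
  then have "gap l y (Suc t) = gap l y t + y (Suc t)" by (auto simp: jump_def)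
  then show ?case using step by auto
qed simp

text \<open>Without a restart up to time k the reset walk coincides with the partial sum, whose
  modulus would then be below l. In this way a bound on the expected number of restarts is also a
  maximal inequality.\<close>

lemma jumps_ge_1:
  assumes "l > 0" "k \<le> n" "l \<le> \<bar>psum y k\<bar>"
  shows "1 \<le> jumps l y n"
proof (rule ccontr)
  assume *: "\<not> 1 \<le> jumps l y n"
  have "\<not> jump l y j" if "0 < j" "j \<le> k" for j
  proof
    assume "jump l y j"
    then have "1 \<le> jumps l y n"
      unfolding jumps_def using that assms by (subst sum.remove[of _ j]) (auto simp: sum_nonneg)
    then show False using * by simp
  qed
  then have "gap l y k = psum y k" using gap_diff[of 0 k l y] by simp
  then show False using abs_gap_less[OF assms(1), of y k] assms(3) by simp
qed

section \<open>Pathwise bound of the variation by restart counts\<close>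

text \<open>As long as there is no restart, partial sums and reset walk move in parallel, and the
  latter stays in (-l, l). An increment of size 2 l therefore forces a restart within its own index
  range, and these ranges are disjoint.\<close>

lemma count_increments_le_jumps:
  fixes k :: "nat \<Rightarrow> nat"
  assumes "mono k" "k 0 = 0" "k d = n" and l: "l > 0"
  shows "(\<Sum>i=1..d. of_bool (2 * l \<le> \<bar>psum y (k i) - psum y (k (i - 1))\<bar>) :: real) \<le> jumps l y n"
proof -
  have "of_bool (2 * l \<le> \<bar>psum y (k i) - psum y (k (i - 1))\<bar>)
      \<le> (\<Sum>j\<in>{k (i - 1)<..k i}. of_bool (jump l y j) :: real)" for i
  proof (cases "2 * l \<le> \<bar>psum y (k i) - psum y (k (i - 1))\<bar>")
    case True
    have "\<exists>j. k (i - 1) < j \<and> j \<le> k i \<and> jump l y j"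
    proof (rule ccontr)
      assume "\<not> ?thesis"
      then have "gap l y (k i) - gap l y (k (i - 1)) = psum y (k i) - psum y (k (i - 1))"
        using monoD[OF assms(1) diff_le_self[of i 1]] by (intro gap_diff) auto
      then show False
        using True abs_gap_less[OF l, of y "k i"] abs_gap_less[OF l, of y "k (i - 1)"] by linarith
    qed
    then obtain j where "k (i - 1) < j" "j \<le> k i" "jump l y j" by blast
    then have "1 \<le> (\<Sum>j\<in>{k (i - 1)<..k i}. of_bool (jump l y j) :: real)"
      by (subst sum.remove[of _ j]) (auto simp: sum_nonneg)
    then show ?thesis by simp
  qed (simp add: sum_nonneg)
  then have "(\<Sum>i=1..d. of_bool (2 * l \<le> \<bar>psum y (k i) - psum y (k (i - 1))\<bar>) :: real)
    \<le> (\<Sum>i=1..d. \<Sum>j\<in>{k (i - 1)<..k i}. of_bool (jump l y j))"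
    by (intro sum_mono)
  also have "\<dots> = jumps l y n"
    using assms sum_consecutive[OF assms(1), where d=d and f="\<lambda>j. of_bool (jump l y j) :: real"]
    by (simp add: jumps_def atLeastSucAtMost_greaterThanAtMost)
  finally show ?thesis .
qed

lemma ennreal_term_le_suminf: "f m \<le> (\<Sum>m. f m :: ennreal)"
  using sum_le_suminf[of f "{m}"] by simp

text \<open>One term is enough: for the least m with 2 R / 2^m at most \<open>\<delta>\<close>,
  minimality gives \<open>\<delta>\<close> at most 4 R / 2^m, and for m = 0 this is the assumed
  upper bound. The sum over all scales is taken because m depends on
  \<open>\<delta>\<close>.\<close>

lemma powr_le_dyadic_sum:
  fixes \<delta> R q :: real
  assumes "0 \<le> \<delta>" "\<delta> < 4 * R" "q > 0"
  shows "ennreal (\<delta> powr q) \<le> (\<Sum>m. ennreal ((4 * (R / 2 ^ m)) powr q * of_bool (2 * (R / 2 ^ m) \<le> \<delta>)))"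
proof (cases "\<delta> = 0")
  case False
  have "R > 0" using assms by simp
  have "\<exists>m. 2 * (R / 2 ^ m) \<le> \<delta>"
  proof -
    obtain m where "2 * R / \<delta> < 2 ^ m" using real_arch_pow[of 2] by auto
    then have "2 * (R / 2 ^ m) \<le> \<delta>" using assms False by (simp add: field_simps)
    then show ?thesis ..
  qed
  define m where "m = (LEAST m. 2 * (R / 2 ^ m) \<le> \<delta>)"
  have m: "2 * (R / 2 ^ m) \<le> \<delta>"
    unfolding m_def by (rule LeastI_ex) fact
  have "\<delta> \<le> 4 * (R / 2 ^ m)"
  proof (cases m)
    case 0 then show ?thesis using assms by simp
  next
    case (Suc m')
    then have "\<not> 2 * (R / 2 ^ m') \<le> \<delta>" using not_less_Least[of m' "\<lambda>m. 2 * (R / 2 ^ m) \<le> \<delta>"] unfolding m_def by auto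
    then show ?thesis using Suc by (simp add: field_simps)
  qed
  then have "ennreal (\<delta> powr q) \<le> ennreal ((4 * (R / 2 ^ m)) powr q * of_bool (2 * (R / 2 ^ m) \<le> \<delta>))"
    using assms(1,3) m by (intro ennreal_leI) (simp add: powr_mono2)
  also have "\<dots> \<le> (\<Sum>m. ennreal ((4 * (R / 2 ^ m)) powr q * of_bool (2 * (R / 2 ^ m) \<le> \<delta>)))"
    by (rule ennreal_term_le_suminf)
  finally show ?thesis .
next
  case True
  then have "ennreal (\<delta> powr q) = 0" by simp
  then show ?thesis by (simp only: zero_le)
qed

text \<open>All increments are below 4 R, so each obeys the dyadic bound. Exchanging the two sums
  leaves, at each scale, the number of large increments, which the restart count bounds
  independently of the index sequence.\<close>

lemma test_statistic_le_jumps: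
  assumes q: "q \<ge> 1" and R: "R > 0" and small: "\<And>k. k \<le> n \<Longrightarrow> \<bar>psum y k\<bar> < 2 * R"
  shows "ennreal (test_statistic q n y powr q)
    \<le> (\<Sum>m. ennreal ((4 * (R / 2 ^ m)) powr q * jumps (R / 2 ^ m) y n))" (is "_ \<le> ?S")
proof (cases ?S)
  case (real b)
  have "test_statistic q n y \<le> b powr (1 / q)"
  proof (rule test_statistic_le)
    fix d k assume k: "mono (k :: nat \<Rightarrow> nat)" "k 0 = 0" "k d = n"
    define \<delta> where "\<delta> i = \<bar>psum y (k i) - psum y (k (i - 1))\<bar>" for i
    have \<delta>: "\<delta> i < 4 * R" if "i \<in> {1..d}" for i
    proof -
      have "k i \<le> n" "k (i - 1) \<le> n" using monoD[OF k(1), of _ d] that k(3) by auto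
      then show ?thesis using small[of "k i"] small[of "k (i - 1)"] unfolding \<delta>_def by linarith
    qed
    have "ennreal (\<Sum>i=1..d. \<delta> i powr q) = (\<Sum>i=1..d. ennreal (\<delta> i powr q))"
      by (simp add: sum_ennreal)
    also have "\<dots> \<le> (\<Sum>i=1..d. \<Sum>m. ennreal ((4 * (R / 2 ^ m)) powr q * of_bool (2 * (R / 2 ^ m) \<le> \<delta> i)))"
      using \<delta> q by (intro sum_mono powr_le_dyadic_sum) (auto simp: \<delta>_def)
    also have "\<dots> = (\<Sum>m. \<Sum>i=1..d. ennreal ((4 * (R / 2 ^ m)) powr q * of_bool (2 * (R / 2 ^ m) \<le> \<delta> i)))"
      by (rule suminf_sum[symmetric]) simp
    also have "\<dots> \<le> ?S"
    proof (intro suminf_le allI)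
      fix m
      have "(\<Sum>i=1..d. ennreal ((4 * (R / 2 ^ m)) powr q * of_bool (2 * (R / 2 ^ m) \<le> \<delta> i)))
        = ennreal ((4 * (R / 2 ^ m)) powr q * (\<Sum>i=1..d. of_bool (2 * (R / 2 ^ m) \<le> \<delta> i)))"
        by (simp only: sum_distrib_left) (rule sum_ennreal, simp)
      also have "\<dots> \<le> ennreal ((4 * (R / 2 ^ m)) powr q * jumps (R / 2 ^ m) y n)"
        unfolding \<delta>_def using R by (intro ennreal_leI mult_left_mono count_increments_le_jumps k) auto
      finally show "(\<Sum>i=1..d. ennreal ((4 * (R / 2 ^ m)) powr q * of_bool (2 * (R / 2 ^ m) \<le> \<delta> i)))
        \<le> ennreal ((4 * (R / 2 ^ m)) powr q * jumps (R / 2 ^ m) y n)" .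
    qed auto
    finally have "(\<Sum>i=1..d. \<delta> i powr q) \<le> b"
      using real by simp
    then have "(\<Sum>i=1..d. \<bar>psum y (k i) - psum y (k (i - 1))\<bar> powr q) \<le> (b powr (1 / q)) powr q"
      using q real by (simp add: powr_powr \<delta>_def)
    then show "lp_norm q d (\<lambda>i. psum y (k i) - psum y (k (i - 1))) \<le> b powr (1 / q)"
      using q by (subst lp_norm_le_iff) auto
  qed
  then have "test_statistic q n y powr q \<le> (b powr (1 / q)) powr q"
    using q by (intro powr_mono2 test_statistic_nonneg) auto
  also have "\<dots> = b" using q real by (simp add: powr_powr)
  finally show ?thesis using real by (simp add: ennreal_leI)
qed simp

lemma borel_measurable_psum [measurable]:
  assumes [measurable]: "\<And>j. y j \<in> borel_measurable M"
  shows "(\<lambda>\<omega>. psum (\<lambda>j. y j \<omega>) k) \<in> borel_measurable M"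
  unfolding psum_def by measurable

text \<open>Measurability is assumed only of the coordinates 1 to k, so that the lemma also applies
  to the identity on the finite product over {1..k}; this is the form in which independence of the
  past is used.\<close>

lemma borel_measurable_gap:
  assumes "\<And>j. 1 \<le> j \<Longrightarrow> j \<le> k \<Longrightarrow> (\<lambda>x. f x j) \<in> borel_measurable M"
  shows "(\<lambda>x. gap l (f x) k) \<in> borel_measurable M"
  using assms
proof (induction k)
  case (Suc k)
  have [measurable]: "(\<lambda>x. gap l (f x) k) \<in> borel_measurable M" "(\<lambda>x. f x (Suc k)) \<in> borel_measurable M"
    using Suc by auto
  show ?case by simp
qed simp

lemma borel_measurable_jumps:
  assumes "\<And>j. 1 \<le> j \<Longrightarrow> j \<le> k \<Longrightarrow> (\<lambda>x. f x j) \<in> borel_measurable M"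
  shows "(\<lambda>x. jumps l (f x) k) \<in> borel_measurable M"
  using assms
proof (induction k)
  case (Suc k)
  have [measurable]: "(\<lambda>x. jumps l (f x) k) \<in> borel_measurable M" "(\<lambda>x. f x (Suc k)) \<in> borel_measurable M"
    "(\<lambda>x. gap l (f x) k) \<in> borel_measurable M"
    using Suc borel_measurable_gap[of k f M] by auto
  show ?case unfolding jumps_Suc by simp
qed simp

section \<open>Moments of the restarted walk and maximal inequalities\<close>

text \<open>A common setting for functions of the innovations, at any shift, and for the increments
  of the Wiener process on a grid.\<close>

locale centred_independent = prob_space +
  fixes y :: "nat \<Rightarrow> 'a \<Rightarrow> real" and n :: nat
  assumes measurable_y [measurable]: "\<And>j. y j \<in> borel_measurable M"
    and indep: "indep_vars (\<lambda>_. borel) y {1..n}"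
    and integrable_sq: "\<And>j. j \<in> {1..n} \<Longrightarrow> integrable M (\<lambda>\<omega>. (y j \<omega>)\<^sup>2)"
    and mean_zero: "\<And>j. j \<in> {1..n} \<Longrightarrow> expectation (y j) = 0"
begin

lemma integrable_y: "j \<in> {1..n} \<Longrightarrow> integrable M (y j)"
  by (rule square_integrable_imp_integrable[OF _ integrable_sq]) simp_all

abbreviation "G l k \<omega> \<equiv> gap l (\<lambda>j. y j \<omega>) k"
abbreviation "J l k \<omega> \<equiv> jumps l (\<lambda>j. y j \<omega>) k"

lemma measurable_GJ [measurable]: "G l k \<in> borel_measurable M" "J l k \<in> borel_measurable M"
  by (auto intro: borel_measurable_gap borel_measurable_jumps)

lemma integrable_G_power:
  assumes "l > 0"
  shows "integrable M (\<lambda>\<omega>. (G l k \<omega>) ^ m)"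
proof (rule integrable_const_bound[of _ "l ^ m"])
  show "AE \<omega> in M. norm (G l k \<omega> ^ m) \<le> l ^ m"
    using abs_gap_less[OF assms] by (intro AE_I2) (simp add: power_abs power_mono less_imp_le)
qed measurable

lemma integrable_J: "integrable M (J l k)"
  by (rule integrable_const_bound[of _ "real k"]) (auto simp: jumps_nonneg jumps_le)

text \<open>The reset walk at time k is a function of the first k variables, hence independent of
  the centred next one. The power 1 serves the second moment, the power 3 the fourth.\<close>

lemma gap_times_next_power:
  assumes k: "Suc k \<le> n" and l: "l > 0"
  shows "integrable M (\<lambda>\<omega>. (G l k \<omega>) ^ m * y (Suc k) \<omega>)"
    and "expectation (\<lambda>\<omega>. (G l k \<omega>) ^ m * y (Suc k) \<omega>) = 0"
proof -
  have 1: "(\<lambda>f. (gap l f k) ^ m) \<in> borel_measurable (PiM {1..k} (\<lambda>_. borel))"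
    by (intro borel_measurable_power borel_measurable_gap) measurable
  have 2: "(\<lambda>f. f (Suc k)) \<in> borel_measurable (PiM {Suc k} (\<lambda>_. borel))"
    by measurable
  have "indep_var (PiM {1..k} (\<lambda>_. borel)) (\<lambda>\<omega>. restrict (\<lambda>i. y i \<omega>) {1..k})
      (PiM {Suc k} (\<lambda>_. borel)) (\<lambda>\<omega>. restrict (\<lambda>i. y i \<omega>) {Suc k})"
    using k by (intro indep_var_restrict[OF indep]) auto
  from indep_var_compose[OF this 1 2]
  have "indep_var borel (\<lambda>\<omega>. (gap l (restrict (\<lambda>i. y i \<omega>) {1..k}) k) ^ m) borel (y (Suc k))"
    by (simp add: comp_def)
  also have "(\<lambda>\<omega>. (gap l (restrict (\<lambda>i. y i \<omega>) {1..k}) k) ^ m) = (\<lambda>\<omega>. (G l k \<omega>) ^ m)"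
    by (intro ext arg_cong[where f="\<lambda>x. x ^ m"] gap_cong) auto
  finally have i: "indep_var borel (\<lambda>\<omega>. (G l k \<omega>) ^ m) borel (y (Suc k))" .
  show "integrable M (\<lambda>\<omega>. (G l k \<omega>) ^ m * y (Suc k) \<omega>)"
    using k l by (intro indep_var_integrable[OF i] integrable_G_power integrable_y) auto
  have "expectation (\<lambda>\<omega>. (G l k \<omega>) ^ m * y (Suc k) \<omega>) = expectation (\<lambda>\<omega>. (G l k \<omega>) ^ m) * expectation (y (Suc k))"
    using k l by (intro indep_var_lebesgue_integral[OF i] integrable_G_power integrable_y) auto
  then show "expectation (\<lambda>\<omega>. (G l k \<omega>) ^ m * y (Suc k) \<omega>) = 0" using k by (simp add: mean_zero)
qed

text \<open>In G^2 + l^2 N a restart discards a square of at least l^2 and pays l^2 to the counter.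
  Hence one step adds at most 2 G y + y^2, as for the free walk, and the mixed term has mean
  zero.\<close>

lemma second_moment_gap:
  fixes v :: real
  assumes l: "l > 0" and v: "\<And>j. j \<in> {1..n} \<Longrightarrow> expectation (\<lambda>\<omega>. (y j \<omega>)\<^sup>2) \<le> v"
  shows "k \<le> n \<Longrightarrow> expectation (\<lambda>\<omega>. (G l k \<omega>)\<^sup>2) + l\<^sup>2 * expectation (J l k) \<le> k * v"
proof (induction k)
  case (Suc k)
  have i2: "integrable M (\<lambda>\<omega>. (G l m \<omega>)\<^sup>2)" for m by (rule integrable_G_power[OF l])
  note c = gap_times_next_power[OF Suc.prems l, of 1, simplified]
  have "expectation (\<lambda>\<omega>. (G l (Suc k) \<omega>)\<^sup>2) + l\<^sup>2 * expectation (J l (Suc k))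
      = expectation (\<lambda>\<omega>. (G l (Suc k) \<omega>)\<^sup>2 + l\<^sup>2 * J l (Suc k) \<omega>)"
    using i2 integrable_J by (simp del: gap.simps)
  also have "\<dots> \<le> expectation (\<lambda>\<omega>. (G l k \<omega>)\<^sup>2 + l\<^sup>2 * J l k \<omega> + 2 * (G l k \<omega> * y (Suc k) \<omega>) + (y (Suc k) \<omega>)\<^sup>2)"
  proof (intro integral_mono)
    show "(G l (Suc k) \<omega>)\<^sup>2 + l\<^sup>2 * J l (Suc k) \<omega> \<le> (G l k \<omega>)\<^sup>2 + l\<^sup>2 * J l k \<omega> + 2 * (G l k \<omega> * y (Suc k) \<omega>) + (y (Suc k) \<omega>)\<^sup>2" for \<omega>
    proof -
      have "l\<^sup>2 \<le> (G l k \<omega> + y (Suc k) \<omega>)\<^sup>2" if "l \<le> \<bar>G l k \<omega> + y (Suc k) \<omega>\<bar>"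
        using that l by (simp add: abs_le_square_iff[symmetric])
      then show ?thesis by (auto simp: jumps_Suc power2_sum algebra_simps)
    qed
  qed (use i2 integrable_J c integrable_sq Suc.prems in \<open>auto simp del: gap.simps\<close>)
  also have "\<dots> = expectation (\<lambda>\<omega>. (G l k \<omega>)\<^sup>2) + l\<^sup>2 * expectation (J l k) + expectation (\<lambda>\<omega>. (y (Suc k) \<omega>)\<^sup>2)"
    using i2 integrable_J c integrable_sq Suc.prems by simp
  also have "\<dots> \<le> k * v + v" using Suc v[of "Suc k"] by auto
  finally show ?case by (simp add: algebra_simps)
qed simp

lemma expectation_jumps_le:
  fixes v :: real
  assumes "l > 0" and "\<And>j. j \<in> {1..n} \<Longrightarrow> expectation (\<lambda>\<omega>. (y j \<omega>)\<^sup>2) \<le> v"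
  shows "expectation (J l n) \<le> n * v / l\<^sup>2"
proof -
  have "l\<^sup>2 * expectation (J l n) \<le> n * v"
    using second_moment_gap[OF assms order_refl] Bochner_Integration.integral_nonneg[of M "\<lambda>\<omega>. (G l n \<omega>)\<^sup>2", OF zero_le_power2]
    by linarith
  then show ?thesis using assms(1) by (simp add: field_simps)
qed

text \<open>The same balance for G^4 + l^4 N. The cubic mixed term has mean zero; the remaining
  mixed terms are bounded through the second moment of G, which is at most k b^2.\<close>

lemma fourth_moment_gap:
  fixes b :: real
  assumes l: "l > 0" and b: "\<And>j \<omega>. j \<in> {1..n} \<Longrightarrow> \<omega> \<in> space M \<Longrightarrow> \<bar>y j \<omega>\<bar> \<le> b"
  shows "k \<le> n \<Longrightarrow> expectation (\<lambda>\<omega>. (G l k \<omega>)^4) + l^4 * expectation (J l k) \<le> 4 * k\<^sup>2 * b^4"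
proof (induction k)
  case (Suc k)
  note i = integrable_G_power[OF l]
  note c3 = gap_times_next_power[OF Suc.prems l, of 3]
  have yb: "(y j \<omega>)\<^sup>2 \<le> b\<^sup>2" if "j \<in> {1..n}" "\<omega> \<in> space M" for j \<omega>
    using b[OF that] by (simp add: abs_le_square_iff[symmetric])
  have gb: "expectation (\<lambda>\<omega>. (y j \<omega>)\<^sup>2) \<le> b\<^sup>2" if "j \<in> {1..n}" for j
    using that yb by (intro integral_le_const integrable_sq) auto
  have g2: "expectation (\<lambda>\<omega>. (G l k \<omega>)\<^sup>2) \<le> k * b\<^sup>2"
proof -
    have "0 \<le> l\<^sup>2 * expectation (J l k)"
      by (intro mult_nonneg_nonneg Bochner_Integration.integral_nonneg) (auto simp: jumps_nonneg)
    then show ?thesis using second_moment_gap[OF l gb, of k] Suc.prems by simp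
  qed
  have "expectation (\<lambda>\<omega>. (G l (Suc k) \<omega>)^4) + l^4 * expectation (J l (Suc k))
      = expectation (\<lambda>\<omega>. (G l (Suc k) \<omega>)^4 + l^4 * J l (Suc k) \<omega>)"
    using i integrable_J by (simp del: gap.simps)
  also have "\<dots> \<le> expectation (\<lambda>\<omega>. (G l k \<omega>)^4 + l^4 * J l k \<omega> + 4 * ((G l k \<omega>)^3 * y (Suc k) \<omega>) + 8 * b\<^sup>2 * (G l k \<omega>)\<^sup>2 + 3 * b^4)"
  proof (intro integral_mono)
    fix \<omega> assume \<omega>: "\<omega> \<in> space M"
    let ?g = "G l k \<omega>" and ?y = "y (Suc k) \<omega>"
    \<comment> \<open>This square absorbs the term of odd order in y into the neighbouring even
      ones, which explains the coefficients 8 = 6 + 2 and 3 = 1 + 2.\<close>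
    have "0 \<le> 2 * ?y\<^sup>2 * (?g - ?y)\<^sup>2" by simp
    then have 1: "4 * ?g * ?y^3 \<le> 2 * ?g\<^sup>2 * ?y\<^sup>2 + 2 * ?y^4"
      by (simp add: power2_eq_square power3_eq_cube power4_eq_xxxx algebra_simps)
    have 2: "(?g + ?y)^4 = ?g^4 + 4 * (?g^3 * ?y) + 6 * ?g\<^sup>2 * ?y\<^sup>2 + 4 * ?g * ?y^3 + ?y^4"
      by (simp add: power2_eq_square power3_eq_cube power4_eq_xxxx algebra_simps)
    have 3: "?g\<^sup>2 * ?y\<^sup>2 \<le> b\<^sup>2 * ?g\<^sup>2" 
      using mult_left_mono[OF yb[OF _ \<omega>, of "Suc k"], of "?g\<^sup>2"] Suc.prems by (simp add: mult.commute)
    have 4: "?y^4 \<le> b^4"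
      using power_mono[OF yb[OF _ \<omega>, of "Suc k"], of 2] Suc.prems by (simp flip: power_mult)
    have 5: "(?g + ?y)^4 \<le> ?g^4 + 4 * (?g^3 * ?y) + 8 * b\<^sup>2 * ?g\<^sup>2 + 3 * b^4"
      using 1 2 3 4 by linarith
    have "l^4 \<le> (?g + ?y)^4" if "l \<le> \<bar>?g + ?y\<bar>"
      using power_mono[OF that, of 4] l by simp
    then show "(G l (Suc k) \<omega>)^4 + l^4 * J l (Suc k) \<omega> \<le> ?g^4 + l^4 * J l k \<omega> + 4 * (?g^3 * ?y) + 8 * b\<^sup>2 * ?g\<^sup>2 + 3 * b^4"
      using 5 by (auto simp: jumps_Suc algebra_simps)
  qed (use i integrable_J c3 in \<open>auto simp del: gap.simps\<close>)
  also have "\<dots> = expectation (\<lambda>\<omega>. (G l k \<omega>)^4) + l^4 * expectation (J l k) + 8 * b\<^sup>2 * expectation (\<lambda>\<omega>. (G l k \<omega>)\<^sup>2) + 3 * b^4"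
    using i integrable_J c3 by (simp add: prob_space)
  also have "\<dots> \<le> 4 * k\<^sup>2 * b^4 + 8 * b\<^sup>2 * (k * b\<^sup>2) + 3 * b^4"
    using Suc g2 by (intro add_mono mult_left_mono) auto
  also have "\<dots> \<le> 4 * (Suc k)\<^sup>2 * b^4"
  proof -
    \<comment> \<open>The constant 4 closes the recursion: 4 (k + 1)^2 - 4 k^2 = 8 k + 4 exceeds the
      increment 8 k + 3.\<close>
    have "4 * (Suc k)\<^sup>2 * b^4 - (4 * k\<^sup>2 * b^4 + 8 * b\<^sup>2 * (k * b\<^sup>2) + 3 * b^4) = b^4"
      by (simp add: power2_eq_square power4_eq_xxxx algebra_simps)
    moreover have "0 \<le> b^4" by simp
    ultimately show ?thesis by linarith
  qed
  finally show ?case by simp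
qed simp

text \<open>The restart count is at least 1 on this event and nonnegative elsewhere.\<close>

lemma prob_max_psum_le:
  assumes l: "l > 0"
  shows "prob {\<omega>\<in>space M. \<exists>k\<le>n. l \<le> \<bar>psum (\<lambda>j. y j \<omega>) k\<bar>} \<le> expectation (J l n)"
proof -
  have "prob {\<omega>\<in>space M. \<exists>k\<le>n. l \<le> \<bar>psum (\<lambda>j. y j \<omega>) k\<bar>}
      = expectation (indicator {\<omega>\<in>space M. \<exists>k\<le>n. l \<le> \<bar>psum (\<lambda>j. y j \<omega>) k\<bar>})"
    by (subst Bochner_Integration.integral_indicator) (auto simp: Int_def intro!: arg_cong[where f=prob])
  also have "\<dots> \<le> expectation (J l n)"
    using jumps_ge_1[OF l] 
    by (intro integral_mono integrable_J integrable_real_indicator)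
       (auto simp: indicator_def jumps_nonneg emeasure_eq_measure)
  finally show ?thesis .
qed

lemma Kolmogorov_inequality:
  fixes v :: real
  assumes "l > 0" and "\<And>j. j \<in> {1..n} \<Longrightarrow> expectation (\<lambda>\<omega>. (y j \<omega>)\<^sup>2) \<le> v"
  shows "prob {\<omega>\<in>space M. \<exists>k\<le>n. l \<le> \<bar>psum (\<lambda>j. y j \<omega>) k\<bar>} \<le> n * v / l\<^sup>2"
  using prob_max_psum_le[OF assms(1)] expectation_jumps_le[OF assms] by (rule order_trans)

text \<open>For stretches of length n/m and a level of order sqrt n the bound is of order 1/m^2,
  which survives a union bound over m stretches; the variance bound would only give 1/m.\<close>

lemma fourth_moment_maximal:
  fixes b :: real
  assumes l: "l > 0" and b: "\<And>j \<omega>. j \<in> {1..n} \<Longrightarrow> \<omega> \<in> space M \<Longrightarrow> \<bar>y j \<omega>\<bar> \<le> b"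
  shows "prob {\<omega>\<in>space M. \<exists>k\<le>n. l \<le> \<bar>psum (\<lambda>j. y j \<omega>) k\<bar>} \<le> 4 * n\<^sup>2 * b^4 / l^4"
proof -
  have "l^4 * expectation (J l n) \<le> 4 * n\<^sup>2 * b^4"
  proof -
    have "0 \<le> expectation (\<lambda>\<omega>. (G l n \<omega>)^4)" by (intro Bochner_Integration.integral_nonneg) simp
    then show ?thesis using fourth_moment_gap[OF l b order_refl]
      unfolding of_nat_mult of_nat_power of_nat_numeral by linarith
  qed
  then have "expectation (J l n) \<le> 4 * n\<^sup>2 * b^4 / l^4" using l by (simp add: field_simps)
  then show ?thesis using prob_max_psum_le[OF l] by (rule order_trans[rotated])
qed

end

section \<open>Tail and mean of the q-variation of sums\<close>

text \<open>The summand 1 stems from the maximal inequality for the partial sums, the fraction from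
  the geometric series with ratio 2^(2 - q) over the dyadic scales. The ratio is below 1 exactly for
  q > 2.\<close>

definition tail_const :: "real \<Rightarrow> real" where
  "tail_const q = 1 + 16 * 2 powr (q - 2) / (1 - 2 powr (2 - q))"

lemma tail_const_pos: "q > 2 \<Longrightarrow> tail_const q > 0"
  unfolding tail_const_def by (intro add_pos_nonneg divide_nonneg_nonneg) (auto simp: powr_less_one less_imp_le)

context centred_independent
begin

text \<open>Off the event that some partial sum reaches x in modulus, the q-th power of the
  statistic is at most the dyadic sum \<open>H\<close>. A scale s contributes at most 16 (4 s)^(q -
  2) n v to its mean, so these contributions form a geometric series, and Markov's inequality at
  level x^q applies.\<close>

lemma prob_test_statistic_ge_le:
  fixes v :: real
  assumes q: "q > 2" and x: "x > 0" and v: "\<And>j. j \<in> {1..n} \<Longrightarrow> expectation (\<lambda>\<omega>. (y j \<omega>)\<^sup>2) \<le> v" "v \<ge> 0"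
  shows "prob {\<omega>\<in>space M. x \<le> test_statistic q n (\<lambda>j. y j \<omega>)} \<le> tail_const q * n * v / x\<^sup>2"
proof -
  have [measurable]: "(\<lambda>\<omega>. test_statistic q n (\<lambda>j. y j \<omega>)) \<in> borel_measurable M"
    using q by (intro borel_measurable_test_statistic) auto
  \<comment> \<open>With 2 R = x the smallness condition of the pathwise bound is precisely the
    complement of \<open>E\<close>.\<close>
  define R where "R = x / 2"
  define \<rho> where "\<rho> = (2::real) powr (2 - q)"
  have \<rho>: "0 < \<rho>" "\<rho> < 1" using q by (auto simp: \<rho>_def powr_less_one)
  define H where "H \<omega> = (\<Sum>m. ennreal ((4 * (R / 2 ^ m)) powr q * J (R / 2 ^ m) n \<omega>))" for \<omega>
  have [measurable]: "H \<in> borel_measurable M" unfolding H_def by measurable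
  define E where "E = {\<omega>\<in>space M. \<exists>k\<le>n. x \<le> \<bar>psum (\<lambda>j. y j \<omega>) k\<bar>}"
  have E [measurable]: "E \<in> sets M" unfolding E_def by measurable
  have sum: "(\<lambda>m. 16 * (2 * x) powr (q - 2) * n * v * \<rho> ^ m) sums (16 * (2 * x) powr (q - 2) * n * v * (1 / (1 - \<rho>)))"
    using \<rho> by (intro sums_mult geometric_sums) auto
  have "(\<integral>\<^sup>+\<omega>. H \<omega> \<partial>M) = (\<Sum>m. \<integral>\<^sup>+\<omega>. ennreal ((4 * (R / 2 ^ m)) powr q * J (R / 2 ^ m) n \<omega>) \<partial>M)"
    unfolding H_def by (rule nn_integral_suminf) measurable
  also have "\<dots> \<le> (\<Sum>m. ennreal (16 * (2 * x) powr (q - 2) * n * v * \<rho> ^ m))"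
  proof (intro suminf_le)
    fix m
    define s where "s = R / 2 ^ m"
    have s: "s > 0" using x by (simp add: s_def R_def)
    have "(\<integral>\<^sup>+\<omega>. ennreal ((4 * s) powr q * J s n \<omega>) \<partial>M) = ennreal (expectation (\<lambda>\<omega>. (4 * s) powr q * J s n \<omega>))"
      using integrable_J by (intro nn_integral_eq_integral) (auto simp: jumps_nonneg)
    also have "expectation (\<lambda>\<omega>. (4 * s) powr q * J s n \<omega>) \<le> (4 * s) powr q * (n * v / s\<^sup>2)"
      using mult_left_mono[OF expectation_jumps_le[OF s v(1)], of "(4 * s) powr q"] by simp
    also have "(4 * s) powr q * (n * v / s\<^sup>2) = 16 * (2 * x) powr (q - 2) * n * v * \<rho> ^ m"
    proof -
      \<comment> \<open>The factor (4 s)^2 cancels the s^2 of the restart bound up to 16; what is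
        left decays geometrically in m.\<close>
      have "(4 * s) powr q = (4 * s) powr (q - 2) * (4 * s)\<^sup>2"
        using s powr_add[of "4 * s" "q - 2" 2] by (simp add: powr_numeral)
      also have "(4 * s) powr (q - 2) = (2 * x / 2 ^ m) powr (q - 2)"
        by (simp add: s_def R_def)
      also have "\<dots> = (2 * x) powr (q - 2) * \<rho> ^ m"
      proof -
        have "\<rho> ^ m = 1 / (2 ^ m) powr (q - 2)"
          by (simp add: \<rho>_def powr_realpow[symmetric] powr_powr powr_minus_divide[symmetric] algebra_simps)
        then show ?thesis using x by (simp add: powr_divide)
      qed
      finally show ?thesis using s by (simp add: power2_eq_square field_simps)
    qed
    finally show "(\<integral>\<^sup>+\<omega>. ennreal ((4 * (R / 2 ^ m)) powr q * J (R / 2 ^ m) n \<omega>) \<partial>M) \<le> ennreal (16 * (2 * x) powr (q - 2) * n * v * \<rho> ^ m)"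
      by (simp add: s_def ennreal_leI)
  qed auto
  also have "\<dots> = ennreal (16 * (2 * x) powr (q - 2) * n * v * (1 / (1 - \<rho>)))"
    using \<rho> v(2) sums_unique[OF sum] by (subst suminf_ennreal2) (auto simp: sums_summable[OF sum])
  finally have H: "(\<integral>\<^sup>+\<omega>. H \<omega> \<partial>M) \<le> ennreal (16 * (2 * x) powr (q - 2) * n * v * (1 / (1 - \<rho>)))" .
  define c where "c = 1 / x powr q"
  have "emeasure M {\<omega>\<in>space M. 1 \<le> ennreal c * H \<omega>} \<le> ennreal c * (\<integral>\<^sup>+\<omega>. H \<omega> \<partial>M)"
  proof -
    have "(\<integral>\<^sup>+\<omega>. H \<omega> * indicator (space M) \<omega> \<partial>M) = (\<integral>\<^sup>+\<omega>. H \<omega> \<partial>M)"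
      by (rule nn_integral_cong) simp
    then show ?thesis
      using nn_integral_Markov_inequality[where u=H and M=M and A="space M" and c="ennreal c"] by simp
  qed
  also have "\<dots> \<le> ennreal c * ennreal (16 * (2 * x) powr (q - 2) * n * v * (1 / (1 - \<rho>)))"
    by (rule mult_left_mono[OF H]) simp
  also have "\<dots> = ennreal (c * (16 * (2 * x) powr (q - 2) * n * v * (1 / (1 - \<rho>))))"
    using \<rho> v(2) by (intro ennreal_mult[symmetric]) (auto simp: c_def)
  also have "c * (16 * (2 * x) powr (q - 2) * n * v * (1 / (1 - \<rho>))) = (tail_const q - 1) * n * v / x\<^sup>2"
  proof -
    have "(2 * x) powr (q - 2) = 2 powr (q - 2) * x powr q / x\<^sup>2"
      using x by (simp add: powr_mult powr_diff powr_numeral)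
    then show ?thesis using x \<rho> by (simp add: c_def tail_const_def \<rho>_def[symmetric] field_simps)
  qed
  finally have "ennreal (prob {\<omega>\<in>space M. 1 \<le> ennreal c * H \<omega>}) \<le> ennreal ((tail_const q - 1) * n * v / x\<^sup>2)"
    by (simp add: emeasure_eq_measure)
  moreover have "0 \<le> (tail_const q - 1) * n * v / x\<^sup>2"
    using \<rho> v(2) by (simp add: tail_const_def \<rho>_def)
  ultimately have 1: "prob {\<omega>\<in>space M. 1 \<le> ennreal c * H \<omega>} \<le> (tail_const q - 1) * n * v / x\<^sup>2"
    by (simp add: ennreal_le_iff)
  have 2: "prob E \<le> n * v / x\<^sup>2"
    unfolding E_def by (rule Kolmogorov_inequality[OF x v(1)])
  have "{\<omega>\<in>space M. x \<le> test_statistic q n (\<lambda>j. y j \<omega>)} \<subseteq> {\<omega>\<in>space M. 1 \<le> ennreal c * H \<omega>} \<union> E"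
  proof safe
    fix \<omega> assume \<omega>: "\<omega> \<in> space M" "x \<le> test_statistic q n (\<lambda>j. y j \<omega>)" "\<omega> \<notin> E"
    have small: "\<bar>psum (\<lambda>j. y j \<omega>) k\<bar> < 2 * R" if "k \<le> n" for k
    proof (rule ccontr)
      assume "\<not> ?thesis"
      then have "\<omega> \<in> E" unfolding E_def R_def using that \<omega>(1) by auto
      then show False using \<omega>(3) by simp
    qed
    have "ennreal (test_statistic q n (\<lambda>j. y j \<omega>) powr q) \<le> H \<omega>"
      unfolding H_def using q x by (intro test_statistic_le_jumps small) (auto simp: R_def)
    moreover have "x powr q \<le> test_statistic q n (\<lambda>j. y j \<omega>) powr q"
      using \<omega> x q by (intro powr_mono2) auto
    ultimately have "ennreal (x powr q) \<le> H \<omega>" by (meson ennreal_leI order_trans)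
    then have "ennreal c * ennreal (x powr q) \<le> ennreal c * H \<omega>" by (rule mult_left_mono) simp
    moreover have "ennreal c * ennreal (x powr q) = 1"
      using x by (simp add: c_def ennreal_mult[symmetric])
    ultimately show "1 \<le> ennreal c * H \<omega>" by simp
  qed
  then have "prob {\<omega>\<in>space M. x \<le> test_statistic q n (\<lambda>j. y j \<omega>)} \<le> prob ({\<omega>\<in>space M. 1 \<le> ennreal c * H \<omega>} \<union> E)"
    by (intro finite_measure_mono) auto
  also have "\<dots> \<le> prob {\<omega>\<in>space M. 1 \<le> ennreal c * H \<omega>} + prob E"
    by (intro measure_Un_le) auto
  also have "\<dots> \<le> (tail_const q - 1) * n * v / x\<^sup>2 + n * v / x\<^sup>2" using 1 2 by simp
  also have "\<dots> = tail_const q * n * v / x\<^sup>2" by (simp add: add_divide_distrib[symmetric] algebra_simps)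
  finally show ?thesis .
qed

lemma integrable_test_statistic: "q \<ge> 1 \<Longrightarrow> integrable M (\<lambda>\<omega>. test_statistic q n (\<lambda>j. y j \<omega>))"
  by (rule Bochner_Integration.integrable_bound[of M "\<lambda>\<omega>. \<Sum>j=1..n. \<bar>y j \<omega>\<bar>"])
     (use test_statistic_le_l1[of q n] in \<open>auto intro!: Bochner_Integration.integrable_sum integrable_abs
        integrable_y borel_measurable_test_statistic simp: test_statistic_nonneg sum_nonneg\<close>)

text \<open>Tails of order x^(-2) are integrable: above s the statistic is split into the layers
  from 2^i s to 2^(i+1) s. Layer i costs at most 2 * 2^i s * \<open>tail_const q\<close> / 4^i, and
  these sum to 4 \<open>tail_const q\<close> s. The scale s is a free bound for sqrt(n v), hence
  positive even if v = 0.\<close>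

lemma expectation_test_statistic_le:
  fixes v :: real
  assumes q: "q > 2" and s: "s > 0" and v: "\<And>j. j \<in> {1..n} \<Longrightarrow> expectation (\<lambda>\<omega>. (y j \<omega>)\<^sup>2) \<le> v" "v \<ge> 0"
    and ns: "n * v \<le> s\<^sup>2"
  shows "expectation (\<lambda>\<omega>. test_statistic q n (\<lambda>j. y j \<omega>)) \<le> (1 + 4 * tail_const q) * s"
proof -
  define T where "T \<omega> = test_statistic q n (\<lambda>j. y j \<omega>)" for \<omega>
  have T0: "0 \<le> T \<omega>" for \<omega> using q by (simp add: T_def test_statistic_nonneg)
  have [measurable]: "T \<in> borel_measurable M"
    unfolding T_def using q by (intro borel_measurable_test_statistic) auto
  let ?g = "\<lambda>i \<omega>. ennreal (2 * 2 ^ i * s) * indicator {\<omega>\<in>space M. 2 ^ i * s \<le> T \<omega>} \<omega>"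
  have pw: "ennreal (T \<omega>) \<le> ennreal s + (\<Sum>i. ?g i \<omega>)" if \<omega>: "\<omega> \<in> space M" for \<omega>
  proof (cases "T \<omega> \<le> s")
    case True then show ?thesis by (simp add: add_increasing2 ennreal_leI)
  next
    case False
    have "\<exists>i. T \<omega> < 2 ^ Suc i * s"
    proof -
      obtain i where "T \<omega> / s < 2 ^ i" using real_arch_pow[of 2] by auto
      then show ?thesis using s by (intro exI[of _ i]) (simp add: field_simps, use T0[of \<omega>] in linarith)
    qed
    define i where "i = (LEAST i. T \<omega> < 2 ^ Suc i * s)"
    have i: "T \<omega> < 2 ^ Suc i * s" unfolding i_def by (rule LeastI_ex) fact
    have "2 ^ i * s \<le> T \<omega>"
    proof (cases i)
      case 0 then show ?thesis using False by simp
    next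
      case (Suc i')
      then show ?thesis using not_less_Least[of i' "\<lambda>i. T \<omega> < 2 ^ Suc i * s"] unfolding i_def by fastforce
    qed
    then have "ennreal (T \<omega>) \<le> ?g i \<omega>" using i \<omega> by (simp add: ennreal_leI)
    also have "\<dots> \<le> (\<Sum>i. ?g i \<omega>)" by (rule ennreal_term_le_suminf)
    finally show ?thesis by (simp add: add_increasing)
  qed
  have geo: "(\<lambda>i. 2 * tail_const q * s * (1 / 2) ^ i) sums (2 * tail_const q * s * 2)"
    using geometric_sums[of "1 / 2 :: real"] by (intro sums_mult) simp
  have "ennreal (expectation T) = (\<integral>\<^sup>+\<omega>. ennreal (T \<omega>) \<partial>M)"
    using q T0 unfolding T_def by (intro nn_integral_eq_integral[symmetric] integrable_test_statistic) auto
  also have "\<dots> \<le> (\<integral>\<^sup>+\<omega>. ennreal s + (\<Sum>i. ?g i \<omega>) \<partial>M)"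
    by (intro nn_integral_mono pw)
  also have "\<dots> = ennreal s + (\<Sum>i. \<integral>\<^sup>+\<omega>. ?g i \<omega> \<partial>M)"
    by (subst nn_integral_add) (auto simp: nn_integral_suminf emeasure_space_1)
  also have "\<dots> \<le> ennreal s + (\<Sum>i. ennreal (2 * tail_const q * s * (1 / 2) ^ i))"
  proof (intro add_left_mono suminf_le)
    fix i
    have "(\<integral>\<^sup>+\<omega>. ?g i \<omega> \<partial>M) = ennreal (2 * 2 ^ i * s) * ennreal (prob {\<omega>\<in>space M. 2 ^ i * s \<le> T \<omega>})"
      by (subst nn_integral_cmult_indicator) (auto simp: emeasure_eq_measure)
    also have "\<dots> = ennreal (2 * 2 ^ i * s * prob {\<omega>\<in>space M. 2 ^ i * s \<le> T \<omega>})"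
      using s by (simp add: ennreal_mult)
    also have "\<dots> \<le> ennreal (2 * 2 ^ i * s * (tail_const q * n * v / (2 ^ i * s)\<^sup>2))"
      unfolding T_def using s by (intro ennreal_leI mult_left_mono prob_test_statistic_ge_le q v) auto
    also have "\<dots> \<le> ennreal (2 * 2 ^ i * s * (tail_const q * s\<^sup>2 / (2 ^ i * s)\<^sup>2))"
      using s ns tail_const_pos[OF q] by (intro ennreal_leI mult_left_mono divide_right_mono) (auto simp: mult.assoc)
    also have "2 * 2 ^ i * s * (tail_const q * s\<^sup>2 / (2 ^ i * s)\<^sup>2) = 2 * tail_const q * s * (1 / 2) ^ i"
      using s by (simp add: power2_eq_square field_simps power_mult_distrib[symmetric])
    finally show "(\<integral>\<^sup>+\<omega>. ?g i \<omega> \<partial>M) \<le> ennreal (2 * tail_const q * s * (1 / 2) ^ i)" .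
  qed auto
  also have "(\<Sum>i. ennreal (2 * tail_const q * s * (1 / 2) ^ i)) = ennreal (2 * tail_const q * s * 2)"
    using tail_const_pos[OF q] s sums_unique[OF geo] by (subst suminf_ennreal2) (auto simp: sums_summable[OF geo])
  also have "ennreal s + ennreal (2 * tail_const q * s * 2) = ennreal ((1 + 4 * tail_const q) * s)"
    using tail_const_pos[OF q] s by (simp add: ennreal_plus[symmetric] algebra_simps del: ennreal_plus)
  finally show ?thesis
    using tail_const_pos[OF q] s unfolding T_def by (subst (asm) ennreal_le_iff) (auto intro!: mult_nonneg_nonneg)
qed

end

section \<open>From the linear process to its innovations\<close>

text \<open>Reindexing is grouping into the singletons of the f j, which are disjoint by
  injectivity.\<close>

lemma (in prob_space) indep_vars_reindex:
  assumes "indep_vars M' X I" "inj_on f J" "f ` J \<subseteq> I"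
  shows "indep_vars (\<lambda>i. M' (f i)) (\<lambda>i. X (f i)) J"
proof -
  have "indep_vars (\<lambda>j. PiM {f j} M') (\<lambda>j \<omega>. restrict (\<lambda>i. X i \<omega>) {f j}) J"
    using assms by (intro indep_vars_restrict) (auto simp: disjoint_family_on_def dest: inj_onD)
  from indep_vars_compose2[OF this, of "\<lambda>j g. g (f j)" "\<lambda>i. M' (f i)"]
  show ?thesis by (simp add: measurable_component_singleton)
qed

text \<open>Raising the lag by one changes a partial sum only by one term at either end, at a cost
  of 2 b; the bound does not depend on k.\<close>

lemma psum_shift_diff_le:
  fixes u :: "int \<Rightarrow> real"
  assumes "\<And>i. \<bar>u i\<bar> \<le> b"
  shows "\<bar>psum (\<lambda>i. u (int i - int j) - u (int i)) k\<bar> \<le> 2 * j * b"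
proof (induction j)
  case (Suc j)
  have tel: "psum (\<lambda>i. u (int i - int (Suc j))) k = psum (\<lambda>i. u (int i - int j)) k + u (- int j) - u (int k - int j)" for k
    by (induction k) (auto simp: algebra_simps)
  have d: "psum (\<lambda>i. u (int i - int j) - u (int i)) k = psum (\<lambda>i. u (int i - int j)) k - psum (\<lambda>i. u (int i)) k" for j
    by (simp add: psum_def sum_subtractf)
  have "psum (\<lambda>i. u (int i - int (Suc j)) - u (int i)) k
      = psum (\<lambda>i. u (int i - int j) - u (int i)) k + u (- int j) - u (int k - int j)"
    unfolding d tel by simp
  then show ?case using Suc assms[of "- int j"] assms[of "int k - int j"] by (simp add: algebra_simps)
qed (simp add: psum_def)

section \<open>The innovations: truncation and lagged differences\<close>

locale iid_noise = prob_space +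
  fixes \<eta> :: "int \<Rightarrow> 'a \<Rightarrow> real" and \<sigma> :: real
  assumes indep_eta: "indep_vars (\<lambda>_. borel) \<eta> UNIV"
    and ident: "distr M borel (\<eta> i) = distr M borel (\<eta> 1)"
    and sq_integrable: "integrable M (\<lambda>\<omega>. (\<eta> 1 \<omega>)\<^sup>2)"
    and mean: "expectation (\<eta> 1) = 0"
    and variance_eta: "\<sigma>\<^sup>2 = expectation (\<lambda>\<omega>. (\<eta> 1 \<omega>)\<^sup>2)"
    and sigma_pos: "\<sigma> > 0"
begin

lemma measurable_eta [measurable]: "\<eta> i \<in> borel_measurable M"
  using indep_eta unfolding indep_vars_def by auto

lemma expectation_eta:
  assumes "f \<in> borel_measurable borel"
  shows "expectation (\<lambda>\<omega>. f (\<eta> i \<omega>) :: real) = expectation (\<lambda>\<omega>. f (\<eta> 1 \<omega>))"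
  using integral_distr[OF measurable_eta assms, of i] integral_distr[OF measurable_eta assms, of 1]
  by (simp add: ident[of i])

lemma integrable_eta:
  assumes "f \<in> borel_measurable borel" "integrable M (\<lambda>\<omega>. f (\<eta> 1 \<omega>) :: real)"
  shows "integrable M (\<lambda>\<omega>. f (\<eta> i \<omega>))"
  using assms integrable_distr_eq[OF measurable_eta assms(1), of i] integrable_distr_eq[OF measurable_eta assms(1), of 1]
  by (simp add: ident[of i])

text \<open>The shift \<open>c\<close> covers lagged noise and noise inside a later block, the
  function \<open>h\<close> the parts produced by truncation.\<close>

lemma centred_independent_eta:
  assumes [measurable]: "h \<in> borel_measurable borel"
    and "integrable M (\<lambda>\<omega>. (h (\<eta> 1 \<omega>))\<^sup>2)" "expectation (\<lambda>\<omega>. h (\<eta> 1 \<omega>)) = 0"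
  shows "centred_independent M (\<lambda>k \<omega>. h (\<eta> (int k + c) \<omega>)) n"
proof
  show "(\<lambda>\<omega>. h (\<eta> (int j + c) \<omega>)) \<in> borel_measurable M" for j by measurable
  have "indep_vars (\<lambda>_. borel) (\<lambda>k. \<eta> (int k + c)) {1..n}"
    by (rule indep_vars_reindex[OF indep_eta]) (auto intro: inj_onI)
  then show "indep_vars (\<lambda>_. borel) (\<lambda>k \<omega>. h (\<eta> (int k + c) \<omega>)) {1..n}"
    by (rule indep_vars_compose2) simp
  show "integrable M (\<lambda>\<omega>. (h (\<eta> (int j + c) \<omega>))\<^sup>2)" for j
    by (rule integrable_eta[where f="\<lambda>x. (h x)\<^sup>2"]) (use assms in auto)
  show "expectation (\<lambda>\<omega>. h (\<eta> (int j + c) \<omega>)) = 0" for j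
    using expectation_eta[of h "int j + c"] assms by simp
qed

lemma expectation_test_statistic_eta_le:
  assumes h: "h \<in> borel_measurable borel"
    "integrable M (\<lambda>\<omega>. (h (\<eta> 1 \<omega>))\<^sup>2)" "expectation (\<lambda>\<omega>. h (\<eta> 1 \<omega>)) = 0"
    and v: "expectation (\<lambda>\<omega>. (h (\<eta> 1 \<omega>))\<^sup>2) \<le> v\<^sup>2" "v > 0" and q: "q > 2" and n: "n > 0"
  shows "expectation (\<lambda>\<omega>. test_statistic q n (\<lambda>k. h (\<eta> (int k + c) \<omega>))) \<le> (1 + 4 * tail_const q) * v * sqrt n"
proof -
  interpret c: centred_independent M "\<lambda>k \<omega>. h (\<eta> (int k + c) \<omega>)" n
    by (rule centred_independent_eta[OF h])
  have "expectation (\<lambda>\<omega>. test_statistic q n (\<lambda>k. h (\<eta> (int k + c) \<omega>))) \<le> (1 + 4 * tail_const q) * (v * sqrt n)"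
  proof (rule c.expectation_test_statistic_le[where v="v\<^sup>2"])
    show "expectation (\<lambda>\<omega>. (h (\<eta> (int j + c) \<omega>))\<^sup>2) \<le> v\<^sup>2" for j
      using expectation_eta[of "\<lambda>x. (h x)\<^sup>2" "int j + c"] h v by simp
  qed (use v q n in \<open>auto simp: power_mult_distrib\<close>)
  then show ?thesis by (simp add: mult.assoc)
qed

lemma integrable_test_statistic_eta:
  assumes h: "h \<in> borel_measurable borel"
    "integrable M (\<lambda>\<omega>. (h (\<eta> 1 \<omega>))\<^sup>2)" "expectation (\<lambda>\<omega>. h (\<eta> 1 \<omega>)) = 0" and q: "q \<ge> 1"
  shows "integrable M (\<lambda>\<omega>. test_statistic q n (\<lambda>k. h (\<eta> (int k + c) \<omega>)))"
  by (rule centred_independent.integrable_test_statistic[OF centred_independent_eta[OF h] q])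

text \<open>Clamping to [-a, a] leaves a remainder whose second moment vanishes as a grows, by
  dominated convergence. Both parts are recentred by the mean m of the clamped part, with opposite
  signs so that their sum is unchanged.\<close>

lemma truncation:
  assumes "\<epsilon> > 0"
  obtains h1 h2 :: "real \<Rightarrow> real" and b where
    "h1 \<in> borel_measurable borel" "h2 \<in> borel_measurable borel"
    "\<And>x. h1 x + h2 x = x" "\<And>x. \<bar>h1 x\<bar> \<le> b" "b > 0"
    "expectation (\<lambda>\<omega>. h1 (\<eta> 1 \<omega>)) = 0" "expectation (\<lambda>\<omega>. h2 (\<eta> 1 \<omega>)) = 0"
    "integrable M (\<lambda>\<omega>. (h1 (\<eta> 1 \<omega>))\<^sup>2)" "integrable M (\<lambda>\<omega>. (h2 (\<eta> 1 \<omega>))\<^sup>2)"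
    "expectation (\<lambda>\<omega>. (h2 (\<eta> 1 \<omega>))\<^sup>2) \<le> \<epsilon>"
proof -
  define cl where "cl a x = max (- a) (min a x)" for a x :: real
  have cl_b: "\<bar>cl a x\<bar> \<le> a" if "a \<ge> 0" for a x using that by (auto simp: cl_def)
  have tl_b: "\<bar>x - cl a x\<bar> \<le> \<bar>x\<bar>" if "a \<ge> 0" for a x using that by (auto simp: cl_def max_def min_def)
  have [measurable]: "cl a \<in> borel_measurable borel" for a unfolding cl_def by measurable
  have "(\<lambda>n. expectation (\<lambda>\<omega>. (\<eta> 1 \<omega> - cl (real n) (\<eta> 1 \<omega>))\<^sup>2)) \<longlonglongrightarrow> expectation (\<lambda>\<omega>. 0)"
  proof (rule integral_dominated_convergence[where w="\<lambda>\<omega>. (\<eta> 1 \<omega>)\<^sup>2"])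
    show "AE \<omega> in M. (\<lambda>n. (\<eta> 1 \<omega> - cl (real n) (\<eta> 1 \<omega>))\<^sup>2) \<longlonglongrightarrow> 0"
    proof (intro AE_I2 tendsto_eventually)
      fix \<omega>
      obtain N where "\<bar>\<eta> 1 \<omega>\<bar> < real N" using reals_Archimedean2 by blast
      then show "\<forall>\<^sub>F n in sequentially. (\<eta> 1 \<omega> - cl (real n) (\<eta> 1 \<omega>))\<^sup>2 = 0"
        by (intro eventually_sequentiallyI[of N]) (auto simp: cl_def max_def min_def)
    qed
    show "AE \<omega> in M. norm ((\<eta> 1 \<omega> - cl (real n) (\<eta> 1 \<omega>))\<^sup>2) \<le> (\<eta> 1 \<omega>)\<^sup>2" for n
      using tl_b[of "real n"] by (simp add: abs_le_square_iff)
  qed (use sq_integrable in auto)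
  then have "\<forall>\<^sub>F n in sequentially. expectation (\<lambda>\<omega>. (\<eta> 1 \<omega> - cl (real n) (\<eta> 1 \<omega>))\<^sup>2) < \<epsilon>"
    using assms by (intro order_tendstoD(2)) auto
  then obtain n where n: "expectation (\<lambda>\<omega>. (\<eta> 1 \<omega> - cl (real n) (\<eta> 1 \<omega>))\<^sup>2) < \<epsilon>"
    by (auto simp: eventually_sequentially)
  define a where "a = real n"
  define m where "m = expectation (\<lambda>\<omega>. cl a (\<eta> 1 \<omega>))"
  have i_eta: "integrable M (\<eta> 1)" by (rule square_integrable_imp_integrable[OF _ sq_integrable]) simp
  have i_cl: "integrable M (\<lambda>\<omega>. cl a (\<eta> 1 \<omega>))"
    by (rule integrable_const_bound[of _ a]) (use cl_b[of a] in \<open>auto simp: a_def\<close>)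
  have m_le: "\<bar>m\<bar> \<le> a"
  proof -
    have "\<bar>m\<bar> \<le> expectation (\<lambda>\<omega>. \<bar>cl a (\<eta> 1 \<omega>)\<bar>)" unfolding m_def by (rule integral_abs_bound)
    also have "\<dots> \<le> a" using i_cl cl_b by (intro integral_le_const) (auto simp: a_def)
    finally show ?thesis .
  qed
  have i_t2: "integrable M (\<lambda>\<omega>. (\<eta> 1 \<omega> - cl a (\<eta> 1 \<omega>))\<^sup>2)"
    by (rule Bochner_Integration.integrable_bound[OF sq_integrable])
       (use tl_b[of a] in \<open>auto simp: abs_le_square_iff a_def\<close>)
  have mt: "expectation (\<lambda>\<omega>. \<eta> 1 \<omega> - cl a (\<eta> 1 \<omega>)) = - m"
    using i_eta i_cl mean by (simp add: m_def)
  show ?thesis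
  \<comment> \<open>Clamped value and mean are both bounded by \<open>a\<close>; the
    \<open>+ 1\<close> keeps the bound positive, as the level \<open>a\<close> may be 0.\<close>
  proof (rule that[of "\<lambda>x. cl a x - m" "\<lambda>x. x - cl a x + m" "2 * a + 1"])
    show "\<bar>cl a x - m\<bar> \<le> 2 * a + 1" for x
      using cl_b[of a x] m_le by (simp add: a_def)
    show "expectation (\<lambda>\<omega>. cl a (\<eta> 1 \<omega>) - m) = 0"
      using i_cl by (simp add: m_def prob_space)
    show "expectation (\<lambda>\<omega>. \<eta> 1 \<omega> - cl a (\<eta> 1 \<omega>) + m) = 0"
      using i_cl i_eta mean by (simp add: m_def prob_space)
    show "integrable M (\<lambda>\<omega>. (cl a (\<eta> 1 \<omega>) - m)\<^sup>2)"
    proof (rule integrable_const_bound[of _ "(2 * a)\<^sup>2"])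
      show "AE \<omega> in M. norm ((cl a (\<eta> 1 \<omega>) - m)\<^sup>2) \<le> (2 * a)\<^sup>2"
      proof (rule AE_I2)
        fix \<omega>
        have "\<bar>cl a (\<eta> 1 \<omega>) - m\<bar> \<le> \<bar>2 * a\<bar>" using cl_b[of a "\<eta> 1 \<omega>"] m_le by (simp add: a_def)
        then show "norm ((cl a (\<eta> 1 \<omega>) - m)\<^sup>2) \<le> (2 * a)\<^sup>2" by (simp add: abs_le_square_iff)
      qed
    qed measurable
    have i_t1: "integrable M (\<lambda>\<omega>. \<eta> 1 \<omega> - cl a (\<eta> 1 \<omega>))" using i_eta i_cl by simp
    have e: "(\<eta> 1 \<omega> - cl a (\<eta> 1 \<omega>) + m)\<^sup>2 = (\<eta> 1 \<omega> - cl a (\<eta> 1 \<omega>))\<^sup>2 + 2 * m * (\<eta> 1 \<omega> - cl a (\<eta> 1 \<omega>)) + m\<^sup>2" for \<omega>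
      by (simp add: power2_eq_square algebra_simps)
    show "integrable M (\<lambda>\<omega>. (\<eta> 1 \<omega> - cl a (\<eta> 1 \<omega>) + m)\<^sup>2)"
      unfolding e by (intro Bochner_Integration.integrable_add integrable_mult_right i_t1 i_t2) simp
    have "expectation (\<lambda>\<omega>. (\<eta> 1 \<omega> - cl a (\<eta> 1 \<omega>) + m)\<^sup>2)
        = expectation (\<lambda>\<omega>. (\<eta> 1 \<omega> - cl a (\<eta> 1 \<omega>))\<^sup>2) + 2 * m * expectation (\<lambda>\<omega>. \<eta> 1 \<omega> - cl a (\<eta> 1 \<omega>)) + m\<^sup>2"
      unfolding e using i_t1 i_t2 by (simp add: prob_space del: Bochner_Integration.integral_diff)
    \<comment> \<open>The remainder has mean -m, so recentring changes its second moment by -2 m^2 +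
      m^2 = -m^2 and only lowers it.\<close>
    also have "\<dots> \<le> \<epsilon>" unfolding mt using n by (simp add: a_def power2_eq_square) (smt (verit) zero_le_square)
    finally show "expectation (\<lambda>\<omega>. (\<eta> 1 \<omega> - cl a (\<eta> 1 \<omega>) + m)\<^sup>2) \<le> \<epsilon>" .
  qed (auto simp: a_def)
qed

text \<open>Interpolation between the 1-variation, at most 2 b n, and the partial sums, at most 2 j
  b uniformly: only the former grows with n, so the p-th root leaves n^(1/p).\<close>

lemma test_statistic_bounded_shift_le:
  fixes u :: "int \<Rightarrow> real"
  assumes p: "p \<ge> 1" and u: "\<And>i. \<bar>u i\<bar> \<le> b" and b: "b > 0"
  shows "test_statistic p n (\<lambda>i. u (int i - int j) - u (int i))
    \<le> ((4 * j * b) powr (p - 1) * 2 * b) powr (1 / p) * n powr (1 / p)"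
proof -
  let ?d = "\<lambda>i. u (int i - int j) - u (int i)"
  have "test_statistic p n ?d powr p \<le> (2 * (2 * j * b)) powr (p - 1) * test_statistic 1 n ?d powr 1"
    using p psum_shift_diff_le[OF u] by (intro test_statistic_interpolate) auto
  also have "\<dots> \<le> (2 * (2 * j * b)) powr (p - 1) * (2 * b * n)"
  proof (intro mult_left_mono)
    have "test_statistic 1 n ?d \<le> (\<Sum>i=1..n. \<bar>?d i\<bar>)" by (rule test_statistic_le_l1) simp
    also have "\<dots> \<le> (\<Sum>i=1..n. 2 * b)"
    proof (rule sum_mono)
      fix i show "\<bar>?d i\<bar> \<le> 2 * b" using u[of "int i - int j"] u[of "int i"] by linarith
    qed
    finally show "test_statistic 1 n ?d powr 1 \<le> 2 * b * n"
      using test_statistic_nonneg[of 1 n ?d] by (simp add: mult.commute)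
  qed simp
  finally have "test_statistic p n ?d powr p \<le> (4 * j * b) powr (p - 1) * 2 * b * n"
    by (simp add: mult.assoc)
  then have "(test_statistic p n ?d powr p) powr (1 / p) \<le> ((4 * j * b) powr (p - 1) * 2 * b * n) powr (1 / p)"
    using p by (intro powr_mono2) auto
  then show ?thesis
    using p b test_statistic_nonneg[OF p, of n ?d] by (simp add: powr_powr powr_mult)
qed

text \<open>The bounded part of the noise contributes n^(1/p) by the previous bound. The part of
  small variance is not compared with its shift at all: both copies are estimated separately and are
  small relative to sqrt n.\<close>

lemma expectation_shift_tendsto_0:
  assumes p: "p > 2"
  shows "(\<lambda>n. expectation (\<lambda>\<omega>. test_statistic p n (\<lambda>i. \<eta> (int i - int j) \<omega> - \<eta> (int i) \<omega>)) / sqrt n) \<longlonglongrightarrow> 0"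
    (is "(\<lambda>n. ?E n / sqrt (real n)) \<longlonglongrightarrow> 0")
proof (rule tendstoI)
  fix e :: real assume e: "e > 0"
  define C where "C = 1 + 4 * tail_const p"
  have C: "C > 0" using tail_const_pos[OF p] by (simp add: C_def)
  \<comment> \<open>Chosen so that the two copies together cost 2 C v sqrt n = (e / 2) sqrt
    n.\<close>
  define v where "v = e / (4 * C)"
  have v: "v > 0" using e C by (simp add: v_def)
  obtain h1 h2 b where h1: "h1 \<in> borel_measurable borel" and h2: "h2 \<in> borel_measurable borel"
    and h: "\<And>x. h1 x + h2 x = x" and b: "\<And>x. \<bar>h1 x\<bar> \<le> b" "b > 0"
    and m: "expectation (\<lambda>\<omega>. h1 (\<eta> 1 \<omega>)) = 0" "expectation (\<lambda>\<omega>. h2 (\<eta> 1 \<omega>)) = 0"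
    and i: "integrable M (\<lambda>\<omega>. (h1 (\<eta> 1 \<omega>))\<^sup>2)" "integrable M (\<lambda>\<omega>. (h2 (\<eta> 1 \<omega>))\<^sup>2)"
    and v2: "expectation (\<lambda>\<omega>. (h2 (\<eta> 1 \<omega>))\<^sup>2) \<le> v\<^sup>2"
    using truncation[of "v\<^sup>2"] v by auto
  note [measurable] = h1 h2
  define D where "D = ((4 * j * b) powr (p - 1) * 2 * b) powr (1 / p)"
  note it = integrable_test_statistic_eta[OF h2 i(2) m(2), of p]
  note et = expectation_test_statistic_eta_le[OF h2 i(2) m(2) v2 v p]
  have bound: "?E n \<le> D * n powr (1 / p) + e / 2 * sqrt n" if n: "n > 0" for n :: nat
  proof -
    have "?E n \<le> expectation (\<lambda>\<omega>. D * n powr (1 / p)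
        + (test_statistic p n (\<lambda>i. h2 (\<eta> (int i + - int j) \<omega>)) + test_statistic p n (\<lambda>i. h2 (\<eta> (int i + 0) \<omega>))))"
    proof (rule Bochner_Integration.integral_mono')
      fix \<omega>
      let ?a = "\<lambda>i. h1 (\<eta> (int i - int j) \<omega>) - h1 (\<eta> (int i) \<omega>)"
      let ?b = "\<lambda>i. h2 (\<eta> (int i - int j) \<omega>)" and ?c = "\<lambda>i. h2 (\<eta> (int i) \<omega>)"
      have eq: "(\<lambda>i. \<eta> (int i - int j) \<omega> - \<eta> (int i) \<omega>) = (\<lambda>i. ?a i + (?b i + (- 1) * ?c i))"
      proof
        fix i show "\<eta> (int i - int j) \<omega> - \<eta> (int i) \<omega> = ?a i + (?b i + (- 1) * ?c i)"
          using h[of "\<eta> (int i - int j) \<omega>"] h[of "\<eta> (int i) \<omega>"] by linarith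
      qed
      have "test_statistic p n (\<lambda>i. ?a i + (?b i + (- 1) * ?c i))
          \<le> test_statistic p n ?a + (test_statistic p n ?b + test_statistic p n (\<lambda>i. (- 1) * ?c i))"
        using p by (intro order_trans[OF test_statistic_triangle] add_left_mono test_statistic_triangle) auto
      moreover have "test_statistic p n (\<lambda>i. (- 1) * ?c i) = test_statistic p n ?c"
        using p by (subst test_statistic_scale) auto
      moreover have "test_statistic p n ?a \<le> D * n powr (1 / p)"
        unfolding D_def using p b test_statistic_bounded_shift_le[where u="\<lambda>i. h1 (\<eta> i \<omega>)"] by simp
      ultimately show "test_statistic p n (\<lambda>i. \<eta> (int i - int j) \<omega> - \<eta> (int i) \<omega>) \<le> D * n powr (1 / p)
        + (test_statistic p n (\<lambda>i. h2 (\<eta> (int i + - int j) \<omega>)) + test_statistic p n (\<lambda>i. h2 (\<eta> (int i + 0) \<omega>)))"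
        unfolding eq by simp
    next
      show "integrable M (\<lambda>\<omega>. D * n powr (1 / p)
        + (test_statistic p n (\<lambda>i. h2 (\<eta> (int i + - int j) \<omega>)) + test_statistic p n (\<lambda>i. h2 (\<eta> (int i + 0) \<omega>))))"
        using p by (intro Bochner_Integration.integrable_add it) auto
      show "0 \<le> D * n powr (1 / p) + (test_statistic p n (\<lambda>i. h2 (\<eta> (int i + - int j) \<omega>)) + test_statistic p n (\<lambda>i. h2 (\<eta> (int i + 0) \<omega>)))" for \<omega>
        using p by (intro add_nonneg_nonneg test_statistic_nonneg) (auto simp: D_def)
    qed
    also have "\<dots> = D * n powr (1 / p) + (expectation (\<lambda>\<omega>. test_statistic p n (\<lambda>i. h2 (\<eta> (int i + - int j) \<omega>)))
        + expectation (\<lambda>\<omega>. test_statistic p n (\<lambda>i. h2 (\<eta> (int i + 0) \<omega>))))"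
      using p it[of n "- int j"] it[of n 0] by (simp add: prob_space)
    also have "\<dots> \<le> D * n powr (1 / p) + (C * v * sqrt n + C * v * sqrt n)"
      unfolding C_def by (intro add_left_mono add_mono et n)
    also have "\<dots> = D * n powr (1 / p) + e / 2 * sqrt n"
      using C by (simp add: v_def field_simps)
    finally show ?thesis .
  qed
  \<comment> \<open>The exponent 1/p - 1/2 is negative because p > 2.\<close>
  have "(\<lambda>n::nat. D * n powr (1 / p - 1 / 2)) \<longlonglongrightarrow> D * 0"
    using p by (intro tendsto_mult tendsto_neg_powr filterlim_real_sequentially) (auto simp: field_simps)
  then have "\<forall>\<^sub>F n in sequentially. D * real n powr (1 / p - 1 / 2) < e / 2"
    using e by (intro order_tendstoD(2)) auto
  then show "\<forall>\<^sub>F n in sequentially. dist (?E n / sqrt n) 0 < e"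
    using eventually_gt_at_top[of 0]
  proof eventually_elim
    case (elim n)
    have "?E n / sqrt n \<le> (D * n powr (1 / p) + e / 2 * sqrt n) / sqrt n"
      using bound elim by (intro divide_right_mono) auto
    also have "\<dots> = D * n powr (1 / p - 1 / 2) + e / 2"
      using elim by (simp add: add_divide_distrib powr_diff powr_half_sqrt)
    also have "\<dots> < e" using elim by simp
    finally show ?case
      using p by (simp add: Bochner_Integration.integral_nonneg test_statistic_nonneg)
  qed
qed

end

section \<open>Replacing the linear process by a multiple of its innovations\<close>

locale short_memory = iid_noise +
  fixes \<psi> :: "nat \<Rightarrow> real"
  assumes summable_psi: "summable (\<lambda>j. \<bar>\<psi> j\<bar>)"
begin

abbreviation "X \<equiv> linear_process \<psi> \<eta>"

lemma measurable_X [measurable]: "X i \<in> borel_measurable M"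
  unfolding linear_process_def by measurable

text \<open>The value of \<open>linear_process\<close> is meaningful only where its series
  converges. The absolute series has expectation E|eta_1| times the sum of the |psi_j|, so it is
  finite almost surely, simultaneously for the countably many indices i.\<close>

lemma AE_summable: "AE \<omega> in M. \<forall>i. summable (\<lambda>j. \<bar>\<psi> j\<bar> * \<bar>\<eta> (i - int j) \<omega>\<bar>)"
proof (subst AE_all_countable, rule allI)
  fix i
  have i1: "integrable M (\<lambda>\<omega>. \<bar>\<eta> 1 \<omega>\<bar>)"
    by (intro integrable_abs square_integrable_imp_integrable[OF _ sq_integrable]) simp
  define c where "c = expectation (\<lambda>\<omega>. \<bar>\<eta> 1 \<omega>\<bar>)"
  have c0: "c \<ge> 0" by (simp add: c_def)
  have c: "(\<integral>\<^sup>+\<omega>. ennreal (\<bar>\<psi> j\<bar> * \<bar>\<eta> k \<omega>\<bar>) \<partial>M) = ennreal (\<bar>\<psi> j\<bar> * c)" for j k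
  proof -
    have "integrable M (\<lambda>\<omega>. \<bar>\<eta> k \<omega>\<bar>)" by (rule integrable_eta[of abs]) (use i1 in auto)
    then have "(\<integral>\<^sup>+\<omega>. ennreal (\<bar>\<psi> j\<bar> * \<bar>\<eta> k \<omega>\<bar>) \<partial>M) = ennreal (expectation (\<lambda>\<omega>. \<bar>\<psi> j\<bar> * \<bar>\<eta> k \<omega>\<bar>))"
      by (intro nn_integral_eq_integral) auto
    also have "expectation (\<lambda>\<omega>. \<bar>\<psi> j\<bar> * \<bar>\<eta> k \<omega>\<bar>) = \<bar>\<psi> j\<bar> * c"
      using expectation_eta[of abs k] by (simp add: c_def)
    finally show ?thesis .
  qed
  have "(\<integral>\<^sup>+\<omega>. (\<Sum>j. ennreal (\<bar>\<psi> j\<bar> * \<bar>\<eta> (i - int j) \<omega>\<bar>)) \<partial>M) = (\<Sum>j. ennreal (\<bar>\<psi> j\<bar> * c))"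
    by (simp add: nn_integral_suminf c)
  also have "\<dots> = ennreal (\<Sum>j. \<bar>\<psi> j\<bar> * c)"
    using c0 by (intro suminf_ennreal2 summable_mult2 summable_psi) auto
  finally have "(\<integral>\<^sup>+\<omega>. (\<Sum>j. ennreal (\<bar>\<psi> j\<bar> * \<bar>\<eta> (i - int j) \<omega>\<bar>)) \<partial>M) \<noteq> \<infinity>"
    by (simp only: ennreal_neq_top infinity_ennreal_def not_False_eq_True)
  then have "AE \<omega> in M. (\<Sum>j. ennreal (\<bar>\<psi> j\<bar> * \<bar>\<eta> (i - int j) \<omega>\<bar>)) \<noteq> \<infinity>"
    by (rule nn_integral_PInf_AE[rotated]) measurable
  then show "AE \<omega> in M. summable (\<lambda>j. \<bar>\<psi> j\<bar> * \<bar>\<eta> (i - int j) \<omega>\<bar>)"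
    by eventually_elim (rule summable_suminf_not_top, auto)
qed

text \<open>The difference X_i - A eta_i is the sum over j of psi_j (eta_(i-j) - eta_i).
  Subadditivity reduces it to the lagged differences \<open>U\<close>, whose means divided by sqrt n
  tend to 0 for each j and are bounded by \<open>C\<close> uniformly in j and n.\<close>

lemma expectation_linear_process_approx:
  assumes p: "p > 2"
  defines "A \<equiv> (\<Sum>j. \<psi> j)"
  shows "(\<lambda>n. expectation (\<lambda>\<omega>. test_statistic p n (\<lambda>i. X (int i) \<omega> - A * \<eta> (int i) \<omega>)) / sqrt n) \<longlonglongrightarrow> 0"
    and "integrable M (\<lambda>\<omega>. test_statistic p n (\<lambda>i. X (int i) \<omega> - A * \<eta> (int i) \<omega>))"
proof -
  have p1: "p \<ge> 1" using p by simp
  note [measurable] = borel_measurable_test_statistic[OF p1]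
  define T where "T n \<omega> = test_statistic p n (\<lambda>i. X (int i) \<omega> - A * \<eta> (int i) \<omega>)" for n \<omega>
  define U where "U n j \<omega> = test_statistic p n (\<lambda>i. \<eta> (int i - int j) \<omega> - \<eta> (int i) \<omega>)" for n j \<omega>
  define C where "C = 2 * ((1 + 4 * tail_const p) * \<sigma>)"
  have C: "C > 0" using tail_const_pos[OF p] sigma_pos by (simp add: C_def add_pos_pos)
  have [measurable]: "T n \<in> borel_measurable M" "U n j \<in> borel_measurable M" for n j
    unfolding T_def U_def by measurable
  have nn: "0 \<le> T n \<omega>" "0 \<le> U n j \<omega>" for n j \<omega>
    unfolding T_def U_def using p1 by (auto intro: test_statistic_nonneg)
  have it: "integrable M (\<lambda>\<omega>. test_statistic p n (\<lambda>k. \<eta> (int k + c) \<omega>))" for n c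
    using integrable_test_statistic_eta[of "\<lambda>x. x", OF _ sq_integrable mean p1] by simp
  have U_le: "U n j \<omega> \<le> test_statistic p n (\<lambda>k. \<eta> (int k + - int j) \<omega>) + test_statistic p n (\<lambda>k. \<eta> (int k + 0) \<omega>)" for n j \<omega>
    using test_statistic_triangle[OF p1, of n "\<lambda>k. \<eta> (int k - int j) \<omega>" "\<lambda>k. (-1) * \<eta> (int k) \<omega>"]
      test_statistic_scale[OF p1, of n "-1" "\<lambda>k. \<eta> (int k) \<omega>"]
    by (simp add: U_def)
  have iU: "integrable M (U n j)" for n j
    by (rule Bochner_Integration.integrable_bound[OF Bochner_Integration.integrable_add[OF it[of n "- int j"] it[of n 0]]])
       (use U_le nn p1 in \<open>auto simp: test_statistic_nonneg\<close>)
  have EU: "expectation (U n j) \<le> C * sqrt n" if "n > 0" for n j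
  proof -
    have "expectation (U n j) \<le> expectation (\<lambda>\<omega>. test_statistic p n (\<lambda>k. \<eta> (int k + - int j) \<omega>) + test_statistic p n (\<lambda>k. \<eta> (int k + 0) \<omega>))"
      using it by (intro integral_mono iU U_le Bochner_Integration.integrable_add)
    also have "\<dots> = expectation (\<lambda>\<omega>. test_statistic p n (\<lambda>k. \<eta> (int k + - int j) \<omega>)) + expectation (\<lambda>\<omega>. test_statistic p n (\<lambda>k. \<eta> (int k + 0) \<omega>))"
      using it by (intro Bochner_Integration.integral_add)
    also have "\<dots> \<le> (1 + 4 * tail_const p) * \<sigma> * sqrt n + (1 + 4 * tail_const p) * \<sigma> * sqrt n"
      by (intro add_mono expectation_test_statistic_eta_le[where h="\<lambda>x. x"])
         (use p sq_integrable mean variance_eta sigma_pos that in auto)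
    finally show ?thesis by (simp add: C_def algebra_simps)
  qed
  have sA: "\<psi> sums A" unfolding A_def using summable_rabs_cancel[OF summable_psi] by (rule summable_sums)
  have "AE \<omega> in M. \<forall>n. ennreal (T n \<omega>) \<le> (\<Sum>j. ennreal (\<bar>\<psi> j\<bar> * U n j \<omega>))"
    using AE_summable
  proof eventually_elim
    case (elim \<omega>)
    show ?case
    proof
      fix n
      have s: "summable (\<lambda>j. \<bar>\<psi> j\<bar> * U n j \<omega>)"
      proof (rule summable_comparison_test'[where N=0])
        show "summable (\<lambda>j. \<Sum>i=1..n. \<bar>\<psi> j\<bar> * \<bar>\<eta> (int i - int j) \<omega>\<bar> + \<bar>\<psi> j\<bar> * \<bar>\<eta> (int i) \<omega>\<bar>)"
          using elim by (intro summable_sum summable_add summable_mult2 summable_psi) auto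
        fix j
        have "U n j \<omega> \<le> (\<Sum>i=1..n. \<bar>\<eta> (int i - int j) \<omega> - \<eta> (int i) \<omega>\<bar>)"
          unfolding U_def by (rule test_statistic_le_l1[OF p1])
        also have "\<dots> \<le> (\<Sum>i=1..n. \<bar>\<eta> (int i - int j) \<omega>\<bar> + \<bar>\<eta> (int i) \<omega>\<bar>)"
          by (intro sum_mono abs_triangle_ineq4)
        finally have "\<bar>\<psi> j\<bar> * U n j \<omega> \<le> \<bar>\<psi> j\<bar> * (\<Sum>i=1..n. \<bar>\<eta> (int i - int j) \<omega>\<bar> + \<bar>\<eta> (int i) \<omega>\<bar>)"
          by (rule mult_left_mono) simp
        then show "norm (\<bar>\<psi> j\<bar> * U n j \<omega>) \<le> (\<Sum>i=1..n. \<bar>\<psi> j\<bar> * \<bar>\<eta> (int i - int j) \<omega>\<bar> + \<bar>\<psi> j\<bar> * \<bar>\<eta> (int i) \<omega>\<bar>)"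
          using nn by (simp add: sum_distrib_left distrib_left)
      qed
      have eq: "test_statistic p n (\<lambda>i. \<psi> j * (\<eta> (int i - int j) \<omega> - \<eta> (int i) \<omega>)) = \<bar>\<psi> j\<bar> * U n j \<omega>" for j
        unfolding U_def by (rule test_statistic_scale[OF p1])
      have "T n \<omega> \<le> (\<Sum>j. test_statistic p n (\<lambda>i. \<psi> j * (\<eta> (int i - int j) \<omega> - \<eta> (int i) \<omega>)))"
        unfolding T_def
      proof (rule test_statistic_suminf_le[OF p1])
        fix i :: nat
        have "summable (\<lambda>j. \<bar>\<psi> j * \<eta> (int i - int j) \<omega>\<bar>)" using elim by (simp add: abs_mult)
        then have "(\<lambda>j. \<psi> j * \<eta> (int i - int j) \<omega>) sums X (int i) \<omega>"
          unfolding linear_process_def by (rule summable_sums[OF summable_rabs_cancel])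
        from sums_diff[OF this sums_mult2[OF sA, of "\<eta> (int i) \<omega>"]]
        show "(\<lambda>j. \<psi> j * (\<eta> (int i - int j) \<omega> - \<eta> (int i) \<omega>)) sums (X (int i) \<omega> - A * \<eta> (int i) \<omega>)"
          by (simp add: algebra_simps)
      qed (use s in \<open>simp add: eq\<close>)
      then show "ennreal (T n \<omega>) \<le> (\<Sum>j. ennreal (\<bar>\<psi> j\<bar> * U n j \<omega>))"
        using s nn by (subst suminf_ennreal2) (auto simp: eq intro!: ennreal_leI)
    qed
  qed
  then have le: "AE \<omega> in M. ennreal (T n \<omega>) \<le> (\<Sum>j. ennreal (\<bar>\<psi> j\<bar> * U n j \<omega>))" for n
    by eventually_elim auto
  have sEU: "summable (\<lambda>j. \<bar>\<psi> j\<bar> * expectation (U n j))" if "n > 0" for n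
    by (rule summable_comparison_test'[where N=0 and g="\<lambda>j. \<bar>\<psi> j\<bar> * (C * sqrt n)"])
       (use EU[OF that] nn in \<open>auto intro!: mult_left_mono summable_mult2 summable_psi simp: Bochner_Integration.integral_nonneg\<close>)
  \<comment> \<open>As a nonnegative integral the bound needs no integrability of
    \<open>T n\<close>; it yields that as well.\<close>
  have main: "(\<integral>\<^sup>+\<omega>. ennreal (T n \<omega>) \<partial>M) \<le> ennreal (\<Sum>j. \<bar>\<psi> j\<bar> * expectation (U n j))" if "n > 0" for n
  proof -
    have "(\<integral>\<^sup>+\<omega>. ennreal (T n \<omega>) \<partial>M) \<le> (\<integral>\<^sup>+\<omega>. (\<Sum>j. ennreal (\<bar>\<psi> j\<bar> * U n j \<omega>)) \<partial>M)"
      by (rule nn_integral_mono_AE[OF le])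
    also have "\<dots> = (\<Sum>j. \<integral>\<^sup>+\<omega>. ennreal (\<bar>\<psi> j\<bar> * U n j \<omega>) \<partial>M)"
      by (rule nn_integral_suminf) simp
    also have "\<dots> = (\<Sum>j. ennreal (\<bar>\<psi> j\<bar> * expectation (U n j)))"
    proof (intro suminf_cong)
      fix j show "(\<integral>\<^sup>+\<omega>. ennreal (\<bar>\<psi> j\<bar> * U n j \<omega>) \<partial>M) = ennreal (\<bar>\<psi> j\<bar> * expectation (U n j))"
        using iU nn by (subst nn_integral_eq_integral) auto
    qed
    also have "\<dots> = ennreal (\<Sum>j. \<bar>\<psi> j\<bar> * expectation (U n j))"
      using nn by (intro suminf_ennreal2 sEU that) (auto simp: Bochner_Integration.integral_nonneg)
    finally show ?thesis .
  qed
  have iT: "integrable M (T n)" for n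
  proof (cases "n = 0")
    case True
    have "T n = (\<lambda>\<omega>. 0)"
      using test_statistic_le_l1[OF p1, of n] nn(1)[of n] True by (auto simp: T_def fun_eq_iff intro!: antisym)
    then show ?thesis by simp
  next
    case False
    show ?thesis
      using main[of n] False nn by (intro integrableI_nonneg) (auto simp: less_top[symmetric] top_unique)
  qed
  show "integrable M (\<lambda>\<omega>. test_statistic p n (\<lambda>i. X (int i) \<omega> - A * \<eta> (int i) \<omega>))"
    using iT[of n] by (simp add: T_def[abs_def])
  have ET: "expectation (T n) \<le> (\<Sum>j. \<bar>\<psi> j\<bar> * expectation (U n j))" if "n > 0" for n
  proof -
    have "ennreal (expectation (T n)) \<le> ennreal (\<Sum>j. \<bar>\<psi> j\<bar> * expectation (U n j))"
      using main[OF that] nn by (subst nn_integral_eq_integral[symmetric]) (auto simp: iT)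
    then show ?thesis
      using nn by (subst (asm) ennreal_le_iff) (auto intro!: suminf_nonneg sEU that simp: Bochner_Integration.integral_nonneg)
  qed
  \<comment> \<open>Tannery's theorem with the summable majorant |psi_j| C.\<close>
  have "((\<lambda>n. \<Sum>j. \<bar>\<psi> j\<bar> * (expectation (U n j) / sqrt n)) \<longlongrightarrow> (\<Sum>j. \<bar>\<psi> j\<bar> * 0)) sequentially"
  proof (rule tannerys_theorem[THEN conjunct2, THEN conjunct2])
    show "(\<lambda>n. \<bar>\<psi> j\<bar> * (expectation (U n j) / sqrt n)) \<longlonglongrightarrow> \<bar>\<psi> j\<bar> * 0" for j
      unfolding U_def by (intro tendsto_mult_left expectation_shift_tendsto_0 p)
    show "summable (\<lambda>j. \<bar>\<psi> j\<bar> * C)" by (intro summable_mult2 summable_psi)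
    have b: "norm (\<bar>\<psi> j\<bar> * (expectation (U n j) / sqrt n)) \<le> \<bar>\<psi> j\<bar> * C" for j n
    proof (cases "n = 0")
      case False
      then show ?thesis
        using EU[of n j] nn by (auto simp: abs_mult Bochner_Integration.integral_nonneg divide_le_eq mult.assoc intro!: mult_left_mono)
    qed (use C in simp)
    show "\<forall>\<^sub>F (j, n) in sequentially \<times>\<^sub>F sequentially. norm (\<bar>\<psi> j\<bar> * (expectation (U n j) / sqrt n)) \<le> \<bar>\<psi> j\<bar> * C"
      using b by (intro always_eventually) auto
  qed simp
  then have lim: "(\<lambda>n. \<Sum>j. \<bar>\<psi> j\<bar> * (expectation (U n j) / sqrt n)) \<longlonglongrightarrow> 0" by simp
  show "(\<lambda>n. expectation (\<lambda>\<omega>. test_statistic p n (\<lambda>i. X (int i) \<omega> - A * \<eta> (int i) \<omega>)) / sqrt n) \<longlonglongrightarrow> 0"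
  proof (rule tendsto_sandwich[OF _ _ tendsto_const lim])
    show "\<forall>\<^sub>F n in sequentially. 0 \<le> expectation (\<lambda>\<omega>. test_statistic p n (\<lambda>i. X (int i) \<omega> - A * \<eta> (int i) \<omega>)) / sqrt n"
      using nn(1) unfolding T_def by (intro always_eventually) (auto intro!: divide_nonneg_nonneg Bochner_Integration.integral_nonneg)
    show "\<forall>\<^sub>F n in sequentially. expectation (\<lambda>\<omega>. test_statistic p n (\<lambda>i. X (int i) \<omega> - A * \<eta> (int i) \<omega>)) / sqrt n
      \<le> (\<Sum>j. \<bar>\<psi> j\<bar> * (expectation (U n j) / sqrt n))"
      using eventually_gt_at_top[of 0]
    proof eventually_elim
      case (elim n)
      have "expectation (T n) / sqrt n \<le> (\<Sum>j. \<bar>\<psi> j\<bar> * expectation (U n j)) / sqrt n"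
        using ET[OF elim] by (intro divide_right_mono) auto
      also have "\<dots> = (\<Sum>j. \<bar>\<psi> j\<bar> * expectation (U n j) / sqrt n)"
        by (rule suminf_divide[OF sEU[OF elim], symmetric])
      finally show ?case by (simp add: T_def[abs_def])
    qed
  qed
qed

end

section \<open>Approximation by block sums\<close>

definition blocks :: "nat \<Rightarrow> (nat \<Rightarrow> real) \<Rightarrow> nat \<Rightarrow> real" where
  "blocks L y i = psum y (i * L) - psum y ((i - 1) * L)"

text \<open>For positive L this is the last multiple of L up to k, capped at m L: observations that
  do not fill a further block are attached to the end of block m.\<close>

definition block_start :: "nat \<Rightarrow> nat \<Rightarrow> nat \<Rightarrow> nat" where
  "block_start L m k = L * min (k div L) m"

lemma psum_blocks: "psum (blocks L y) i = psum y (i * L)"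
  by (induction i) (simp_all add: blocks_def)

lemma block_start_le: "block_start L m k \<le> k"
  unfolding block_start_def by (rule order_trans[of _ "L * (k div L)"]) auto

text \<open>The step path is again a path of partial sums, so the seminorm estimates apply to it and
  to its difference from the original path.\<close>

lemma psum_block_steps:
  "psum (\<lambda>j. psum y (block_start L m j) - psum y (block_start L m (j - 1))) k = psum y (block_start L m k)"
  by (induction k) (auto simp: block_start_def)

text \<open>Multiplied by L, an index sequence of the blocks becomes one of the full data, except
  that it ends in m L. One more index n repairs this and can only enlarge the norm.\<close>

lemma test_statistic_blocks_le:
  assumes p: "p \<ge> 1" and mL: "m * L \<le> n"
  shows "test_statistic p m (blocks L y) \<le> test_statistic p n y"
proof (rule test_statistic_le)
  fix d k assume k: "mono (k :: nat \<Rightarrow> nat)" "k 0 = 0" "k d = m"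
  define k' where "k' i = (if i \<le> d then k i * L else n)" for i
  have "k i \<le> m" if "i \<le> d" for i using monoD[OF k(1) that] k(3) by simp
  then have "k i * L \<le> n" if "i \<le> d" for i using that mL by (meson mult_le_mono1 order_trans)
  then have "mono k'" using monoD[OF k(1)] by (auto simp: mono_def k'_def intro!: mult_le_mono1)
  have "lp_norm p d (\<lambda>i. psum (blocks L y) (k i) - psum (blocks L y) (k (i - 1)))
      = lp_norm p d (\<lambda>i. psum y (k' i) - psum y (k' (i - 1)))"
    by (intro lp_norm_cong) (auto simp: psum_blocks k'_def)
  also have "\<dots> \<le> lp_norm p (Suc d) (\<lambda>i. psum y (k' i) - psum y (k' (i - 1)))"
    unfolding lp_norm_def using p by (intro powr_mono2) (auto intro!: sum_nonneg)
  also have "\<dots> \<le> test_statistic p n y"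
    using k by (intro test_statistic_ge[OF p \<open>mono k'\<close>]) (auto simp: k'_def)
  finally show "lp_norm p d (\<lambda>i. psum (blocks L y) (k i) - psum (blocks L y) (k (i - 1))) \<le> test_statistic p n y" .
qed

text \<open>Along any index sequence the step path takes values of the block partial sums, at the
  weakly increasing indices min (k div L) m.\<close>

lemma test_statistic_block_steps_le:
  assumes p: "p \<ge> 1" and L: "L > 0" and mL: "m * L \<le> n"
  shows "test_statistic p n (\<lambda>j. psum y (block_start L m j) - psum y (block_start L m (j - 1)))
    \<le> test_statistic p m (blocks L y)"
proof (rule test_statistic_le)
  fix d k assume k: "mono (k :: nat \<Rightarrow> nat)" "k 0 = 0" "k d = n"
  define k' where "k' i = min (k i div L) m" for i
  have "mono k'"
    unfolding k'_def by (intro monoI min.mono div_le_mono monoD[OF k(1)]) auto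
  moreover have "m \<le> n div L" using mL L by (simp add: less_eq_div_iff_mult_less_eq)
  then have "k' d = m" "k' 0 = 0" using k by (auto simp: k'_def)
  ultimately have "lp_norm p d (\<lambda>i. psum (blocks L y) (k' i) - psum (blocks L y) (k' (i - 1))) \<le> test_statistic p m (blocks L y)"
    by (intro test_statistic_ge[OF p])
  then show "lp_norm p d (\<lambda>i. psum (\<lambda>j. psum y (block_start L m j) - psum y (block_start L m (j - 1))) (k i)
      - psum (\<lambda>j. psum y (block_start L m j) - psum y (block_start L m (j - 1))) (k (i - 1)))
    \<le> test_statistic p m (blocks L y)"
    unfolding psum_block_steps psum_blocks by (simp add: block_start_def k'_def mult.commute)
qed

text \<open>The residual \<open>r\<close>, path minus step path, has partial sums bounded by c and
  at most twice the q-variation of y, as the step path has no larger q-variation than y.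
  Interpolation then bounds its p-variation, which dominates the difference of the two
  statistics.\<close>

lemma test_statistic_blocks_approx:
  assumes q: "1 \<le> q" "q < p" and L: "L > 0" and mL: "m * L \<le> n"
    and c: "\<And>k. k \<le> n \<Longrightarrow> \<bar>psum y k - psum y (block_start L m k)\<bar> \<le> c"
  shows "(test_statistic p n y - test_statistic p m (blocks L y)) powr p
    \<le> (2 * c) powr (p - q) * (2 * test_statistic q n y) powr q"
proof -
  have p: "p \<ge> 1" using q by simp
  define s where "s j = psum y (block_start L m j) - psum y (block_start L m (j - 1))" for j
  define r where "r j = y j - s j" for j
  have psr: "psum r k = psum y k - psum y (block_start L m k)" for k
  proof -
    have "psum r k = psum y k - psum s k" by (simp add: r_def psum_def sum_subtractf)
    then show ?thesis unfolding s_def[abs_def] psum_block_steps .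
  qed
  have 1: "test_statistic p n y - test_statistic p m (blocks L y) \<le> test_statistic p n r"
    using test_statistic_triangle[OF p, of n s r] test_statistic_block_steps_le[OF p L mL, of y]
    by (simp add: r_def[abs_def] s_def[abs_def])
  have 2: "test_statistic q n r \<le> 2 * test_statistic q n y"
  proof -
    have "r = (\<lambda>j. y j + (-1) * s j)" by (simp add: r_def fun_eq_iff)
    moreover have "test_statistic q n (\<lambda>j. (-1) * s j) = test_statistic q n s"
      by (simp only: test_statistic_scale[OF q(1)] abs_minus_cancel abs_1 mult_1)
    moreover have "test_statistic q n s \<le> test_statistic q m (blocks L y)"
      unfolding s_def[abs_def] by (rule test_statistic_block_steps_le[OF q(1) L mL])
    ultimately show ?thesis
      using test_statistic_triangle[OF q(1), of n y "\<lambda>j. (-1) * s j"] test_statistic_blocks_le[OF q(1) mL, of y] by simp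
  qed
  have "(test_statistic p n y - test_statistic p m (blocks L y)) powr p \<le> test_statistic p n r powr p"
    using 1 p test_statistic_blocks_le[OF p mL, of y] by (intro powr_mono2) auto
  also have "\<dots> \<le> (2 * c) powr (p - q) * test_statistic q n r powr q"
    using q c by (intro test_statistic_interpolate) (auto simp: psr)
  also have "\<dots> \<le> (2 * c) powr (p - q) * (2 * test_statistic q n y) powr q"
    using q 2 test_statistic_nonneg[OF q(1)] by (intro mult_left_mono powr_mono2) auto
  finally show ?thesis .
qed

lemma psum_shift: "psum (\<lambda>j. y (j + s)) l = psum y (s + l) - psum y s"
  by (induction l) (auto simp: add.commute)

section \<open>Block approximation of the random walk, uniformly in n\<close>

context iid_noise
begin

text \<open>Each residual is a partial sum over an initial piece of one of m + 1 stretches of length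
  L, namely the m blocks and the leftover. The fourth moment inequality gives 4 b^4 / (\<theta>^4
  m^2) for a stretch, and m + 1 is at most 2 m. The condition on n yields m at most L, so the
  leftover, shorter than m, fits into one stretch.\<close>

lemma residual_bounded_noise:
  assumes h: "h \<in> borel_measurable borel"
    "integrable M (\<lambda>\<omega>. (h (\<eta> 1 \<omega>))\<^sup>2)" "expectation (\<lambda>\<omega>. h (\<eta> 1 \<omega>)) = 0"
    and b: "\<And>x. \<bar>h x\<bar> \<le> b" "b > 0" and \<theta>: "\<theta> > 0" and m: "m > 0" and n: "m\<^sup>2 \<le> n"
  defines "R \<equiv> (\<lambda>\<omega> k. psum (\<lambda>j. h (\<eta> (int j) \<omega>)) k - psum (\<lambda>j. h (\<eta> (int j) \<omega>)) (block_start (n div m) m k))"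
  shows "prob {\<omega>\<in>space M. \<exists>k\<le>n. \<theta> * sqrt n \<le> \<bar>R \<omega> k\<bar>} \<le> 8 * b^4 / (\<theta>^4 * m)"
proof -
  define L where "L = n div m"
  have n0: "n > 0" using n m by (metis gr0I le_zero_eq power_eq_0_iff neq0_conv)
  have Lm: "m \<le> L" using n m by (simp add: L_def less_eq_div_iff_mult_less_eq power2_eq_square)
  note [measurable] = h(1)
  \<comment> \<open>The stretch i = m runs past n; the noise is indexed by all integers, so the
    event makes sense.\<close>
  define E where "E i = {\<omega>\<in>space M. \<exists>l\<le>L. \<theta> * sqrt n \<le> \<bar>psum (\<lambda>j. h (\<eta> (int j + int (L * i)) \<omega>)) l\<bar>}" for i
  have [measurable]: "E i \<in> sets M" for i unfolding E_def by measurable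
  have PE: "prob (E i) \<le> 4 * b^4 / (\<theta>^4 * m\<^sup>2)" for i
  proof -
    interpret c: centred_independent M "\<lambda>j \<omega>. h (\<eta> (int j + int (L * i)) \<omega>)" L
      by (rule centred_independent_eta[OF h])
    have "prob (E i) \<le> 4 * L\<^sup>2 * b^4 / (\<theta> * sqrt n)^4"
      unfolding E_def using \<theta> n0 b by (intro c.fourth_moment_maximal) auto
    also have "(\<theta> * sqrt n)^4 = \<theta>^4 * (real n)\<^sup>2"
      by (simp add: power_mult_distrib power4_eq_xxxx power2_eq_square)
    also have "4 * L\<^sup>2 * b^4 / (\<theta>^4 * (real n)\<^sup>2) \<le> 4 * (real n / real m)\<^sup>2 * b^4 / (\<theta>^4 * (real n)\<^sup>2)"
    proof -
      have "real L \<le> real n / real m" unfolding L_def by (rule of_nat_div_le_of_nat)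
      then have "(real L)\<^sup>2 \<le> (real n / real m)\<^sup>2" by (intro power_mono) auto
      then show ?thesis using \<theta> by (intro divide_right_mono mult_right_mono) auto
    qed
    also have "\<dots> = 4 * b^4 / (\<theta>^4 * m\<^sup>2)" using n0 by (simp add: power_divide)
    finally show ?thesis .
  qed
  have "{\<omega>\<in>space M. \<exists>k\<le>n. \<theta> * sqrt n \<le> \<bar>R \<omega> k\<bar>} \<subseteq> (\<Union>i\<le>m. E i)"
  proof safe
    fix \<omega> k assume k: "\<omega> \<in> space M" "k \<le> n" "\<theta> * sqrt n \<le> \<bar>R \<omega> k\<bar>"
    define i where "i = min (k div L) m"
    define l where "l = k - L * i"
    have ik: "L * i \<le> k" using block_start_le[of L m k] by (simp add: block_start_def i_def)
    have "l \<le> L"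
    proof (cases "k div L \<le> m")
      case True
      then have "l = k mod L" by (simp add: l_def i_def minus_mult_div_eq_mod)
      then show ?thesis using m Lm by (simp add: less_imp_le)
    next
      case False
      then have "l \<le> n - L * m" using k by (simp add: l_def i_def diff_le_mono)
      also have "\<dots> = n mod m" by (simp add: L_def minus_div_mult_eq_mod)
      also have "\<dots> < m" using m by simp
      finally show ?thesis using Lm by simp
    qed
    have "psum (\<lambda>j. h (\<eta> (int j + int (L * i)) \<omega>)) l = R \<omega> k"
      using psum_shift[of "\<lambda>k. h (\<eta> (int k) \<omega>)" "L * i" l] ik
      by (simp add: R_def l_def block_start_def i_def L_def)
    then have "\<omega> \<in> E i" using k \<open>l \<le> L\<close> by (auto simp: E_def intro!: exI[of _ l])
    then show "\<omega> \<in> (\<Union>i\<le>m. E i)" by (auto simp: i_def intro!: bexI[of _ i])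
  qed
  then have "prob {\<omega>\<in>space M. \<exists>k\<le>n. \<theta> * sqrt n \<le> \<bar>R \<omega> k\<bar>} \<le> prob (\<Union>i\<le>m. E i)"
    by (intro finite_measure_mono) auto
  also have "\<dots> \<le> (\<Sum>i\<le>m. prob (E i))" by (intro finite_measure_subadditive_finite) auto
  also have "\<dots> \<le> (\<Sum>i\<le>m. 4 * b^4 / (\<theta>^4 * m\<^sup>2))" by (intro sum_mono PE)
  also have "\<dots> = (m + 1) * (4 * b^4 / (\<theta>^4 * m\<^sup>2))" by simp
  also have "\<dots> \<le> (2 * m) * (4 * b^4 / (\<theta>^4 * m\<^sup>2))"
    using m \<theta> by (intro mult_right_mono) auto
  also have "\<dots> = 8 * b^4 / (\<theta>^4 * m)" using m by (simp add: power2_eq_square)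
  finally show ?thesis .
qed

text \<open>After truncation the bounded part is treated blockwise, where large m helps. For the
  part of small variance the maximal inequality is used once on the whole range, which bounds both
  the value at k and that at the start of its block.\<close>

lemma residual_small:
  assumes \<theta>: "\<theta> > 0" and \<delta>: "\<delta> > 0"
  obtains m0 where "m0 > 0" "\<And>m n. m0 \<le> m \<Longrightarrow> m\<^sup>2 \<le> n \<Longrightarrow> prob {\<omega>\<in>space M. \<exists>k\<le>n. \<theta> * sqrt n \<le>
     \<bar>psum (\<lambda>j. \<eta> (int j) \<omega>) k - psum (\<lambda>j. \<eta> (int j) \<omega>) (block_start (n div m) m k)\<bar>} \<le> \<delta>"
proof -
  \<comment> \<open>Kolmogorov's inequality at level \<open>\<theta> / 4 * sqrt n\<close> then gives
    16 v / \<theta>^2 = \<delta> / 2.\<close>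
  define v where "v = \<delta> * \<theta>\<^sup>2 / 32"
  have v: "v > 0" using assms by (simp add: v_def)
  obtain h1 h2 b where h1: "h1 \<in> borel_measurable borel" and h2: "h2 \<in> borel_measurable borel"
    and h: "\<And>x. h1 x + h2 x = x" and b: "\<And>x. \<bar>h1 x\<bar> \<le> b" "b > 0"
    and mz: "expectation (\<lambda>\<omega>. h1 (\<eta> 1 \<omega>)) = 0" "expectation (\<lambda>\<omega>. h2 (\<eta> 1 \<omega>)) = 0"
    and i: "integrable M (\<lambda>\<omega>. (h1 (\<eta> 1 \<omega>))\<^sup>2)" "integrable M (\<lambda>\<omega>. (h2 (\<eta> 1 \<omega>))\<^sup>2)"
    and v2: "expectation (\<lambda>\<omega>. (h2 (\<eta> 1 \<omega>))\<^sup>2) \<le> v"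
    using truncation[OF v] by auto
  note [measurable] = h1 h2
  \<comment> \<open>At level \<open>\<theta> / 2\<close> the blockwise bound is 128 b^4 /
    (\<theta>^4 m), which is at most \<delta> / 2 from this m on.\<close>
  obtain m0 :: nat where m0: "256 * b^4 / (\<theta>^4 * \<delta>) \<le> m0" using real_arch_simple by blast
  have m0_pos: "m0 > 0"
  proof -
    have "0 < 256 * b^4 / (\<theta>^4 * \<delta>)" using b \<theta> \<delta> by simp
    then have "0 < real m0" using m0 by (rule less_le_trans)
    then show ?thesis by simp
  qed
  show ?thesis
  proof (rule that[OF m0_pos])
    fix m n :: nat assume m: "m0 \<le> m" and n: "m\<^sup>2 \<le> n"
    have m_pos: "m > 0" using m m0_pos by simp
    have n0: "n > 0" using n m_pos by (metis gr0I le_zero_eq power_eq_0_iff neq0_conv)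
    define R where "R h \<omega> k = psum (\<lambda>j. h (\<eta> (int j) \<omega>)) k - psum (\<lambda>j. h (\<eta> (int j) \<omega>)) (block_start (n div m) m k)"
      for h :: "real \<Rightarrow> real" and \<omega> k
    define E1 where "E1 = {\<omega>\<in>space M. \<exists>k\<le>n. \<theta> / 2 * sqrt n \<le> \<bar>R h1 \<omega> k\<bar>}"
    define E2 where "E2 = {\<omega>\<in>space M. \<exists>k\<le>n. \<theta> / 4 * sqrt n \<le> \<bar>psum (\<lambda>j. h2 (\<eta> (int j + 0) \<omega>)) k\<bar>}"
    have [measurable]: "E1 \<in> sets M" "E2 \<in> sets M" unfolding E1_def E2_def R_def by measurable
    have "prob E1 \<le> 8 * b^4 / ((\<theta> / 2)^4 * m)"
      unfolding E1_def R_def using \<theta> by (intro residual_bounded_noise h1 i mz b m_pos n) auto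
    also have "\<dots> = 128 * b^4 / (\<theta>^4 * m)" by (simp add: power_divide)
    also have "\<dots> \<le> \<delta> / 2"
    proof -
      have "256 * b^4 / (\<theta>^4 * \<delta>) \<le> m" using m0 m by (meson of_nat_le_iff order_trans)
      then show ?thesis using \<theta> \<delta> m_pos by (simp add: field_simps)
    qed
    finally have P1: "prob E1 \<le> \<delta> / 2" .
    interpret c: centred_independent M "\<lambda>j \<omega>. h2 (\<eta> (int j + 0) \<omega>)" n
      by (rule centred_independent_eta[OF h2 i(2) mz(2)])
    have "prob E2 \<le> n * v / (\<theta> / 4 * sqrt n)\<^sup>2"
      unfolding E2_def
    proof (rule c.Kolmogorov_inequality)
      show "expectation (\<lambda>\<omega>. (h2 (\<eta> (int j + 0) \<omega>))\<^sup>2) \<le> v" for j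
        using expectation_eta[of "\<lambda>x. (h2 x)\<^sup>2" "int j + 0"] v2 by simp
    qed (use \<theta> n0 in auto)
    also have "\<dots> = \<delta> / 2" using \<theta> n0 by (simp add: v_def power_mult_distrib power_divide)
    finally have P2: "prob E2 \<le> \<delta> / 2" .
    have "{\<omega>\<in>space M. \<exists>k\<le>n. \<theta> * sqrt n \<le> \<bar>R (\<lambda>x. x) \<omega> k\<bar>} \<subseteq> E1 \<union> E2"
    proof (rule subsetI, rule ccontr)
      fix \<omega> assume "\<omega> \<in> {\<omega>\<in>space M. \<exists>k\<le>n. \<theta> * sqrt n \<le> \<bar>R (\<lambda>x. x) \<omega> k\<bar>}" and n: "\<omega> \<notin> E1 \<union> E2"
      then obtain k where \<omega>: "\<omega> \<in> space M" and k: "k \<le> n" "\<theta> * sqrt n \<le> \<bar>R (\<lambda>x. x) \<omega> k\<bar>" by auto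
      have "psum (\<lambda>j. \<eta> (int j) \<omega>) k = psum (\<lambda>j. h1 (\<eta> (int j) \<omega>)) k + psum (\<lambda>j. h2 (\<eta> (int j) \<omega>)) k" for k
        by (simp add: psum_def h flip: sum.distrib)
      then have "R (\<lambda>x. x) \<omega> k = R h1 \<omega> k + psum (\<lambda>j. h2 (\<eta> (int j) \<omega>)) k - psum (\<lambda>j. h2 (\<eta> (int j) \<omega>)) (block_start (n div m) m k)"
        by (simp add: R_def)
      moreover have "\<bar>R h1 \<omega> k\<bar> < \<theta> / 2 * sqrt n"
      proof (rule ccontr)
        assume "\<not> ?thesis"
        then have "\<omega> \<in> E1" unfolding E1_def using k(1) \<omega> by (auto simp: not_less)
        then show False using n by simp
      qed
      moreover have s: "\<bar>psum (\<lambda>j. h2 (\<eta> (int j) \<omega>)) l\<bar> < \<theta> / 4 * sqrt n" if "l \<le> n" for l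
      proof (rule ccontr)
        assume "\<not> ?thesis"
        then have "\<omega> \<in> E2" unfolding E2_def using that \<omega> by (auto simp: not_less)
        then show False using n by simp
      qed
      note s[OF k(1)] s[OF order_trans[OF block_start_le k(1)], of "n div m" m]
      ultimately show False using k(2) by (simp add: abs_if split: if_splits)
    qed
    then have "prob {\<omega>\<in>space M. \<exists>k\<le>n. \<theta> * sqrt n \<le> \<bar>R (\<lambda>x. x) \<omega> k\<bar>} \<le> prob (E1 \<union> E2)"
      by (intro finite_measure_mono) auto
    also have "\<dots> \<le> prob E1 + prob E2" by (intro measure_Un_le) auto
    also have "\<dots> \<le> \<delta>" using P1 P2 by simp
    finally show "prob {\<omega>\<in>space M. \<exists>k\<le>n. \<theta> * sqrt n \<le>
     \<bar>psum (\<lambda>j. \<eta> (int j) \<omega>) k - psum (\<lambda>j. \<eta> (int j) \<omega>) (block_start (n div m) m k)\<bar>} \<le> \<delta>"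
      by (simp add: R_def)
  qed
qed

text \<open>The q-variation is of order sqrt n with high probability, and the residual is below
  \<theta> sqrt n with high probability. Both powers of sqrt n combine to (sqrt n)^p in the
  interpolation, so the resulting bound scales as required, uniformly in n.\<close>

lemma blocks_approx_in_prob:
  assumes p: "p > 2" and \<epsilon>: "\<epsilon> > 0" and \<delta>: "\<delta> > 0"
  obtains m0 where "m0 > 0" "\<And>m n. m0 \<le> m \<Longrightarrow> m\<^sup>2 \<le> n \<Longrightarrow> prob {\<omega>\<in>space M. \<epsilon> * sqrt n \<le>
     \<bar>test_statistic p n (\<lambda>j. \<eta> (int j) \<omega>) - test_statistic p m (blocks (n div m) (\<lambda>j. \<eta> (int j) \<omega>))\<bar>} \<le> \<delta>"
proof -
  define q where "q = (p + 2) / 2"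
  have q: "2 < q" "q < p" using p by (auto simp: q_def)
  have p1: "p \<ge> 1" "q \<ge> 1" using q by auto
  note [measurable] = borel_measurable_test_statistic[OF p1(1)] borel_measurable_test_statistic[OF p1(2)]
  define K where "K = tail_const q"
  have K: "K > 0" using tail_const_pos q by (simp add: K_def)
  \<comment> \<open>The level at which the tail bound for the q-variation equals \<delta> /
    2.\<close>
  define x where "x = sqrt (2 * K * \<sigma>\<^sup>2 / \<delta>)"
  have x: "x > 0" "K * \<sigma>\<^sup>2 / x\<^sup>2 = \<delta> / 2"
    using K sigma_pos \<delta> by (auto simp: x_def)
  \<comment> \<open>The solution of (2 \<theta>)^(p-q) (2 x)^q = (\<epsilon> / 2)^p. The target
    \<epsilon> / 2 leaves room to contradict the non-strict inequality in \<open>F\<close>.\<close>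
  define \<theta> where "\<theta> = ((\<epsilon> / 2) powr p / (2 * x) powr q) powr (1 / (p - q)) / 2"
  have \<theta>: "\<theta> > 0" "(2 * \<theta>) powr (p - q) * (2 * x) powr q = (\<epsilon> / 2) powr p"
    using \<epsilon> x q by (auto simp: \<theta>_def powr_powr)
  obtain m0 where m0: "m0 > 0" and res: "\<And>m n. m0 \<le> m \<Longrightarrow> m\<^sup>2 \<le> n \<Longrightarrow> prob {\<omega>\<in>space M. \<exists>k\<le>n. \<theta> * sqrt n \<le>
     \<bar>psum (\<lambda>j. \<eta> (int j) \<omega>) k - psum (\<lambda>j. \<eta> (int j) \<omega>) (block_start (n div m) m k)\<bar>} \<le> \<delta> / 2"
    using residual_small[OF \<theta>(1), of "\<delta> / 2"] \<delta> by auto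
  show ?thesis
  proof (rule that[OF m0])
    fix m n :: nat assume m: "m0 \<le> m" and n: "m\<^sup>2 \<le> n"
    have m_pos: "m > 0" using m m0 by simp
    have n0: "n > 0" using n m_pos by (metis gr0I le_zero_eq power_eq_0_iff neq0_conv)
    define L where "L = n div m"
    have mL: "m * L \<le> n" by (simp add: L_def)
    have "m \<le> L" using n m_pos by (simp add: L_def less_eq_div_iff_mult_less_eq power2_eq_square)
    then have L: "L > 0" using m_pos by simp
    define E1 where "E1 = {\<omega>\<in>space M. \<exists>k\<le>n. \<theta> * sqrt n \<le>
     \<bar>psum (\<lambda>j. \<eta> (int j) \<omega>) k - psum (\<lambda>j. \<eta> (int j) \<omega>) (block_start L m k)\<bar>}"
    define E2 where "E2 = {\<omega>\<in>space M. x * sqrt n \<le> test_statistic q n (\<lambda>j. \<eta> (int j + 0) \<omega>)}"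
    have [measurable]: "E1 \<in> sets M" "E2 \<in> sets M" unfolding E1_def E2_def by measurable
    have P1: "prob E1 \<le> \<delta> / 2" unfolding E1_def L_def by (rule res[OF m n])
    interpret c: centred_independent M "\<lambda>j \<omega>. \<eta> (int j + 0) \<omega>" n
      using centred_independent_eta[of "\<lambda>x. x" 0] sq_integrable mean by simp
    have "prob E2 \<le> K * n * \<sigma>\<^sup>2 / (x * sqrt n)\<^sup>2"
      unfolding E2_def K_def
    proof (rule c.prob_test_statistic_ge_le[OF q(1)])
      show "expectation (\<lambda>\<omega>. (\<eta> (int j + 0) \<omega>)\<^sup>2) \<le> \<sigma>\<^sup>2" for j
        using expectation_eta[of "\<lambda>x. x\<^sup>2" "int j + 0"] variance_eta by simp
    qed (use x n0 in auto)
    also have "\<dots> = \<delta> / 2" using x n0 by (simp add: power_mult_distrib)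
    finally have P2: "prob E2 \<le> \<delta> / 2" .
    define F where "F = {\<omega>\<in>space M. \<epsilon> * sqrt n \<le>
     \<bar>test_statistic p n (\<lambda>j. \<eta> (int j) \<omega>) - test_statistic p m (blocks L (\<lambda>j. \<eta> (int j) \<omega>))\<bar>}"
    have "F \<subseteq> E1 \<union> E2"
    proof (rule subsetI, rule ccontr)
      fix \<omega> assume F: "\<omega> \<in> F" and n: "\<omega> \<notin> E1 \<union> E2"
      let ?y = "\<lambda>j. \<eta> (int j) \<omega>"
      have \<omega>: "\<omega> \<in> space M" using F by (simp add: F_def)
      have 0: "0 \<le> test_statistic p n ?y - test_statistic p m (blocks L ?y)"
        using test_statistic_blocks_le[OF p1(1) mL] by simp
      have "\<bar>psum ?y k - psum ?y (block_start L m k)\<bar> \<le> \<theta> * sqrt n" if "k \<le> n" for k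
      proof (rule ccontr)
        assume "\<not> ?thesis"
        then have "\<omega> \<in> E1" unfolding E1_def using that \<omega> by auto
        then show False using n by simp
      qed
      then have "(test_statistic p n ?y - test_statistic p m (blocks L ?y)) powr p
          \<le> (2 * (\<theta> * sqrt n)) powr (p - q) * (2 * test_statistic q n ?y) powr q"
        by (intro test_statistic_blocks_approx p1 q L mL)
      also have "\<dots> \<le> (2 * (\<theta> * sqrt n)) powr (p - q) * (2 * (x * sqrt n)) powr q"
      proof -
        have "test_statistic q n ?y \<le> x * sqrt n"
          using n \<omega> by (auto simp: E2_def)
        then show ?thesis using p1 q test_statistic_nonneg[OF p1(2)] by (intro mult_left_mono powr_mono2) auto
      qed
      also have "\<dots> = ((2 * \<theta>) powr (p - q) * (2 * x) powr q) * (sqrt n powr (p - q) * sqrt n powr q)"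
        using \<theta> x by (simp add: powr_mult)
      also have "\<dots> = (\<epsilon> / 2 * sqrt n) powr p"
      proof -
        have "(\<epsilon> / 2 * sqrt n) powr p = (\<epsilon> / 2) powr p * sqrt n powr p"
          using \<epsilon> by (intro powr_mult)
        then show ?thesis unfolding \<theta>(2) by (simp flip: powr_add)
      qed
      finally have le: "(test_statistic p n ?y - test_statistic p m (blocks L ?y)) powr p \<le> (\<epsilon> / 2 * sqrt n) powr p" .
      have "test_statistic p n ?y - test_statistic p m (blocks L ?y) \<le> \<epsilon> / 2 * sqrt n"
      proof (rule ccontr)
        assume "\<not> ?thesis"
        then have "(\<epsilon> / 2 * sqrt n) powr p < (test_statistic p n ?y - test_statistic p m (blocks L ?y)) powr p"
          using p \<epsilon> by (intro powr_less_mono2) auto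
        then show False using le by simp
      qed
      moreover have "\<epsilon> * sqrt n \<le> test_statistic p n ?y - test_statistic p m (blocks L ?y)"
        using F 0 by (simp add: F_def)
      moreover have "\<epsilon> / 2 * sqrt n < \<epsilon> * sqrt n" using \<epsilon> n0 by simp
      ultimately show False by linarith
    qed
    then have "prob F \<le> prob (E1 \<union> E2)"
      by (intro finite_measure_mono) auto
    also have "\<dots> \<le> prob E1 + prob E2" by (intro measure_Un_le) auto
    also have "\<dots> \<le> \<delta>" using P1 P2 by simp
    finally show "prob {\<omega>\<in>space M. \<epsilon> * sqrt n \<le>
     \<bar>test_statistic p n (\<lambda>j. \<eta> (int j) \<omega>) - test_statistic p m (blocks (n div m) (\<lambda>j. \<eta> (int j) \<omega>))\<bar>} \<le> \<delta>"
      by (simp add: F_def L_def)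
  qed
qed

section \<open>Central limit theorem for the vector of block sums\<close>

text \<open>The characteristic function is a power of that of one scaled innovation, with the
  cardinality as exponent. This carries the central limit theorem from the first L innovations to a
  block at any position.\<close>

lemma distr_sum_eta:
  assumes "finite K" "finite K'" "card K = card K'"
  shows "distr M borel (\<lambda>\<omega>. (\<Sum>j\<in>K. \<eta> j \<omega>) / c) = distr M borel (\<lambda>\<omega>. (\<Sum>j\<in>K'. \<eta> j \<omega>) / c)"
proof (rule Levy_uniqueness)
  have *: "char (distr M borel (\<lambda>\<omega>. (\<Sum>j\<in>K. \<eta> j \<omega>) / c)) t
      = char (distr M borel (\<lambda>\<omega>. \<eta> 1 \<omega> / c)) t ^ card K" for t K
  proof -
    have d: "distr M borel (\<lambda>\<omega>. \<eta> j \<omega> / c) = distr M borel (\<lambda>\<omega>. \<eta> 1 \<omega> / c)" for j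
    proof -
      have "distr M borel (\<lambda>\<omega>. \<eta> j \<omega> / c) = distr (distr M borel (\<eta> j)) borel (\<lambda>x. x / c)" for j
        by (subst distr_distr) (auto simp: comp_def)
      from this[of j] this[of 1] show ?thesis by (simp only: ident[of j])
    qed
    have "indep_vars (\<lambda>_. borel) (\<lambda>j \<omega>. \<eta> j \<omega> / c) UNIV"
      by (rule indep_vars_compose2[OF indep_eta]) simp
    then have "indep_vars (\<lambda>_. borel) (\<lambda>j \<omega>. \<eta> j \<omega> / c) K" by (rule indep_vars_subset) simp
    then have "char (distr M borel (\<lambda>\<omega>. (\<Sum>j\<in>K. \<eta> j \<omega> / c))) t = (\<Prod>j\<in>K. char (distr M borel (\<lambda>\<omega>. \<eta> j \<omega> / c)) t)"
      by (rule char_distr_sum)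
    also have "\<dots> = (\<Prod>j\<in>K. char (distr M borel (\<lambda>\<omega>. \<eta> 1 \<omega> / c)) t)"
      by (intro prod.cong refl arg_cong[where f="\<lambda>D. char D t"] d)
    finally show ?thesis by (simp add: sum_divide_distrib)
  qed
  show "char (distr M borel (\<lambda>\<omega>. (\<Sum>j\<in>K. \<eta> j \<omega>) / c)) = char (distr M borel (\<lambda>\<omega>. (\<Sum>j\<in>K'. \<eta> j \<omega>) / c))"
    unfolding * assms(3) ..
qed (auto intro!: real_distribution_distr)

text \<open>Skorohod's theorem turns the central limit theorem for the independent blocks into pointwise
  convergence of independent copies on a product space.\<close>
lemma blocks_clt:
  fixes F :: "(nat \<Rightarrow> real) \<Rightarrow> 'c :: {banach, second_countable_topology}"
  assumes m: "m > 0" and Fm [measurable]: "F \<in> borel_measurable borel" and FB: "\<And>x. norm (F x) \<le> B"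
    and Fc: "\<And>x y. (\<And>i. (\<lambda>n. x n i) \<longlonglongrightarrow> y i) \<Longrightarrow> (\<lambda>n. F (x n)) \<longlonglongrightarrow> F y"
    and N: "prob_space N" and Z: "prob_space.indep_vars N (\<lambda>_. borel) Z {1..m}"
      "\<And>i. i \<in> {1..m} \<Longrightarrow> distr N borel (Z i) = std_normal_distribution"
  shows "(\<lambda>n. expectation (\<lambda>\<omega>. F (\<lambda>i. if i \<in> {1..m} then blocks (n div m) (\<lambda>j. \<eta> (int j) \<omega>) i / (\<sigma> * sqrt n) else 0)))
     \<longlonglongrightarrow> integral\<^sup>L N (\<lambda>\<omega>. F (\<lambda>i. if i \<in> {1..m} then Z i \<omega> / sqrt m else 0))"
proof -
  define I where "I = {1..m}"
  have I: "finite I" "I \<noteq> {}" using m by (auto simp: I_def)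
  define \<mu> where "\<mu> L = distr M borel (\<lambda>\<omega>. (\<Sum>i<L. \<eta> (int i) \<omega>) / sqrt (L * \<sigma>\<^sup>2))" for L
  have rd: "real_distribution (\<mu> L)" for L unfolding \<mu>_def by (intro real_distribution_distr) simp
  have "indep_vars (\<lambda>i. borel) (\<lambda>i. \<eta> (int i)) UNIV"
    by (rule indep_vars_reindex[OF indep_eta]) (auto intro: inj_onI)
  moreover have "expectation (\<eta> i) = 0" for i using expectation_eta[of "\<lambda>x. x" i] mean by simp
  moreover have "expectation (\<lambda>\<omega>. (\<eta> i \<omega>)\<^sup>2) = \<sigma>\<^sup>2" for i using expectation_eta[of "\<lambda>x. x\<^sup>2" i] variance_eta by simp
  moreover have "integrable M (\<lambda>\<omega>. (\<eta> i \<omega>)\<^sup>2)" for i using integrable_eta[of "\<lambda>x. x\<^sup>2" i] sq_integrable by simp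
  ultimately have "weak_conv_m \<mu> std_normal_distribution"
    unfolding \<mu>_def by (intro central_limit_theorem_zero_mean[where \<mu>="distr M borel (\<eta> 1)"] sigma_pos ident) auto
  then obtain \<Omega> :: "real measure" and Y_seq :: "nat \<Rightarrow> real \<Rightarrow> real" and Y :: "real \<Rightarrow> real"
    where sk: "prob_space \<Omega> \<and> (\<forall>L. Y_seq L \<in> borel_measurable \<Omega>) \<and> (\<forall>L. distr \<Omega> borel (Y_seq L) = \<mu> L) \<and>
      Y \<in> measurable \<Omega> lborel \<and> distr \<Omega> borel Y = std_normal_distribution \<and>
      (\<forall>x\<in>space \<Omega>. (\<lambda>L. Y_seq L x) \<longlonglongrightarrow> Y x)"
    using Skorohod[of \<mu> std_normal_distribution, OF rd real_dist_normal_dist] by blast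
  have \<Omega>: "prob_space \<Omega>" and Ym: "\<And>L. Y_seq L \<in> borel_measurable \<Omega>" and Yd: "\<And>L. distr \<Omega> borel (Y_seq L) = \<mu> L"
    and Y: "Y \<in> borel_measurable \<Omega>" "distr \<Omega> borel Y = std_normal_distribution"
    and conv: "\<And>x. x \<in> space \<Omega> \<Longrightarrow> (\<lambda>L. Y_seq L x) \<longlonglongrightarrow> Y x"
    using sk by auto
  note [measurable] = Ym Y(1)
  define P where "P = PiM I (\<lambda>_. \<Omega>)"
  interpret P: prob_space P unfolding P_def by (intro prob_space_PiM \<Omega>)
  \<comment> \<open>Rescales a vector indexed by \<open>I\<close> and extends it by 0 to all natural
    numbers, the domain on which \<open>F\<close> is defined.\<close>
  define e where "e c x i = (if i \<in> I then c * x i else 0)" for c :: real and x :: "nat \<Rightarrow> real" and i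
  have e [measurable]: "e c \<in> measurable (PiM I (\<lambda>_. borel)) borel" for c
  proof (rule measurable_coordinatewise_then_product)
    show "(\<lambda>x. e c x i) \<in> borel_measurable (PiM I (\<lambda>_. borel))" for i
      by (cases "i \<in> I") (simp_all add: e_def)
  qed
  have prod: "distr P (PiM I (\<lambda>_. borel)) (compose I g) = PiM I (\<lambda>_. distr \<Omega> borel g)"
    if [measurable]: "g \<in> borel_measurable \<Omega>" for g
  proof -
    let ?D = "distr \<Omega> borel g"
    have "distr P (PiM I (\<lambda>_. ?D)) (compose I g) = PiM I (\<lambda>_. distr \<Omega> ?D g)"
      unfolding P_def using I \<Omega>
      by (intro distr_PiM_finite_prob_space') (auto intro: prob_space.prob_space_distr cong: measurable_cong_sets)
    moreover have "distr P (PiM I (\<lambda>_. ?D)) (compose I g) = distr P (PiM I (\<lambda>_. borel)) (compose I g)"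
      by (intro distr_cong sets_PiM_cong) auto
    moreover have "distr \<Omega> ?D g = ?D" by (intro distr_cong) auto
    ultimately show ?thesis by simp
  qed
  \<comment> \<open>Independence and marginals determine the joint law, so such a family may be
    replaced by g applied to the coordinates of the product space. This is used both for the blocks
    on M and for Z on N.\<close>
  have transfer: "integral\<^sup>L N' (\<lambda>\<omega>. F (e c (\<lambda>i. V i \<omega>))) = P.expectation (\<lambda>w. F (e c (compose I g w)))"
    if N': "prob_space N'" and V: "prob_space.indep_vars N' (\<lambda>_. borel) V I" "\<And>i. i \<in> I \<Longrightarrow> distr N' borel (V i) = distr \<Omega> borel g"
      and g [measurable]: "g \<in> borel_measurable \<Omega>" for N' :: "'d measure" and V c g
  proof -
    interpret N': prob_space N' by fact
    have Vm: "V i \<in> borel_measurable N'" if "i \<in> I" for i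
      using V(1) that by (simp add: N'.indep_vars_def)
    have Vm' [measurable]: "(\<lambda>\<omega>. \<lambda>i\<in>I. V i \<omega>) \<in> measurable N' (PiM I (\<lambda>_. borel))"
      using Vm by (intro measurable_restrict) auto
    have "distr N' (PiM I (\<lambda>_. borel)) (\<lambda>\<omega>. \<lambda>i\<in>I. V i \<omega>) = PiM I (\<lambda>i. distr N' borel (V i))"
      using N'.indep_vars_iff_distr_eq_PiM'[of I V "\<lambda>_. borel"] I V(1) Vm by simp
    also have "\<dots> = PiM I (\<lambda>_. distr \<Omega> borel g)" by (intro PiM_cong V) auto
    also have "\<dots> = distr P (PiM I (\<lambda>_. borel)) (compose I g)" by (rule prod[symmetric]) fact
    finally have eq: "distr N' (PiM I (\<lambda>_. borel)) (\<lambda>\<omega>. \<lambda>i\<in>I. V i \<omega>) = distr P (PiM I (\<lambda>_. borel)) (compose I g)" .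
    have cm [measurable]: "compose I g \<in> measurable P (PiM I (\<lambda>_. borel))"
      unfolding compose_def P_def by (intro measurable_restrict) measurable
    have "integral\<^sup>L N' (\<lambda>\<omega>. F (e c (\<lambda>i. V i \<omega>))) = integral\<^sup>L N' (\<lambda>\<omega>. F (e c (\<lambda>i\<in>I. V i \<omega>)))"
      by (intro Bochner_Integration.integral_cong refl arg_cong[where f=F]) (auto simp: e_def)
    also have "\<dots> = integral\<^sup>L (distr N' (PiM I (\<lambda>_. borel)) (\<lambda>\<omega>. \<lambda>i\<in>I. V i \<omega>)) (\<lambda>x. F (e c x))"
      by (rule integral_distr[symmetric]) measurable
    also have "\<dots> = P.expectation (\<lambda>w. F (e c (compose I g w)))"
      unfolding eq by (rule integral_distr) measurable
    finally show ?thesis .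
  qed
  have lim_N: "integral\<^sup>L N (\<lambda>\<omega>. F (e (1 / sqrt m) (\<lambda>i. Z i \<omega>))) = P.expectation (\<lambda>w. F (e (1 / sqrt m) (compose I Y w)))"
    by (rule transfer[OF N]) (use Z Y in \<open>auto simp: I_def\<close>)
  \<comment> \<open>The factor sqrt L / sqrt n converts the normalisation of a block of length L
    into the common one by \<sigma> sqrt n; for L = n div m it tends to 1 / sqrt m.\<close>
  have eq_M: "expectation (\<lambda>\<omega>. F (\<lambda>i. if i \<in> I then blocks L (\<lambda>j. \<eta> (int j) \<omega>) i / (\<sigma> * sqrt n) else 0))
      = P.expectation (\<lambda>w. F (e (sqrt L / sqrt n) (compose I (Y_seq L) w)))" if L: "L > 0" for n L :: nat
  proof -
    define K where "K i = int ` {(i - 1) * L<..i * L}" for i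
    define V where "V i \<omega> = (\<Sum>j\<in>K i. \<eta> j \<omega>) / sqrt (L * \<sigma>\<^sup>2)" for i \<omega>
    have "e (sqrt L / sqrt n) (\<lambda>i. V i \<omega>) = (\<lambda>i. if i \<in> I then blocks L (\<lambda>j. \<eta> (int j) \<omega>) i / (\<sigma> * sqrt n) else 0)" for \<omega>
    proof
      fix i
      have "blocks L (\<lambda>j. \<eta> (int j) \<omega>) i = (\<Sum>j\<in>K i. \<eta> j \<omega>)"
        unfolding blocks_def K_def by (subst psum_diff) (auto simp: sum.reindex)
      then show "e (sqrt L / sqrt n) (\<lambda>i. V i \<omega>) i = (if i \<in> I then blocks L (\<lambda>j. \<eta> (int j) \<omega>) i / (\<sigma> * sqrt n) else 0)"
        using L sigma_pos by (simp add: e_def V_def real_sqrt_mult)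
    qed
    moreover have "expectation (\<lambda>\<omega>. F (e (sqrt L / sqrt n) (\<lambda>i. V i \<omega>))) = P.expectation (\<lambda>w. F (e (sqrt L / sqrt n) (compose I (Y_seq L) w)))"
    proof (rule transfer[OF prob_space_axioms])
      have "K i \<inter> K i' = {}" if "i < i'" for i i'
      proof -
        have "i * L \<le> (i' - 1) * L" using that by (intro mult_le_mono1) auto
        then have "{(i - 1) * L<..i * L} \<inter> {(i' - 1) * L<..i' * L} = {}"
          by (simp only: greaterThanAtMost_iff disjoint_iff) linarith
        then show ?thesis unfolding K_def by (simp only: image_Int[OF inj_of_nat, symmetric] image_empty)
      qed
      then have "disjoint_family_on K I"
        unfolding disjoint_family_on_def by (metis inf_commute linorder_neqE_nat)
      then have "indep_vars (\<lambda>i. PiM (K i) (\<lambda>_. borel)) (\<lambda>i \<omega>. restrict (\<lambda>j. \<eta> j \<omega>) (K i)) I"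
        by (intro indep_vars_restrict[OF indep_eta]) auto
      then have "indep_vars (\<lambda>_. borel) (\<lambda>i \<omega>. (\<Sum>j\<in>K i. restrict (\<lambda>j. \<eta> j \<omega>) (K i) j) / sqrt (L * \<sigma>\<^sup>2)) I"
        by (rule indep_vars_compose2[where Y="\<lambda>i g. (\<Sum>j\<in>K i. g j) / sqrt (L * \<sigma>\<^sup>2)"]) measurable
      then show "indep_vars (\<lambda>_. borel) V I"
        by (simp add: V_def[abs_def])
      fix i assume i: "i \<in> I"
      have "i * L - (i - 1) * L = L" using i by (cases i) (auto simp: I_def)
      then have "card (K i) = L" by (simp add: K_def card_image)
      moreover have "\<mu> L = distr M borel (\<lambda>\<omega>. (\<Sum>j\<in>int ` {..<L}. \<eta> j \<omega>) / sqrt (L * \<sigma>\<^sup>2))"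
        by (simp add: \<mu>_def sum.reindex)
      ultimately show "distr M borel (V i) = distr \<Omega> borel (Y_seq L)"
        unfolding Yd V_def[abs_def] by (simp, intro distr_sum_eta) (auto simp: K_def card_image)
    qed measurable
    ultimately show ?thesis by simp
  qed
  have c_lim: "(\<lambda>n. sqrt (n div m) / sqrt n) \<longlonglongrightarrow> 1 / sqrt m"
  proof -
    have "(\<lambda>n. real (n div m) / real n) \<longlonglongrightarrow> 1 / m"
    proof (rule tendsto_sandwich)
      show "(\<lambda>n. 1 / real m - 1 / real n) \<longlonglongrightarrow> 1 / m" using lim_1_over_n[where 'a=real] by (auto intro!: tendsto_eq_intros)
      show "\<forall>\<^sub>F n in sequentially. 1 / real m - 1 / real n \<le> real (n div m) / real n"
        using eventually_gt_at_top[of 0]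
      proof eventually_elim
        case (elim n)
        have "n \<le> (n div m + 1) * m" using m dividend_less_div_times[of m n] by (simp add: algebra_simps)
        then have "real n \<le> (real (n div m) + 1) * real m" by (metis of_nat_1 of_nat_add of_nat_le_iff of_nat_mult)
        then have "real n / real m - 1 \<le> real (n div m)" using m by (simp add: field_simps)
        then have "(real n / real m - 1) / real n \<le> real (n div m) / real n" by (intro divide_right_mono) auto
        then show ?case using elim by (simp add: diff_divide_distrib)
      qed
      show "\<forall>\<^sub>F n in sequentially. real (n div m) / real n \<le> 1 / m"
        using eventually_gt_at_top[of 0]
      proof eventually_elim
        case (elim n)
        have "real (n div m) \<le> real n / real m" by (rule of_nat_div_le_of_nat)
        then show ?case using elim m by (simp add: field_simps)
      qed
    qed auto
    from tendsto_real_sqrt[OF this] show ?thesis by (simp add: real_sqrt_divide)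
  qed
  have "(\<lambda>n. P.expectation (\<lambda>w. F (e (sqrt (n div m) / sqrt n) (compose I (Y_seq (n div m)) w))))
      \<longlonglongrightarrow> P.expectation (\<lambda>w. F (e (1 / sqrt m) (compose I Y w)))"
  proof (rule integral_dominated_convergence[where w="\<lambda>_. B"])
    have cm [measurable]: "compose I g \<in> measurable P (PiM I (\<lambda>_. borel))" if [measurable]: "g \<in> borel_measurable \<Omega>" for g
      unfolding compose_def P_def by (intro measurable_restrict) measurable
    show "(\<lambda>w. F (e (1 / sqrt m) (compose I Y w))) \<in> borel_measurable P" by measurable
    show "(\<lambda>w. F (e (sqrt (n div m) / sqrt n) (compose I (Y_seq (n div m)) w))) \<in> borel_measurable P" for n by measurable
    have sub: "filterlim (\<lambda>n. n div m) sequentially sequentially"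
      by (rule filterlim_at_top_div_const_nat[OF m])
    show "AE w in P. (\<lambda>n. F (e (sqrt (n div m) / sqrt n) (compose I (Y_seq (n div m)) w))) \<longlonglongrightarrow> F (e (1 / sqrt m) (compose I Y w))"
    proof (intro AE_I2 Fc)
      fix w i assume w: "w \<in> space P"
      show "(\<lambda>n. e (sqrt (n div m) / sqrt n) (compose I (Y_seq (n div m)) w) i) \<longlonglongrightarrow> e (1 / sqrt m) (compose I Y w) i"
      proof (cases "i \<in> I")
        case True
        then have "w i \<in> space \<Omega>" using w by (auto simp: P_def space_PiM)
        then have "(\<lambda>n. Y_seq (n div m) (w i)) \<longlonglongrightarrow> Y (w i)"
          using filterlim_compose[OF conv sub] by simp
        from tendsto_mult[OF c_lim this] show ?thesis using True by (simp add: e_def compose_def)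
      qed (simp add: e_def)
    qed
  qed (use FB in auto)
  then have "(\<lambda>n. expectation (\<lambda>\<omega>. F (\<lambda>i. if i \<in> I then blocks (n div m) (\<lambda>j. \<eta> (int j) \<omega>) i / (\<sigma> * sqrt n) else 0)))
      \<longlonglongrightarrow> P.expectation (\<lambda>w. F (e (1 / sqrt m) (compose I Y w)))"
  proof (rule Lim_transform_eventually)
    show "\<forall>\<^sub>F n in sequentially. P.expectation (\<lambda>w. F (e (sqrt (n div m) / sqrt n) (compose I (Y_seq (n div m)) w)))
      = expectation (\<lambda>\<omega>. F (\<lambda>i. if i \<in> I then blocks (n div m) (\<lambda>j. \<eta> (int j) \<omega>) i / (\<sigma> * sqrt n) else 0))"
      using eventually_ge_at_top[of m]
    proof eventually_elim
      case (elim n)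
      then have "n div m > 0" using m by (simp add: div_greater_zero_iff)
      then show ?case by (rule eq_M[symmetric])
    qed
  qed
  moreover have eN: "e (1 / sqrt m) (\<lambda>i. Z i \<omega>) = (\<lambda>i. if i \<in> {1..m} then Z i \<omega> / sqrt m else 0)" for \<omega>
    by (simp add: e_def I_def fun_eq_iff)
  ultimately show ?thesis
    using lim_N by (simp only: eN I_def)
qed

end

section \<open>The \<open>p\<close>-variation of the Wiener process and the limit theorem\<close>

lemma tendsto_lp_norm:
  assumes p: "p \<ge> 1" and v: "\<And>i. i \<in> {1..d} \<Longrightarrow> ((\<lambda>x. v x i) \<longlongrightarrow> w i) F"
  shows "((\<lambda>x. lp_norm p d (v x)) \<longlongrightarrow> lp_norm p d w) F"
  unfolding lp_norm_def using assms
  by (intro tendsto_powr2 tendsto_sum tendsto_rabs tendsto_const always_eventually allI sum_nonneg) auto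

text \<open>The value 0 outside {1..m} keeps g from being evaluated beyond the unit interval, where
  nothing is known of a Wiener process.\<close>

definition grid_increments :: "nat \<Rightarrow> (real \<Rightarrow> real) \<Rightarrow> nat \<Rightarrow> real" where
  "grid_increments m g i = (if i \<in> {1..m} then g (real i / real m) - g (real (i - 1) / real m) else 0)"

lemma psum_grid_increments: "k \<le> m \<Longrightarrow> psum (grid_increments m g) k = g (real k / real m) - g 0"
  by (induction k) (auto simp: grid_increments_def)

text \<open>Mixing with the uniform partition makes a weakly increasing sequence strictly increasing, and the
  continuity of \<open>g\<close> allows the mixing weight to tend to \<open>0\<close>.\<close>
lemma p_variation_ge_weak_partition:
  assumes p: "p \<ge> 1" and g: "continuous_on {0..1} g" and d: "d > 0"
    and t: "\<And>i j. i \<le> j \<Longrightarrow> j \<le> d \<Longrightarrow> t i \<le> t j" "t 0 = 0" "t d = 1"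
  shows "ennreal (lp_norm p d (\<lambda>i. g (t i) - g (t (i - 1)))) \<le> p_variation p g"
proof -
  define s where "s n i = (1 - 1 / real (Suc n)) * t i + 1 / real (Suc n) * (real i / real d)" for n i
  have w: "0 \<le> 1 - 1 / real (Suc n)" for n by simp
  have t01: "0 \<le> t i" "t i \<le> 1" if "i \<le> d" for i using t(1)[of 0 i] t(1)[of i d] t that by auto
  have s01: "s n i \<in> {0..1}" if "i \<le> d" for n i
  proof -
    have "s n i \<le> (1 - 1 / real (Suc n)) * 1 + 1 / real (Suc n) * 1"
      unfolding s_def using t01[OF that] that d w by (intro add_mono mult_left_mono) auto
    moreover have "0 \<le> s n i"
      unfolding s_def using t01[OF that] w by (intro add_nonneg_nonneg mult_nonneg_nonneg) auto
    ultimately show ?thesis by simp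
  qed
  have up: "unit_partition d (s n)" for n
    unfolding unit_partition_def
  proof (intro conjI strict_mono_onI)
    fix i j assume "i \<in> {..d}" "j \<in> {..d}" "i < j"
    then show "s n i < s n j"
      unfolding s_def using t(1)[of i j] w d
      by (intro add_le_less_mono mult_left_mono mult_strict_left_mono divide_strict_right_mono) auto
  qed (use d t in \<open>auto simp: s_def\<close>)
  have le: "ennreal (lp_norm p d (\<lambda>i. g (s n i) - g (s n (i - 1)))) \<le> p_variation p g" for n
    unfolding p_variation_def by (rule SUP_upper2[of "(d, s n)"]) (use up in auto)
  have lim: "(\<lambda>n. g (s n i)) \<longlonglongrightarrow> g (t i)" if "i \<le> d" for i
  proof (rule continuous_on_tendsto_compose[OF g])
    have "(\<lambda>n. 1 / real (Suc n)) \<longlonglongrightarrow> 0" by (rule LIMSEQ_Suc[OF lim_1_over_n])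
    then have "(\<lambda>n. s n i) \<longlonglongrightarrow> (1 - 0) * t i + 0 * (real i / real d)"
      unfolding s_def by (intro tendsto_intros)
    then show "(\<lambda>n. s n i) \<longlonglongrightarrow> t i" by simp
    show "t i \<in> {0..1}" using t01[OF that] by simp
    show "\<forall>\<^sub>F n in sequentially. s n i \<in> {0..1}" using s01[OF that] by simp
  qed
  have "(\<lambda>n. lp_norm p d (\<lambda>i. g (s n i) - g (s n (i - 1)))) \<longlonglongrightarrow> lp_norm p d (\<lambda>i. g (t i) - g (t (i - 1)))"
    using lim by (intro tendsto_lp_norm[OF p] tendsto_diff) auto
  from tendsto_ennrealI[OF this] show ?thesis
    by (rule tendsto_upperbound) (rule always_eventually, rule allI, rule le, simp)
qed

text \<open>Index sequences may repeat values, so their grid points form only a weak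
  partition.\<close>

lemma test_statistic_grid_le_p_variation:
  assumes p: "p \<ge> 1" and g: "continuous_on {0..1} g" and m: "m > 0"
  shows "ennreal (test_statistic p m (grid_increments m g)) \<le> p_variation p g"
proof (cases "p_variation p g")
  case (real b)
  have "test_statistic p m (grid_increments m g) \<le> b"
  proof (rule test_statistic_le)
    fix d k assume k: "mono (k :: nat \<Rightarrow> nat)" "k 0 = 0" "k d = m"
    have km: "k i \<le> m" if "i \<le> d" for i using monoD[OF k(1) that] k(3) by simp
    have d: "d > 0" using k m by (cases d) auto
    have "lp_norm p d (\<lambda>i. psum (grid_increments m g) (k i) - psum (grid_increments m g) (k (i - 1)))
        = lp_norm p d (\<lambda>i. g (real (k i) / m) - g (real (k (i - 1)) / m))"
      using km by (intro lp_norm_cong) (auto simp: psum_grid_increments)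
    moreover have "ennreal (lp_norm p d (\<lambda>i. g (real (k i) / m) - g (real (k (i - 1)) / m))) \<le> p_variation p g"
      using k m monoD[OF k(1)]
      by (intro p_variation_ge_weak_partition[OF p g d, of "\<lambda>i. real (k i) / m"]) (auto intro!: divide_right_mono)
    ultimately show "lp_norm p d (\<lambda>i. psum (grid_increments m g) (k i) - psum (grid_increments m g) (k (i - 1))) \<le> b"
      using real by simp
  qed
  then show ?thesis using real by (simp add: ennreal_leI)
qed simp

text \<open>The upper bound holds on every grid. For the lower one a single near-optimal partition
  is kept fixed and rounded down to the grid; by continuity of g the norms of its increments
  converge as the grid is refined.\<close>

lemma test_statistic_grid_tendsto_p_variation:
  assumes p: "p \<ge> 1" and g: "continuous_on {0..1} g"
  shows "(\<lambda>m. ennreal (test_statistic p m (grid_increments m g))) \<longlonglongrightarrow> p_variation p g"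
proof (rule order_tendstoI)
  fix a assume less: "p_variation p g < a"
  show "\<forall>\<^sub>F m in sequentially. ennreal (test_statistic p m (grid_increments m g)) < a"
    using eventually_gt_at_top[of 0]
  proof eventually_elim
    case (elim m)
    then show ?case
      using test_statistic_grid_le_p_variation[OF p g elim] less by (meson le_less_trans)
  qed
next
  fix a assume "a < p_variation p g"
  then obtain d t where t: "unit_partition d t" and a: "a < ennreal (lp_norm p d (\<lambda>i. g (t i) - g (t (i - 1))))"
    unfolding p_variation_def less_SUP_iff by auto
  define k where "k m i = nat \<lfloor>t (min i d) * real m\<rfloor>" for m i
  have t01: "0 \<le> t i" "t i \<le> 1" if "i \<le> d" for i
    using unit_partition_mono[OF t, of 0 i] unit_partition_mono[OF t, of i d] t that by (auto simp: unit_partition_def)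
  have k: "mono (k m)" "k m 0 = 0" "k m d = m" for m
    using t by (auto simp: k_def unit_partition_def
      intro!: monoI nat_floor_mono mult_right_mono unit_partition_mono[OF t])
  have km: "k m i \<le> m" if "i \<le> d" for i m using monoD[OF k(1)[of m] that] k(3)[of m] by simp
  have lim: "(\<lambda>m. g (real (k m i) / real m)) \<longlonglongrightarrow> g (t i)" if i: "i \<le> d" for i
  proof (rule continuous_on_tendsto_compose[OF g])
    show "(\<lambda>m. real (k m i) / real m) \<longlonglongrightarrow> t i"
    proof (rule tendsto_sandwich)
      show "(\<lambda>m. t i - 1 / real m) \<longlonglongrightarrow> t i" using lim_1_over_n[where 'a=real] by (auto intro!: tendsto_eq_intros)
      have b: "t i * real m - 1 \<le> real (k m i)" "real (k m i) \<le> t i * real m" for m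
      proof -
        have "0 \<le> t i * real m" using t01[OF i] by simp
        moreover have "k m i = nat \<lfloor>t i * real m\<rfloor>" using i by (simp add: k_def min_absorb1)
        ultimately show "t i * real m - 1 \<le> real (k m i)" "real (k m i) \<le> t i * real m" by linarith+
      qed
      show "\<forall>\<^sub>F m in sequentially. t i - 1 / real m \<le> real (k m i) / real m"
        using eventually_gt_at_top[of 0]
      proof eventually_elim
        case (elim m)
        have "(t i * real m - 1) / real m \<le> real (k m i) / real m" by (intro divide_right_mono b) simp
        then show ?case using elim by (simp add: diff_divide_distrib)
      qed
      show "\<forall>\<^sub>F m in sequentially. real (k m i) / real m \<le> t i"
        using eventually_gt_at_top[of 0] by eventually_elim (use b(2) in \<open>simp add: field_simps\<close>)
    qed auto
    show "t i \<in> {0..1}" using t01[OF i] by simp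
    show "\<forall>\<^sub>F m in sequentially. real (k m i) / real m \<in> {0..1}"
      using km[OF i] by (intro always_eventually) (auto simp: divide_le_eq_1)
  qed
  have "(\<lambda>m. lp_norm p d (\<lambda>i. g (real (k m i) / m) - g (real (k m (i - 1)) / m))) \<longlonglongrightarrow> lp_norm p d (\<lambda>i. g (t i) - g (t (i - 1)))"
    using lim by (intro tendsto_lp_norm[OF p] tendsto_diff) auto
  from order_tendstoD(1)[OF tendsto_ennrealI[OF this] a] show "\<forall>\<^sub>F m in sequentially. a < ennreal (test_statistic p m (grid_increments m g))"
  proof eventually_elim
    case (elim m)
    have "lp_norm p d (\<lambda>i. g (real (k m i) / m) - g (real (k m (i - 1)) / m))
        = lp_norm p d (\<lambda>i. psum (grid_increments m g) (k m i) - psum (grid_increments m g) (k m (i - 1)))"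
      using km by (intro lp_norm_cong) (auto simp: psum_grid_increments)
    also have "\<dots> \<le> test_statistic p m (grid_increments m g)" by (rule test_statistic_ge[OF p k])
    finally show ?case using elim by (meson ennreal_leI less_le_trans)
  qed
qed

section \<open>Grid variations of the Wiener process\<close>

locale wiener =
  fixes N :: "'b measure" and W :: "real \<Rightarrow> 'b \<Rightarrow> real"
  assumes W: "wiener_process N W"
begin

sublocale prob_space N using W by (simp add: wiener_process_def)

lemma measurable_W: "t \<in> {0..1} \<Longrightarrow> W t \<in> borel_measurable N"
  using W by (simp add: wiener_process_def)

lemma continuous_W: "\<omega> \<in> space N \<Longrightarrow> continuous_on {0..1} (\<lambda>t. W t \<omega>)"
  using W by (simp add: wiener_process_def)

definition inc :: "nat \<Rightarrow> nat \<Rightarrow> 'b \<Rightarrow> real" where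
  "inc m i \<omega> = grid_increments m (\<lambda>t. W t \<omega>) i"

lemma measurable_inc [measurable]: "inc m i \<in> borel_measurable N"
proof (cases "i \<in> {1..m}")
  case True
  then have [measurable]: "W (real i / real m) \<in> borel_measurable N" "W (real (i - 1) / real m) \<in> borel_measurable N"
    by (auto intro!: measurable_W simp: divide_le_eq_1)
  have "inc m i = (\<lambda>\<omega>. W (real i / real m) \<omega> - W (real (i - 1) / real m) \<omega>)"
    using True by (simp add: inc_def[abs_def] grid_increments_def del: of_nat_diff)
  then show ?thesis by (simp only:) measurable
next
  case False
  then have "inc m i = (\<lambda>\<omega>. 0)" by (auto simp: inc_def grid_increments_def fun_eq_iff)
  then show ?thesis by simp
qed

lemma indep_inc: "indep_vars (\<lambda>_. borel) (inc m) {1..m}"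
proof (cases "m = 0")
  case True
  then show ?thesis by (simp add: indep_vars_def indep_sets_def)
next
  case False
  have "strict_mono_on {..m} (\<lambda>i. real i / real m)"
    using False by (auto intro!: strict_mono_onI divide_strict_right_mono)
  then have "indep_vars (\<lambda>_. borel) (\<lambda>i \<omega>. W (real (Suc i) / real m) \<omega> - W (real i / real m) \<omega>) {..<m}"
    using W False unfolding wiener_process_def by (elim conjE allE[of _ m] allE[of _ "\<lambda>i. real i / real m"]) simp
  moreover have "inj_on (\<lambda>i. i - 1) {1..m}" "(\<lambda>i. i - 1) ` {1..m} \<subseteq> {..<m}"
    by (auto simp: inj_on_def)
  ultimately
  have "indep_vars (\<lambda>_. borel) (\<lambda>i \<omega>. W (real (Suc (i - 1)) / real m) \<omega> - W (real (i - 1) / real m) \<omega>) {1..m}"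
    by (rule indep_vars_reindex)
  then show ?thesis
    by (rule indep_vars_cong[THEN iffD1, rotated -1]) (auto simp: inc_def[abs_def] grid_increments_def)
qed

lemma distr_inc:
  assumes i: "i \<in> {1..m}"
  shows "distr N borel (\<lambda>\<omega>. sqrt m * inc m i \<omega>) = std_normal_distribution"
proof -
  let ?s = "real (i - 1) / real m" and ?t = "real i / real m"
  have m: "m > 0" using i by auto
  have "?s < ?t" "0 \<le> ?s" "?t \<le> 1" using i m by (auto intro!: divide_strict_right_mono)
  then have "distributed N lborel (\<lambda>\<omega>. W ?t \<omega> - W ?s \<omega>) (normal_density 0 (sqrt (?t - ?s)))"
    using W unfolding wiener_process_def by blast
  moreover have "?t - ?s = 1 / m" using i m by (simp add: field_simps of_nat_diff)
  ultimately have "distributed N lborel (\<lambda>\<omega>. inc m i \<omega>) (normal_density 0 (sqrt (1 / m)))"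
    using i by (simp add: inc_def grid_increments_def)
  then have "distributed N lborel (\<lambda>\<omega>. (inc m i \<omega> - 0) / sqrt (1 / m)) std_normal_density"
    using m by (subst (asm) normal_standard_normal_convert) auto
  then have "distr N lborel (\<lambda>\<omega>. sqrt m * inc m i \<omega>) = std_normal_distribution"
    by (simp add: distributed_def real_sqrt_divide mult.commute)
  then show ?thesis by (simp cong: distr_cong)
qed

lemma
  assumes i: "i \<in> {1..m}"
  shows integrable_inc_sq: "integrable N (\<lambda>\<omega>. (inc m i \<omega>)\<^sup>2)"
    and expectation_inc: "expectation (inc m i) = 0"
    and expectation_inc_sq: "expectation (\<lambda>\<omega>. (inc m i \<omega>)\<^sup>2) = 1 / m"
proof -
  have m: "m > 0" using i by auto
  let ?Z = "\<lambda>\<omega>. sqrt m * inc m i \<omega>"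
  have Z: "integrable N (\<lambda>\<omega>. ?Z \<omega> ^ k)" for k
  proof -
    have "integrable (distr N borel ?Z) (\<lambda>x. x ^ k)"
      unfolding distr_inc[OF i] by (rule integrable_std_normal_distribution_moment)
    then show ?thesis by (subst (asm) integrable_distr_eq) auto
  qed
  have EZ: "expectation (\<lambda>\<omega>. ?Z \<omega> ^ k) = integral\<^sup>L std_normal_distribution (\<lambda>x. x ^ k)" for k
    unfolding distr_inc[OF i, symmetric] by (rule integral_distr[symmetric]) auto
  have "integrable N (\<lambda>\<omega>. ?Z \<omega> ^ 2 / m)" using Z[of 2] by simp
  then show "integrable N (\<lambda>\<omega>. (inc m i \<omega>)\<^sup>2)" using m by (simp add: power_mult_distrib)
  have "expectation (\<lambda>\<omega>. ?Z \<omega> ^ 1) = 0"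
    unfolding EZ by (rule integral_std_normal_distribution_moment_odd) simp
  then show "expectation (inc m i) = 0" using m by simp
  have "expectation (\<lambda>\<omega>. ?Z \<omega> ^ (2 * 1)) = 1"
    unfolding EZ std_normal_distribution_even_moments by simp
  also have "(\<lambda>\<omega>. ?Z \<omega> ^ (2 * 1)) = (\<lambda>\<omega>. m * (inc m i \<omega>)\<^sup>2)"
    by (simp add: power_mult_distrib fun_eq_iff)
  finally show "expectation (\<lambda>\<omega>. (inc m i \<omega>)\<^sup>2) = 1 / m" using m by (simp add: field_simps)
qed

text \<open>Through this the variation estimate for sums of independent variables applies to the
  Wiener process itself.\<close>

lemma centred_independent_inc: "centred_independent N (inc m) m"
  by (intro centred_independent.intro centred_independent_axioms.intro prob_space_axioms
      measurable_inc indep_inc integrable_inc_sq expectation_inc)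

definition V :: "real \<Rightarrow> nat \<Rightarrow> 'b \<Rightarrow> real" where
  "V p m \<omega> = test_statistic p m (\<lambda>i. inc m i \<omega>)"

lemma measurable_V: "p \<ge> 1 \<Longrightarrow> V p m \<in> borel_measurable N"
  unfolding V_def[abs_def] by (rule borel_measurable_test_statistic) auto

lemma V_tendsto:
  "p \<ge> 1 \<Longrightarrow> \<omega> \<in> space N \<Longrightarrow> (\<lambda>m. ennreal (V p m \<omega>)) \<longlonglongrightarrow> p_variation p (\<lambda>t. W t \<omega>)"
  unfolding V_def inc_def by (intro test_statistic_grid_tendsto_p_variation continuous_W)

text \<open>A supremum over uncountably many partitions, but by continuity of the paths also the
  limit of the sequence of grid variations.\<close>

lemma measurable_p_variation:
  assumes "p \<ge> 1"
  shows "(\<lambda>\<omega>. p_variation p (\<lambda>t. W t \<omega>)) \<in> borel_measurable N"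
  by (rule borel_measurable_LIMSEQ_order[where u="\<lambda>m \<omega>. ennreal (V p m \<omega>)"])
     (use assms measurable_V V_tendsto in auto)

text \<open>The m grid increments have variance 1/m each, so the grid variations have means bounded
  uniformly in m; Fatou's lemma passes the bound to the limit.\<close>

lemma p_variation_finite:
  assumes p: "p > 2"
  shows "AE \<omega> in N. p_variation p (\<lambda>t. W t \<omega>) < \<infinity>"
proof -
  have p1: "p \<ge> 1" using p by simp
  note [measurable] = measurable_V[OF p1] measurable_p_variation[OF p1]
  have le: "(\<integral>\<^sup>+\<omega>. ennreal (V p m \<omega>) \<partial>N) \<le> ennreal (1 + 4 * tail_const p)" if m: "m > 0" for m
  proof -
    interpret c: centred_independent N "inc m" m by (rule centred_independent_inc)
    have "expectation (V p m) \<le> (1 + 4 * tail_const p) * 1"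
      unfolding V_def[abs_def]
      by (rule c.expectation_test_statistic_le[where v="1 / m"]) (use p m in \<open>auto simp: expectation_inc_sq\<close>)
    moreover have "integrable N (V p m)" unfolding V_def[abs_def] by (rule c.integrable_test_statistic[OF p1])
    moreover have "0 \<le> V p m \<omega>" for \<omega> unfolding V_def by (rule test_statistic_nonneg[OF p1])
    ultimately show ?thesis by (subst nn_integral_eq_integral) (auto intro: ennreal_leI)
  qed
  have "(\<integral>\<^sup>+\<omega>. p_variation p (\<lambda>t. W t \<omega>) \<partial>N) = (\<integral>\<^sup>+\<omega>. liminf (\<lambda>m. ennreal (V p m \<omega>)) \<partial>N)"
    using V_tendsto[OF p1] by (intro nn_integral_cong lim_imp_Liminf[symmetric]) auto
  also have "\<dots> \<le> liminf (\<lambda>m. \<integral>\<^sup>+\<omega>. ennreal (V p m \<omega>) \<partial>N)" by (rule nn_integral_liminf) measurable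
  also have "\<dots> \<le> ennreal (1 + 4 * tail_const p)"
    by (rule order_trans[OF Liminf_mono Liminf_const[THEN eq_refl]])
       (auto intro!: eventually_mono[OF eventually_gt_at_top[of 0]] le)
  finally have "(\<integral>\<^sup>+\<omega>. p_variation p (\<lambda>t. W t \<omega>) \<partial>N) \<noteq> \<infinity>"
    by (auto simp: top_unique)
  then have "AE \<omega> in N. p_variation p (\<lambda>t. W t \<omega>) \<noteq> \<infinity>"
    by (rule nn_integral_PInf_AE[rotated]) measurable
  then show ?thesis by eventually_elim (simp add: less_top)
qed

lemma V_tendsto_real:
  assumes p: "p > 2"
  shows "AE \<omega> in N. (\<lambda>m. V p m \<omega>) \<longlonglongrightarrow> enn2real (p_variation p (\<lambda>t. W t \<omega>))"
  using p_variation_finite[OF p] AE_space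
proof eventually_elim
  case (elim \<omega>)
  have p1: "p \<ge> 1" using p by simp
  have "(\<lambda>m. ennreal (V p m \<omega>)) \<longlonglongrightarrow> ennreal (enn2real (p_variation p (\<lambda>t. W t \<omega>)))"
    using V_tendsto[OF p1 elim(2)] elim(1) by simp
  then have "(\<lambda>m. enn2real (ennreal (V p m \<omega>))) \<longlonglongrightarrow> enn2real (p_variation p (\<lambda>t. W t \<omega>))"
    by (rule tendsto_enn2real) simp
  then show ?case unfolding V_def using test_statistic_nonneg[OF p1] by simp
qed

end

section \<open>Comparison of characteristic functions and the limit theorem\<close>

lemma norm_iexp_diff_le: "norm (iexp x - iexp y) \<le> \<bar>x - y\<bar>"
proof -
  have "iexp x - iexp y = iexp y * (iexp (x - y) - 1)"
    by (simp add: algebra_simps flip: exp_add)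
  then have "norm (iexp x - iexp y) = norm (iexp (x - y) - 1)" by (simp add: norm_mult)
  also have "\<dots> \<le> \<bar>x - y\<bar>" using iexp_approx1[of "x - y" 0] by simp
  finally show ?thesis .
qed

context prob_space
begin

lemma integrable_iexp_rv: "f \<in> borel_measurable M \<Longrightarrow> integrable M (\<lambda>\<omega>. iexp (t * f \<omega>))"
  by (rule integrable_const_bound[of _ 1]) auto

lemma char_distr: "f \<in> borel_measurable M \<Longrightarrow> char (distr M borel f) t = expectation (\<lambda>\<omega>. iexp (t * f \<omega>))"
  unfolding char_def by (rule integral_distr) auto

lemma char_diff_le_expectation:
  assumes [measurable]: "f \<in> borel_measurable M" "g \<in> borel_measurable M"
    and h: "integrable M h" "\<And>\<omega>. \<omega> \<in> space M \<Longrightarrow> \<bar>f \<omega> - g \<omega>\<bar> \<le> h \<omega>"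
  shows "norm (expectation (\<lambda>\<omega>. iexp (t * f \<omega>)) - expectation (\<lambda>\<omega>. iexp (t * g \<omega>))) \<le> \<bar>t\<bar> * expectation h"
proof -
  have "expectation (\<lambda>\<omega>. iexp (t * f \<omega>)) - expectation (\<lambda>\<omega>. iexp (t * g \<omega>))
      = expectation (\<lambda>\<omega>. iexp (t * f \<omega>) - iexp (t * g \<omega>))"
    by (intro Bochner_Integration.integral_diff[symmetric] integrable_iexp_rv assms)
  also have "norm \<dots> \<le> expectation (\<lambda>\<omega>. \<bar>t\<bar> * h \<omega>)"
  proof (rule order_trans[OF Bochner_Integration.integral_norm_bound Bochner_Integration.integral_mono])
    fix \<omega> assume \<omega>: "\<omega> \<in> space M"
    have "norm (iexp (t * f \<omega>) - iexp (t * g \<omega>)) \<le> \<bar>t * f \<omega> - t * g \<omega>\<bar>" by (rule norm_iexp_diff_le)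
    also have "\<dots> = \<bar>t\<bar> * \<bar>f \<omega> - g \<omega>\<bar>" by (simp add: abs_mult flip: right_diff_distrib)
    also have "\<dots> \<le> \<bar>t\<bar> * h \<omega>" using h(2)[OF \<omega>] by (intro mult_left_mono) auto
    finally show "norm (iexp (t * f \<omega>) - iexp (t * g \<omega>)) \<le> \<bar>t\<bar> * h \<omega>" .
  qed (use h in \<open>auto intro!: integrable_norm Bochner_Integration.integrable_diff integrable_iexp_rv simp del: of_real_mult\<close>)
  finally show ?thesis by simp
qed

text \<open>On the exceptional event the difference of two unimodular numbers is at most 2; off it
  the Lipschitz constant |t| is used.\<close>

lemma char_diff_le_prob:
  assumes [measurable]: "f \<in> borel_measurable M" "g \<in> borel_measurable M" and \<epsilon>: "\<epsilon> \<ge> 0"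
  shows "norm (expectation (\<lambda>\<omega>. iexp (t * f \<omega>)) - expectation (\<lambda>\<omega>. iexp (t * g \<omega>)))
    \<le> \<bar>t\<bar> * \<epsilon> + 2 * prob {\<omega>\<in>space M. \<epsilon> \<le> \<bar>f \<omega> - g \<omega>\<bar>}"
proof -
  let ?E = "{\<omega>\<in>space M. \<epsilon> \<le> \<bar>f \<omega> - g \<omega>\<bar>}"
  have "expectation (\<lambda>\<omega>. iexp (t * f \<omega>)) - expectation (\<lambda>\<omega>. iexp (t * g \<omega>))
      = expectation (\<lambda>\<omega>. iexp (t * f \<omega>) - iexp (t * g \<omega>))"
    by (intro Bochner_Integration.integral_diff[symmetric] integrable_iexp_rv assms)
  also have "norm \<dots> \<le> expectation (\<lambda>\<omega>. \<bar>t\<bar> * \<epsilon> + 2 * indicator ?E \<omega>)"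
  proof (rule order_trans[OF Bochner_Integration.integral_norm_bound Bochner_Integration.integral_mono])
    fix \<omega> assume \<omega>: "\<omega> \<in> space M"
    show "norm (iexp (t * f \<omega>) - iexp (t * g \<omega>)) \<le> \<bar>t\<bar> * \<epsilon> + 2 * indicator ?E \<omega>"
    proof (cases "\<epsilon> \<le> \<bar>f \<omega> - g \<omega>\<bar>")
      case True
      have "norm (iexp (t * f \<omega>) - iexp (t * g \<omega>)) \<le> 1 + 1"
        by (rule order_trans[OF norm_triangle_ineq4]) simp
      moreover have "0 \<le> \<bar>t\<bar> * \<epsilon>" using \<epsilon> by simp
      ultimately show ?thesis using True \<omega> by (simp add: indicator_def)
    next
      case False
      have "norm (iexp (t * f \<omega>) - iexp (t * g \<omega>)) \<le> \<bar>t * f \<omega> - t * g \<omega>\<bar>" by (rule norm_iexp_diff_le)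
      also have "\<dots> = \<bar>t\<bar> * \<bar>f \<omega> - g \<omega>\<bar>" by (simp add: abs_mult flip: right_diff_distrib)
      also have "\<dots> \<le> \<bar>t\<bar> * \<epsilon>" using False by (intro mult_left_mono) auto
      finally show ?thesis using False by (simp add: indicator_def)
    qed
  qed (auto simp del: of_real_mult intro!: integrable_norm Bochner_Integration.integrable_diff integrable_iexp_rv Bochner_Integration.integrable_add
        integrable_mult_right integrable_real_indicator simp: emeasure_eq_measure)
  also have "\<dots> = \<bar>t\<bar> * \<epsilon> + 2 * prob ?E"
    by (subst Bochner_Integration.integral_add)
       (auto simp: prob_space emeasure_eq_measure intro!: integrable_mult_right integrable_real_indicator)
  finally show ?thesis .
qed

end

text \<open>Four comparisons: \<open>Z\<close> with \<open>Z'\<close> in L^1, \<open>Z'\<close> with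
  \<open>U m\<close> in probability, \<open>U m\<close> with the grid variation of W as n grows, and
  the latter with the limit as m grows. The second is uniform over n at least m^2, so m can be fixed
  before n tends to infinity.\<close>

lemma (in short_memory) char_test_statistic_tendsto:
  fixes N :: "'b measure" and A
  defines "A \<equiv> (\<Sum>j. \<psi> j)"
  assumes p: "p > 2" and A0: "A \<noteq> 0" and W: "wiener_process N W"
  shows "(\<lambda>n. expectation (\<lambda>\<omega>. iexp (t * (test_statistic p n (\<lambda>i. X (int i) \<omega>) / (\<bar>A\<bar> * \<sigma> * sqrt n)))))
     \<longlonglongrightarrow> integral\<^sup>L N (\<lambda>\<omega>. iexp (t * enn2real (p_variation p (\<lambda>s. W s \<omega>))))"
proof -
  interpret w: wiener N W by standard fact
  have p1: "p \<ge> 1" using p by simp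
  note [measurable] = borel_measurable_test_statistic[OF p1] w.measurable_V[OF p1] w.measurable_p_variation[OF p1]
  define Z where "Z n \<omega> = test_statistic p n (\<lambda>i. X (int i) \<omega>) / (\<bar>A\<bar> * \<sigma> * sqrt n)" for n \<omega>
  define Z' where "Z' n \<omega> = test_statistic p n (\<lambda>i. \<eta> (int i) \<omega>) / (\<sigma> * sqrt n)" for n \<omega>
  define U where "U m n \<omega> = test_statistic p m (blocks (n div m) (\<lambda>i. \<eta> (int i) \<omega>)) / (\<sigma> * sqrt n)" for m n \<omega>
  define L where "L \<omega> = enn2real (p_variation p (\<lambda>s. W s \<omega>))" for \<omega>
  have bm: "(\<lambda>\<omega>. blocks l (\<lambda>i. \<eta> (int i) \<omega>) j) \<in> borel_measurable M" for l j
    unfolding blocks_def by measurable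
  have Zm [measurable]: "Z n \<in> borel_measurable M" for n unfolding Z_def by measurable
  have Z'm [measurable]: "Z' n \<in> borel_measurable M" for n unfolding Z'_def by measurable
  have Um [measurable]: "U m n \<in> borel_measurable M" for m n
    unfolding U_def using bm by (intro borel_measurable_divide borel_measurable_test_statistic p1) auto
  have Lm [measurable]: "L \<in> borel_measurable N" unfolding L_def by measurable
  define D where "D n = expectation (\<lambda>\<omega>. test_statistic p n (\<lambda>i. X (int i) \<omega> - A * \<eta> (int i) \<omega>)) / sqrt n" for n
  have D_lim: "D \<longlonglongrightarrow> 0" unfolding D_def A_def by (rule expectation_linear_process_approx(1)[OF p])
  have step1: "norm (expectation (\<lambda>\<omega>. iexp (t * Z n \<omega>)) - expectation (\<lambda>\<omega>. iexp (t * Z' n \<omega>))) \<le> \<bar>t\<bar> * (D n / (\<bar>A\<bar> * \<sigma>))" for n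
  proof -
    let ?h = "\<lambda>\<omega>. test_statistic p n (\<lambda>i. X (int i) \<omega> - A * \<eta> (int i) \<omega>) / (\<bar>A\<bar> * \<sigma> * sqrt n)"
    have "norm (expectation (\<lambda>\<omega>. iexp (t * Z n \<omega>)) - expectation (\<lambda>\<omega>. iexp (t * Z' n \<omega>))) \<le> \<bar>t\<bar> * expectation ?h"
    proof (rule char_diff_le_expectation)
      show "integrable M ?h"
        unfolding A_def by (intro integrable_divide expectation_linear_process_approx(2)[OF p])
      fix \<omega>
      have "Z' n \<omega> = test_statistic p n (\<lambda>i. A * \<eta> (int i) \<omega>) / (\<bar>A\<bar> * \<sigma> * sqrt n)"
        using A0 by (simp add: Z'_def test_statistic_scale[OF p1])
      then have "\<bar>Z n \<omega> - Z' n \<omega>\<bar> = \<bar>test_statistic p n (\<lambda>i. X (int i) \<omega>) - test_statistic p n (\<lambda>i. A * \<eta> (int i) \<omega>)\<bar> / (\<bar>A\<bar> * \<sigma> * sqrt n)"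
        using sigma_pos by (simp add: Z_def abs_mult flip: diff_divide_distrib)
      also have "\<dots> \<le> ?h \<omega>"
        using sigma_pos by (intro divide_right_mono test_statistic_diff_le[OF p1]) auto
      finally show "\<bar>Z n \<omega> - Z' n \<omega>\<bar> \<le> ?h \<omega>" .
    qed measurable
    then show ?thesis by (simp add: D_def mult_ac)
  qed
  have step3: "(\<lambda>n. expectation (\<lambda>\<omega>. iexp (t * U m n \<omega>))) \<longlonglongrightarrow> integral\<^sup>L N (\<lambda>\<omega>. iexp (t * w.V p m \<omega>))" if m: "m > 0" for m
  proof -
    have "(\<lambda>n. expectation (\<lambda>\<omega>. iexp (t * test_statistic p m (\<lambda>i. if i \<in> {1..m} then blocks (n div m) (\<lambda>j. \<eta> (int j) \<omega>) i / (\<sigma> * sqrt n) else 0))))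
      \<longlonglongrightarrow> integral\<^sup>L N (\<lambda>\<omega>. iexp (t * test_statistic p m (\<lambda>i. if i \<in> {1..m} then (sqrt m * w.inc m i \<omega>) / sqrt m else 0)))"
    proof (rule blocks_clt[OF m, where F="\<lambda>x. iexp (t * test_statistic p m x)" and B=1])
      show "(\<lambda>x. iexp (t * test_statistic p m x)) \<in> borel_measurable borel"
        using borel_measurable_continuous_onI[OF continuous_test_statistic[OF p1, of m]] by measurable
      show "norm (iexp (t * test_statistic p m x)) \<le> 1" for x by simp
      show "(\<lambda>n. iexp (t * test_statistic p m (x n))) \<longlonglongrightarrow> iexp (t * test_statistic p m y)"
        if "\<And>i. (\<lambda>n. x n i) \<longlonglongrightarrow> y i" for x y
        using that by (intro tendsto_intros tendsto_test_statistic p1)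
      show "prob_space N" by (rule w.prob_space_axioms)
      show "w.indep_vars (\<lambda>_. borel) (\<lambda>i \<omega>. sqrt m * w.inc m i \<omega>) {1..m}"
        by (rule w.indep_vars_compose2[OF w.indep_inc]) simp
      show "distr N borel (\<lambda>\<omega>. sqrt m * w.inc m i \<omega>) = std_normal_distribution" if "i \<in> {1..m}" for i
        by (rule w.distr_inc[OF that])
    qed
    moreover have "test_statistic p m (\<lambda>i. if i \<in> {1..m} then (sqrt m * w.inc m i \<omega>) / sqrt m else 0) = w.V p m \<omega>" for \<omega>
      unfolding w.V_def using m by (intro test_statistic_cong) auto
    moreover have "test_statistic p m (\<lambda>i. if i \<in> {1..m} then blocks (n div m) (\<lambda>j. \<eta> (int j) \<omega>) i / (\<sigma> * sqrt n) else 0) = U m n \<omega>" for n \<omega>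
    proof -
      have "test_statistic p m (\<lambda>i. if i \<in> {1..m} then blocks (n div m) (\<lambda>j. \<eta> (int j) \<omega>) i / (\<sigma> * sqrt n) else 0)
          = test_statistic p m (\<lambda>i. 1 / (\<sigma> * sqrt n) * blocks (n div m) (\<lambda>j. \<eta> (int j) \<omega>) i)"
        by (intro test_statistic_cong) auto
      also have "\<dots> = U m n \<omega>"
        unfolding U_def test_statistic_scale[OF p1] using sigma_pos by simp
      finally show ?thesis .
    qed
    ultimately show ?thesis by simp
  qed
  have step4: "(\<lambda>m. integral\<^sup>L N (\<lambda>\<omega>. iexp (t * w.V p m \<omega>))) \<longlonglongrightarrow> integral\<^sup>L N (\<lambda>\<omega>. iexp (t * L \<omega>))"
  proof (rule integral_dominated_convergence[where w="\<lambda>_. 1"])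
    show "AE \<omega> in N. (\<lambda>m. iexp (t * w.V p m \<omega>)) \<longlonglongrightarrow> iexp (t * L \<omega>)"
      using w.V_tendsto_real[OF p] by eventually_elim (auto simp: L_def intro!: tendsto_intros)
  qed auto
  have "(\<lambda>n. expectation (\<lambda>\<omega>. iexp (t * Z n \<omega>))) \<longlonglongrightarrow> integral\<^sup>L N (\<lambda>\<omega>. iexp (t * L \<omega>))"
  proof (rule tendstoI)
    fix e :: real assume e: "e > 0"
    \<comment> \<open>Gives |t| \<epsilon> at most e / 8, also for t = 0; together with twice the
      probability bound e / 16 the second comparison costs e / 4.\<close>
    define \<epsilon> where "\<epsilon> = e / (8 * (\<bar>t\<bar> + 1))"
    have \<epsilon>: "\<epsilon> > 0" using e by (simp add: \<epsilon>_def)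
    have te: "\<bar>t\<bar> * \<epsilon> \<le> e / 8"
    proof -
      have "\<bar>t\<bar> * \<epsilon> \<le> (\<bar>t\<bar> + 1) * \<epsilon>" using \<epsilon> by (intro mult_right_mono) auto
      also have "\<dots> = e / 8" by (simp add: \<epsilon>_def field_simps add_pos_nonneg)
      finally show ?thesis .
    qed
    obtain m0 where m0: "m0 > 0" and approx: "\<And>m n. m0 \<le> m \<Longrightarrow> m\<^sup>2 \<le> n \<Longrightarrow> prob {\<omega>\<in>space M. \<epsilon> * \<sigma> * sqrt n \<le>
       \<bar>test_statistic p n (\<lambda>j. \<eta> (int j) \<omega>) - test_statistic p m (blocks (n div m) (\<lambda>j. \<eta> (int j) \<omega>))\<bar>} \<le> e / 16"
      using blocks_approx_in_prob[OF p, of "\<epsilon> * \<sigma>" "e / 16"] \<epsilon> sigma_pos e by auto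
    have "\<forall>\<^sub>F m in sequentially. dist (integral\<^sup>L N (\<lambda>\<omega>. iexp (t * w.V p m \<omega>))) (integral\<^sup>L N (\<lambda>\<omega>. iexp (t * L \<omega>))) < e / 4 \<and> m0 \<le> m"
      using tendstoD[OF step4, of "e / 4"] e by (intro eventually_conj eventually_ge_at_top) auto
    then obtain m where m: "dist (integral\<^sup>L N (\<lambda>\<omega>. iexp (t * w.V p m \<omega>))) (integral\<^sup>L N (\<lambda>\<omega>. iexp (t * L \<omega>))) < e / 4" "m0 \<le> m"
      by (auto simp: eventually_sequentially)
    have m_pos: "m > 0" using m m0 by simp
    have "(\<lambda>n. \<bar>t\<bar> * (D n / (\<bar>A\<bar> * \<sigma>))) \<longlonglongrightarrow> \<bar>t\<bar> * (0 / (\<bar>A\<bar> * \<sigma>))"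
      using D_lim A0 sigma_pos by (intro tendsto_intros) auto
    then have "\<forall>\<^sub>F n in sequentially. \<bar>t\<bar> * (D n / (\<bar>A\<bar> * \<sigma>)) < e / 4"
      using e by (intro order_tendstoD(2)) auto
    moreover have "\<forall>\<^sub>F n in sequentially. dist (expectation (\<lambda>\<omega>. iexp (t * U m n \<omega>))) (integral\<^sup>L N (\<lambda>\<omega>. iexp (t * w.V p m \<omega>))) < e / 4"
      using tendstoD[OF step3[OF m_pos], of "e / 4"] e by simp
    ultimately show "\<forall>\<^sub>F n in sequentially. dist (expectation (\<lambda>\<omega>. iexp (t * Z n \<omega>))) (integral\<^sup>L N (\<lambda>\<omega>. iexp (t * L \<omega>))) < e"
      using eventually_ge_at_top[of "m\<^sup>2"]
    proof eventually_elim
      case (elim n)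
      have n0: "n > 0" using elim(3) m_pos by (metis gr0I le_zero_eq power_eq_0_iff neq0_conv)
      have "{\<omega>\<in>space M. \<epsilon> \<le> \<bar>Z' n \<omega> - U m n \<omega>\<bar>} = {\<omega>\<in>space M. \<epsilon> * \<sigma> * sqrt n \<le>
       \<bar>test_statistic p n (\<lambda>j. \<eta> (int j) \<omega>) - test_statistic p m (blocks (n div m) (\<lambda>j. \<eta> (int j) \<omega>))\<bar>}"
        using n0 sigma_pos by (simp add: Z'_def U_def le_divide_eq mult.assoc flip: diff_divide_distrib)
      then have "prob {\<omega>\<in>space M. \<epsilon> \<le> \<bar>Z' n \<omega> - U m n \<omega>\<bar>} \<le> e / 16" using approx[OF m(2) elim(3)] by simp
      moreover have "norm (expectation (\<lambda>\<omega>. iexp (t * Z' n \<omega>)) - expectation (\<lambda>\<omega>. iexp (t * U m n \<omega>)))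
        \<le> \<bar>t\<bar> * \<epsilon> + 2 * prob {\<omega>\<in>space M. \<epsilon> \<le> \<bar>Z' n \<omega> - U m n \<omega>\<bar>}"
        by (rule char_diff_le_prob) (use \<epsilon> in auto)
      ultimately have 2: "dist (expectation (\<lambda>\<omega>. iexp (t * Z' n \<omega>))) (expectation (\<lambda>\<omega>. iexp (t * U m n \<omega>))) \<le> e / 4"
        using te by (simp add: dist_norm)
      have 1: "dist (expectation (\<lambda>\<omega>. iexp (t * Z n \<omega>))) (expectation (\<lambda>\<omega>. iexp (t * Z' n \<omega>))) < e / 4"
        using le_less_trans[OF step1[of n] elim(1)] by (simp only: dist_norm)
      note tri = dist_triangle[of "expectation (\<lambda>\<omega>. iexp (t * Z n \<omega>))" "integral\<^sup>L N (\<lambda>\<omega>. iexp (t * L \<omega>))" "expectation (\<lambda>\<omega>. iexp (t * Z' n \<omega>))"]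
        dist_triangle[of "expectation (\<lambda>\<omega>. iexp (t * Z' n \<omega>))" "integral\<^sup>L N (\<lambda>\<omega>. iexp (t * L \<omega>))" "expectation (\<lambda>\<omega>. iexp (t * U m n \<omega>))"]
        dist_triangle[of "expectation (\<lambda>\<omega>. iexp (t * U m n \<omega>))" "integral\<^sup>L N (\<lambda>\<omega>. iexp (t * L \<omega>))" "integral\<^sup>L N (\<lambda>\<omega>. iexp (t * w.V p m \<omega>))"]
      then show ?case using 1 2 elim(2) m(1) by linarith
    qed
  qed
  then show ?thesis by (simp add: Z_def L_def)
qed

text \<open>Finiteness of the p-variation is part of the conclusion because \<open>enn2real\<close>
  maps infinity to 0: with it, the limit variable is almost surely the true p-variation. Convergence
  follows from that of the characteristic functions by Levy's continuity theorem.\<close>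

theorem theorem15:
  fixes M :: "'a measure" and N :: "'b measure"
    and \<eta> :: "int \<Rightarrow> 'a \<Rightarrow> real" and \<psi> :: "nat \<Rightarrow> real" and X :: "int \<Rightarrow> 'a \<Rightarrow> real"
    and \<mu> :: "nat \<Rightarrow> nat \<Rightarrow> real" and Y :: "nat \<Rightarrow> nat \<Rightarrow> 'a \<Rightarrow> real"
    and T :: "nat \<Rightarrow> 'a \<Rightarrow> real" and W :: "real \<Rightarrow> 'b \<Rightarrow> real"
    and p \<sigma> A :: real
  assumes p: "p > 2"
    and M: "prob_space M"
    and indep: "prob_space.indep_vars M (\<lambda>_. borel) \<eta> UNIV"
    and ident: "\<And>i. distr M borel (\<eta> i) = distr M borel (\<eta> 1)"
    and sq_integrable: "integrable M (\<lambda>\<omega>. (\<eta> 1 \<omega>)\<^sup>2)"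
    and mean: "(\<integral>\<omega>. \<eta> 1 \<omega> \<partial>M) = 0"
    and variance: "\<sigma>\<^sup>2 = (\<integral>\<omega>. (\<eta> 1 \<omega>)\<^sup>2 \<partial>M)" and sigma_pos: "\<sigma> > 0"
    and summable: "summable (\<lambda>j. \<bar>\<psi> j\<bar>)"
    and A: "A = (\<Sum>j. \<psi> j)" and A_nonzero: "A \<noteq> 0"
    and X: "X = linear_process \<psi> \<eta>"
    and Y: "\<And>n j \<omega>. Y n j \<omega> = \<mu> n j + X (int j) \<omega>"
    and T: "\<And>n \<omega>. T n \<omega> = test_statistic p n (\<lambda>j. Y n j \<omega>)"
    and null: "\<And>n j. 1 \<le> j \<Longrightarrow> j \<le> n \<Longrightarrow> \<mu> n j = 0"
    and W: "wiener_process N W"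
  shows "(AE \<omega> in N. p_variation p (\<lambda>t. W t \<omega>) < \<infinity>) \<and>
    converges_in_distribution
      M (\<lambda>n \<omega>. real n powr (- 1 / 2) * inverse \<bar>A\<bar> * inverse \<sigma> * T n \<omega>)
      N (\<lambda>\<omega>. enn2real (p_variation p (\<lambda>t. W t \<omega>)))"
proof -
  interpret short_memory M \<eta> \<sigma> \<psi>
    by (intro short_memory.intro iid_noise.intro iid_noise_axioms.intro short_memory_axioms.intro) fact+
  interpret w: wiener N W by standard fact
  have p1: "p \<ge> 1" using p by simp
  define Z where "Z n \<omega> = test_statistic p n (\<lambda>i. linear_process \<psi> \<eta> (int i) \<omega>) / (\<bar>A\<bar> * \<sigma> * sqrt n)" for n \<omega>
  have Z: "real n powr (- 1 / 2) * inverse \<bar>A\<bar> * inverse \<sigma> * T n \<omega> = Z n \<omega>" for n \<omega>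
  proof -
    have "T n \<omega> = test_statistic p n (\<lambda>i. linear_process \<psi> \<eta> (int i) \<omega>)"
      unfolding T by (intro test_statistic_cong) (simp add: Y X null)
    \<comment> \<open>This includes n = 0, where both sides are 0.\<close>
    moreover have "real n powr (- 1 / 2) = inverse (sqrt n)"
      using powr_minus[of "real n" "1 / 2"] by (simp add: powr_half_sqrt)
    ultimately show ?thesis by (simp add: Z_def field_simps)
  qed
  have [measurable]: "Z n \<in> borel_measurable M" for n
    unfolding Z_def by (intro borel_measurable_divide borel_measurable_test_statistic p1) auto
  have [measurable]: "(\<lambda>\<omega>. enn2real (p_variation p (\<lambda>t. W t \<omega>))) \<in> borel_measurable N"
    using w.measurable_p_variation[OF p1] by measurable
  have "weak_conv_m (\<lambda>n. distr M borel (Z n)) (distr N borel (\<lambda>\<omega>. enn2real (p_variation p (\<lambda>t. W t \<omega>))))"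
  proof (rule levy_continuity)
    show "real_distribution (distr M borel (Z n))" for n by (rule real_distribution_distr) simp
    show "real_distribution (distr N borel (\<lambda>\<omega>. enn2real (p_variation p (\<lambda>t. W t \<omega>))))"
      by (rule w.real_distribution_distr) simp
    show "(\<lambda>n. char (distr M borel (Z n)) t) \<longlonglongrightarrow> char (distr N borel (\<lambda>\<omega>. enn2real (p_variation p (\<lambda>t. W t \<omega>)))) t" for t
      using char_test_statistic_tendsto[OF p _ W, of t] A_nonzero
      by (simp add: char_distr w.char_distr) (simp add: Z_def A)
  qed
  then show ?thesis
    unfolding converges_in_distribution_def Z using w.p_variation_finite[OF p] by simp
qed

end
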